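(* Let $\Gamma$ be a discrete group with the AP. Let $A\subset B$ be an inclusion of $\Gamma$-C$^\ast$-algebras. Assume that the inclusion is centrally $\Gamma$-free. Then the map $$D\mapsto D\rtimes_{\mathrm r}\Gamma$$ gives a lattice isomorphism between the lattice of intermediate $\Gamma$-C$^\ast$-algebras $D$ of $A\subset B$ and the lattice of intermediate C$^\ast$-algebras of $A\rtimes_{\mathrm r}\Gamma\subset B\rtimes_{\mathrm r}\Gamma$.
   Context: For a C$^\ast$-algebra $A$, $\ell^2(A)$ is the set of sequences $a=(a_i)_{i=1}^\infty\in A^{\mathbb N}$ such that $\sum_i a_i^\ast a_i$ converges in norm, with norm $\|a\|_2=\|\sum_i a_i^\ast a_i\|^{1/2}$; $\ell^2(A)_1$ is the set of $a\in\ell^2(A)$ with $\|a\|_2\le1$. For $a,b\in\ell^2(A)$ and $c\in A$: $a^\ast b:=\sum_i a_i^\ast b_i\in A$, $ac:=(a_ic)_i$, $ca:=(ca_i)_i$. If $A$ is a $\Gamma$-C$^\ast$-algebra, $\Gamma$ acts on $\ell^2(A)$ pointwise. An inclusion $A\subset B$ of $\Gamma$-C$^\ast$-algebras (i.e. $A$ is a $\Gamma$-invariant C$^\ast$-subalgebra of $B$) is centrally $\Gamma$-free if for any $b,c\in B$, $\epsilon>0$, $s\in\Gamma\setminus\{e\}$, there is $a\in\ell^2(A)_1\subset\ell^2(B)$ with $\|a^\ast b a-b\|<\epsilon$ and $\|a^\ast c\,s(a)\|<\epsilon$. AP (approximation property of Haagerup–Kraus): let $M_0A(\Gamma)$ be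 the Banach space of completely bounded (Herz–Schur) multipliers of $\Gamma$; it is the dual of the Banach space $Q(\Gamma)$ obtained by completing $\ell^1(\Gamma)$ in the norm $\|f\|_Q=\sup\{|\sum_s f(s)\varphi(s)|:\|\varphi\|_{M_0A}\le1\}$. $\Gamma$ has the AP if the constant function $1$ lies in the $\sigma(M_0A(\Gamma),Q(\Gamma))$-closure of the finitely supported functions. Intermediate $\Gamma$-C$^\ast$-algebras of $A\subset B$ are $\Gamma$-invariant C$^\ast$-algebras $D$ with $A\subset D\subset B$. Lattice operations are generated C$^\ast$-algebra and intersection. $\rtimes_{\mathrm r}$ is the reduced crossed product. *)

theory Defs
  imports "HOL-Analysis.Analysis" "HOL-Library.FuncSet"
begin

section \<open>C*-algebras and group actions\<close>

text \<open>Abstract, not necessarily unital, complex C*-algebras (the zero algebra is allowed).\<close>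

class cstar_algebra = real_normed_algebra + complete_space +
  fixes scaleC :: "complex \<Rightarrow> 'a \<Rightarrow> 'a"
    and star :: "'a \<Rightarrow> 'a"
  assumes scaleC_add_right: "scaleC z (x + y) = scaleC z x + scaleC z y"
    and scaleC_add_left: "scaleC (z + w) x = scaleC z x + scaleC w x"
    and scaleC_scaleC: "scaleC z (scaleC w x) = scaleC (z * w) x"
    and scaleC_of_real: "scaleC (complex_of_real r) x = r *\<^sub>R x"
    and norm_scaleC: "norm (scaleC z x) = cmod z * norm x"
    and mult_scaleC_left: "scaleC z x * y = scaleC z (x * y)"
    and mult_scaleC_right: "x * scaleC z y = scaleC z (x * y)"
    and star_star: "star (star x) = x"
    and star_add: "star (x + y) = star x + star y"
    and star_scaleC: "star (scaleC z x) = scaleC (cnj z) (star x)"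
    and star_mult: "star (x * y) = star y * star x"
    and cstar_identity: "norm (star x * x) = (norm x)\<^sup>2"

instantiation complex :: cstar_algebra
begin

definition scaleC_complex :: "complex \<Rightarrow> complex \<Rightarrow> complex"
  where "scaleC_complex z w = z * w"

definition star_complex :: "complex \<Rightarrow> complex"
  where "star_complex z = cnj z"

instance
  by standard
    (simp_all add: scaleC_complex_def star_complex_def algebra_simps norm_mult
      scaleR_conv_of_real power2_eq_square)

end

definition cstar_subalgebra :: "'b::cstar_algebra set \<Rightarrow> bool"
  where "cstar_subalgebra D \<longleftrightarrow>
    0 \<in> D \<and>
    (\<forall>x\<in>D. \<forall>y\<in>D. x + y \<in> D \<and> x * y \<in> D) \<and>
    (\<forall>z. \<forall>x\<in>D. scaleC z x \<in> D) \<and>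
    (\<forall>x\<in>D. star x \<in> D) \<and>
    closed D"

definition cstar_generated :: "'b::cstar_algebra set \<Rightarrow> 'b set"
  where "cstar_generated X = \<Inter>{D. cstar_subalgebra D \<and> X \<subseteq> D}"

definition star_hom :: "('b::cstar_algebra \<Rightarrow> 'b) \<Rightarrow> bool"
  where "star_hom f \<longleftrightarrow>
    (\<forall>x y. f (x + y) = f x + f y) \<and>
    (\<forall>x y. f (x * y) = f x * f y) \<and>
    (\<forall>z x. f (scaleC z x) = scaleC z (f x)) \<and>
    (\<forall>x. f (star x) = star (f x))"

text \<open>
  The discrete group is the whole of a type of class \<open>group_add\<close> (not assumed commutative), so
  the product \<open>st\<close> is written \<open>s + t\<close>, the inverse of \<open>s\<close> is \<open>- s\<close> and the neutral element is \<open>0\<close>.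
  The last two clauses below make every \<open>\<alpha> s\<close> bijective, hence a *-automorphism.
\<close>

definition cstar_action :: "('g::group_add \<Rightarrow> 'b::cstar_algebra \<Rightarrow> 'b) \<Rightarrow> bool"
  where "cstar_action \<alpha> \<longleftrightarrow>
    (\<forall>s. star_hom (\<alpha> s)) \<and>
    (\<forall>x. \<alpha> 0 x = x) \<and>
    (\<forall>s t x. \<alpha> (s + t) x = \<alpha> s (\<alpha> t x))"

definition action_invariant :: "('g \<Rightarrow> 'b \<Rightarrow> 'b) \<Rightarrow> 'b set \<Rightarrow> bool"
  where "action_invariant \<alpha> D \<longleftrightarrow> (\<forall>s. \<forall>x\<in>D. \<alpha> s x \<in> D)"

section \<open>Centrally free inclusions\<close>

definition ell2_seq :: "'b::cstar_algebra set \<Rightarrow> (nat \<Rightarrow> 'b) set"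
  where "ell2_seq A = {a. (\<forall>i. a i \<in> A) \<and> summable (\<lambda>i. star (a i) * a i)}"

definition star_prod :: "(nat \<Rightarrow> 'b::cstar_algebra) \<Rightarrow> (nat \<Rightarrow> 'b) \<Rightarrow> 'b"
  where "star_prod a b = (\<Sum>i. star (a i) * b i)"

definition ell2_seq_norm :: "(nat \<Rightarrow> 'b::cstar_algebra) \<Rightarrow> real"
  where "ell2_seq_norm a = sqrt (norm (\<Sum>i. star (a i) * a i))"

definition centrally_free :: "('g::group_add \<Rightarrow> 'b::cstar_algebra \<Rightarrow> 'b) \<Rightarrow> 'b set \<Rightarrow> bool"
  where "centrally_free \<alpha> A \<longleftrightarrow>
    (\<forall>b c. \<forall>\<epsilon>>0. \<forall>s. s \<noteq> 0 \<longrightarrow>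
      (\<exists>a\<in>ell2_seq A. ell2_seq_norm a \<le> 1 \<and>
        norm (star_prod a (\<lambda>i. b * a i) - b) < \<epsilon> \<and>
        norm (star_prod a (\<lambda>i. c * \<alpha> s (a i))) < \<epsilon>))"

section \<open>Adjointable operators on the Hilbert module of square-summable functions\<close>

text \<open>
  \<open>ell2\<close> is the right Hilbert module of square-summable families with entries in the
  C*-algebra \<open>'b\<close>, with inner product \<open>ell2_inner\<close> (linear in the second variable).
  Operators on it are extensional functions, so that equality of operators is plain equality.
\<close>

definition ell2 :: "('g \<Rightarrow> 'b::cstar_algebra) set"
  where "ell2 = {\<xi>. (\<lambda>t. star (\<xi> t) * \<xi> t) summable_on UNIV}"

definition ell2_inner :: "('g \<Rightarrow> 'b::cstar_algebra) \<Rightarrow> ('g \<Rightarrow> 'b) \<Rightarrow> 'b"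
  where "ell2_inner \<xi> \<eta> = (\<Sum>\<^sub>\<infinity>t. star (\<xi> t) * \<eta> t)"

definition ell2_norm :: "('g \<Rightarrow> 'b::cstar_algebra) \<Rightarrow> real"
  where "ell2_norm \<xi> = sqrt (norm (ell2_inner \<xi> \<xi>))"

type_synonym ('g, 'b) op = "('g \<Rightarrow> 'b) \<Rightarrow> ('g \<Rightarrow> 'b)"

definition is_adjoint :: "('g, 'b::cstar_algebra) op \<Rightarrow> ('g, 'b) op \<Rightarrow> bool"
  where "is_adjoint T S \<longleftrightarrow>
    (\<forall>\<xi>\<in>ell2. \<forall>\<eta>\<in>ell2. ell2_inner (T \<xi>) \<eta> = ell2_inner \<xi> (S \<eta>))"

text \<open>The boundedness clause is automatic for adjointable operators; so is linearity.\<close>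

definition adjointable :: "('g, 'b::cstar_algebra) op set"
  where "adjointable =
    {T \<in> ell2 \<rightarrow>\<^sub>E ell2.
      (\<exists>S \<in> ell2 \<rightarrow>\<^sub>E ell2. is_adjoint T S) \<and>
      (\<exists>K. \<forall>\<xi>\<in>ell2. ell2_norm (T \<xi>) \<le> K * ell2_norm \<xi>)}"

definition op_zero :: "('g, 'b::cstar_algebra) op"
  where "op_zero = (\<lambda>\<xi>\<in>ell2. \<lambda>t. 0)"

definition op_add :: "('g, 'b::cstar_algebra) op \<Rightarrow> ('g, 'b) op \<Rightarrow> ('g, 'b) op"
  where "op_add S T = (\<lambda>\<xi>\<in>ell2. \<lambda>t. S \<xi> t + T \<xi> t)"

definition op_diff :: "('g, 'b::cstar_algebra) op \<Rightarrow> ('g, 'b) op \<Rightarrow> ('g, 'b) op"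
  where "op_diff S T = (\<lambda>\<xi>\<in>ell2. \<lambda>t. S \<xi> t - T \<xi> t)"

definition op_scale :: "complex \<Rightarrow> ('g, 'b::cstar_algebra) op \<Rightarrow> ('g, 'b) op"
  where "op_scale z T = (\<lambda>\<xi>\<in>ell2. \<lambda>t. scaleC z (T \<xi> t))"

definition op_norm :: "('g, 'b::cstar_algebra) op \<Rightarrow> real"
  where "op_norm T = Sup {ell2_norm (T \<xi>) | \<xi>. \<xi> \<in> ell2 \<and> ell2_norm \<xi> \<le> 1}"

definition op_cstar_subalgebra :: "('g, 'b::cstar_algebra) op set \<Rightarrow> bool"
  where "op_cstar_subalgebra C \<longleftrightarrow>
    C \<subseteq> adjointable \<and>
    op_zero \<in> C \<and>
    (\<forall>S\<in>C. \<forall>T\<in>C. op_add S T \<in> C \<and> compose ell2 S T \<in> C) \<and>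
    (\<forall>z. \<forall>T\<in>C. op_scale z T \<in> C) \<and>
    (\<forall>T\<in>C. \<exists>S\<in>C. is_adjoint T S) \<and>
    (\<forall>T\<in>adjointable. (\<forall>\<epsilon>>0. \<exists>S\<in>C. op_norm (op_diff T S) < \<epsilon>) \<longrightarrow> T \<in> C)"

definition op_cstar_generated :: "('g, 'b::cstar_algebra) op set \<Rightarrow> ('g, 'b) op set"
  where "op_cstar_generated X = \<Inter>{C. op_cstar_subalgebra C \<and> X \<subseteq> C}"

section \<open>Reduced crossed products\<close>

text \<open>
  The regular covariant representation of \<open>'b\<close> and the group on \<open>ell2\<close>; it satisfies
  \<open>\<lambda>\<^sub>s \<pi>(b) \<lambda>\<^sub>s\<^sup>* = \<pi>(\<alpha>\<^sub>s(b))\<close>.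
\<close>

definition coeff_op :: "('g::group_add \<Rightarrow> 'b::cstar_algebra \<Rightarrow> 'b) \<Rightarrow> 'b \<Rightarrow> ('g, 'b) op"
  where "coeff_op \<alpha> b = (\<lambda>\<xi>\<in>ell2. \<lambda>t. \<alpha> (- t) b * \<xi> t)"

definition shift_op :: "'g::group_add \<Rightarrow> ('g, 'b::cstar_algebra) op"
  where "shift_op s = (\<lambda>\<xi>\<in>ell2. \<lambda>t. \<xi> (- s + t))"

text \<open>
  The algebraic crossed product of an invariant C*-subalgebra \<open>D\<close> of \<open>'b\<close>: the finite sums
  \<open>\<Sum>\<^sub>s \<pi>(d\<^sub>s) \<lambda>\<^sub>s\<close> with coefficients in \<open>D\<close>.  The reduced crossed product is its norm closure.
  For \<open>D \<noteq> UNIV\<close> it is realised inside that of \<open>UNIV\<close>, through the canonical isometric inclusion.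
\<close>

definition algebraic_crossed_product ::
    "('g::group_add \<Rightarrow> 'b::cstar_algebra \<Rightarrow> 'b) \<Rightarrow> 'b set \<Rightarrow> ('g, 'b) op set"
  where "algebraic_crossed_product \<alpha> D =
    {(\<lambda>\<xi>\<in>ell2. \<lambda>t. \<Sum>s\<in>F. coeff_op \<alpha> (d s) (shift_op s \<xi>) t) | F d.
      finite F \<and> (\<forall>s\<in>F. d s \<in> D)}"

definition reduced_crossed_product ::
    "('g::group_add \<Rightarrow> 'b::cstar_algebra \<Rightarrow> 'b) \<Rightarrow> 'b set \<Rightarrow> ('g, 'b) op set"
  where "reduced_crossed_product \<alpha> D =
    {T \<in> adjointable. \<forall>\<epsilon>>0. \<exists>S\<in>algebraic_crossed_product \<alpha> D. op_norm (op_diff T S) < \<epsilon>}"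

section \<open>Completely bounded multipliers and the approximation property\<close>

definition reduced_group_algebra :: "('g::group_add, complex) op set"
  where "reduced_group_algebra = reduced_crossed_product (\<lambda>_ z. z) UNIV"

text \<open>
  The norm of an \<open>n \<times> n\<close> matrix of operators, acting on the Hilbert space direct sum of \<open>n\<close> copies
  of \<open>ell2\<close>; only the entries \<open>T i j\<close> with \<open>i, j < n\<close> matter.
\<close>

definition matrix_op_norm :: "nat \<Rightarrow> (nat \<Rightarrow> nat \<Rightarrow> ('g, complex) op) \<Rightarrow> real"
  where "matrix_op_norm n T =
    Sup {sqrt (\<Sum>i<n. (ell2_norm (\<lambda>t. \<Sum>j<n. T i j (\<xi> j) t))\<^sup>2) | \<xi>.
      (\<forall>j<n. \<xi> j \<in> ell2) \<and> sqrt (\<Sum>j<n. (ell2_norm (\<xi> j))\<^sup>2) \<le> 1}"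

definition amplification_norms ::
    "(('g::group_add, complex) op \<Rightarrow> ('g, complex) op) \<Rightarrow> real set"
  where "amplification_norms M =
    {matrix_op_norm n (\<lambda>i j. M (T i j)) | n T.
      (\<forall>i<n. \<forall>j<n. T i j \<in> reduced_group_algebra) \<and> matrix_op_norm n T \<le> 1}"

text \<open>
  \<open>M\<close> is a completely bounded map on the reduced group C*-algebra extending
  \<open>\<lambda>\<^sub>s \<mapsto> \<phi>(s) \<lambda>\<^sub>s\<close>.  There is at most one such \<open>M\<close> for a given \<open>\<phi>\<close>.
\<close>

definition cb_multiplier_map ::
    "('g::group_add \<Rightarrow> complex) \<Rightarrow> (('g, complex) op \<Rightarrow> ('g, complex) op) \<Rightarrow> bool"
  where "cb_multiplier_map \<phi> M \<longleftrightarrow>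
    M \<in> reduced_group_algebra \<rightarrow>\<^sub>E reduced_group_algebra \<and>
    (\<forall>S\<in>reduced_group_algebra. \<forall>T\<in>reduced_group_algebra.
      M (op_add S T) = op_add (M S) (M T)) \<and>
    (\<forall>z. \<forall>T\<in>reduced_group_algebra. M (op_scale z T) = op_scale z (M T)) \<and>
    (\<forall>s. M (shift_op s) = op_scale (\<phi> s) (shift_op s)) \<and>
    bdd_above (amplification_norms M)"

definition cb_multipliers :: "('g::group_add \<Rightarrow> complex) set"
  where "cb_multipliers = {\<phi>. \<exists>M. cb_multiplier_map \<phi> M}"

definition cb_multiplier_norm :: "('g::group_add \<Rightarrow> complex) \<Rightarrow> real"
  where "cb_multiplier_norm \<phi> = Sup (amplification_norms (SOME M. cb_multiplier_map \<phi> M))"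

definition ell1 :: "('g \<Rightarrow> complex) set"
  where "ell1 = {f. (\<lambda>s. cmod (f s)) summable_on UNIV}"

definition ell1_pairing :: "('g \<Rightarrow> complex) \<Rightarrow> ('g \<Rightarrow> complex) \<Rightarrow> complex"
  where "ell1_pairing f \<phi> = (\<Sum>\<^sub>\<infinity>s. f s * \<phi> s)"

definition Q_norm :: "('g::group_add \<Rightarrow> complex) \<Rightarrow> real"
  where "Q_norm f =
    Sup {cmod (ell1_pairing f \<phi>) | \<phi>. \<phi> \<in> cb_multipliers \<and> cb_multiplier_norm \<phi> \<le> 1}"

text \<open>
  Elements of the completion \<open>Q\<close> of \<open>ell1\<close> are represented by \<open>Q_norm\<close>-Cauchy sequences in \<open>ell1\<close>;
  the pairing with multipliers is extended to the completion by continuity.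
\<close>

definition Q_Cauchy :: "(nat \<Rightarrow> 'g::group_add \<Rightarrow> complex) set"
  where "Q_Cauchy =
    {f. (\<forall>n. f n \<in> ell1) \<and>
      (\<forall>\<epsilon>>0. \<exists>N. \<forall>m\<ge>N. \<forall>n\<ge>N. Q_norm (\<lambda>s. f m s - f n s) < \<epsilon>)}"

definition Q_pairing :: "(nat \<Rightarrow> 'g \<Rightarrow> complex) \<Rightarrow> ('g \<Rightarrow> complex) \<Rightarrow> complex"
  where "Q_pairing f \<phi> = lim (\<lambda>n. ell1_pairing (f n) \<phi>)"

text \<open>The topology \<open>\<sigma>(M\<^sub>0A, Q)\<close> on the space of completely bounded multipliers.\<close>

definition multiplier_topology :: "('g::group_add \<Rightarrow> complex) topology"
  where "multiplier_topology =
    topology_generated_by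
      {{\<phi> \<in> cb_multipliers. Q_pairing f \<phi> \<in> U} | f U. f \<in> Q_Cauchy \<and> open U}"

definition has_AP :: "'g::group_add itself \<Rightarrow> bool"
  where "has_AP _ \<longleftrightarrow>
    (\<lambda>s::'g. 1) \<in> multiplier_topology closure_of {\<phi>. finite {s. \<phi> s \<noteq> 0}}"

section \<open>Lattices of intermediate algebras\<close>

text \<open>The ambient algebra \<open>B\<close> is the whole type \<open>'b\<close>, so \<open>D \<subseteq> B\<close> needs no mention here.\<close>

definition intermediate_algebras ::
    "('g::group_add \<Rightarrow> 'b::cstar_algebra \<Rightarrow> 'b) \<Rightarrow> 'b set \<Rightarrow> 'b set set"
  where "intermediate_algebras \<alpha> A =
    {D. cstar_subalgebra D \<and> action_invariant \<alpha> D \<and> A \<subseteq> D}"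

definition intermediate_op_algebras ::
    "('g, 'b::cstar_algebra) op set \<Rightarrow> ('g, 'b) op set \<Rightarrow> ('g, 'b) op set set"
  where "intermediate_op_algebras P R = {C. op_cstar_subalgebra C \<and> P \<subseteq> C \<and> C \<subseteq> R}"

text \<open>The first two clauses say that the operations are defined on the respective carriers.\<close>

definition lattice_isomorphism ::
    "'x set \<Rightarrow> ('x \<Rightarrow> 'x \<Rightarrow> 'x) \<Rightarrow> ('x \<Rightarrow> 'x \<Rightarrow> 'x) \<Rightarrow>
     'y set \<Rightarrow> ('y \<Rightarrow> 'y \<Rightarrow> 'y) \<Rightarrow> ('y \<Rightarrow> 'y \<Rightarrow> 'y) \<Rightarrow> ('x \<Rightarrow> 'y) \<Rightarrow> bool"
  where "lattice_isomorphism L meet join L' meet' join' f \<longleftrightarrow>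
    (\<forall>x\<in>L. \<forall>y\<in>L. meet x y \<in> L \<and> join x y \<in> L) \<and>
    (\<forall>x\<in>L'. \<forall>y\<in>L'. meet' x y \<in> L' \<and> join' x y \<in> L') \<and>
    bij_betw f L L' \<and>
    (\<forall>x\<in>L. \<forall>y\<in>L. f (meet x y) = meet' (f x) (f y) \<and> f (join x y) = join' (f x) (f y))"

end

theory Submission
  imports Defs "HOL-Analysis.Finite_Function_Topology"
begin

text \<open>
  The coefficient algebra of an intermediate algebra \<open>C\<close> is \<open>D = {b. \<pi>(b) \<in> C}\<close>.  Compressions
  \<open>T \<mapsto> \<Sum>\<^sub>i a\<^sub>i\<^sup>* T a\<^sub>i\<close> by centrally free sequences in \<open>A\<close> are contractive, map \<open>C\<close> to itself, almost
  fix the coefficient of \<open>T\<close> at the neutral element and make finitely many others small; hence the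
  conditional expectation maps \<open>C\<close> into \<open>D\<close>, and then all Fourier coefficients of elements of \<open>C\<close>
  lie in \<open>D\<close>.  Conversely, let all coefficients of \<open>T\<close> lie in \<open>D\<close> and let a functional vanish on
  \<open>D \<rtimes> \<Gamma>\<close> but not at \<open>T\<close>.  Its values at the Fourier multiples \<open>M\<^sub>\<phi> T\<close> define an element of \<open>Q\<close>
  which annihilates the finitely supported multipliers but not the constant \<open>1\<close>; this contradicts the
  approximation property.  So \<open>C = D \<rtimes> \<Gamma>\<close>.

  Norms in \<open>'b\<close> and on the Hilbert module are computed with states.  Under a state the operator
  matrix of an element of the crossed product becomes a family of scalar matrices, to which a
  completely bounded multiplier applies as a Schur multiplier.
\<close>

text \<open>\<open>A\<close> and the ambient algebra may lack a unit, so the shifts need not belong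
  to \<open>C\<close>; only products of a shift with an element of \<open>A\<close> are sure to.
  Half of central freeness, namely that b is close to a sum of terms
  \<open>star (a i) * b * a i\<close>, takes over the role of a unit: it gives the invariance of
  \<open>D\<close> and allows a coefficient at s to be moved to the neutral element at the price of
  a factor from \<open>A\<close>.

  Knowing all coefficients of \<open>T\<close> does not give back \<open>T\<close>, since Fourier
  series need not converge in norm; this is the obstacle that the approximation property removes.
  The values of a bounded functional at the terms of a finite sum form a finitely supported function
  on the group, and its \<open>Q_norm\<close> is controlled by the norm of the sum because
  multipliers in the unit ball act contractively on sums with coefficients in the ambient algebra.
  That contractivity is where complete boundedness enters: scalar matrices of all sizes occur.
  Finite orthonormal systems modulo null vectors do the work of a Hilbert space representation
  attached to the state.\<close>

instance cstar_algebra \<subseteq> banach ..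

section \<open>Elementary rules for complex scalars and the involution\<close>

lemma scaleC_zero_right [simp]: "scaleC z (0::'a::cstar_algebra) = 0"
  using scaleC_add_right[of z 0 "0::'a"] by simp

lemma scaleC_zero_left [simp]: "scaleC 0 (x::'a::cstar_algebra) = 0"
  using scaleC_add_left[of 0 0 x] by simp

lemma scaleC_minus_right [simp]: "scaleC z (- x) = - scaleC z (x::'a::cstar_algebra)"
  using scaleC_add_right[of z x "- x"] by (simp add: eq_neg_iff_add_eq_0 add.commute)

lemma scaleC_minus_left [simp]: "scaleC (- z) x = - scaleC z (x::'a::cstar_algebra)"
  using scaleC_add_left[of z "- z" x] by (simp add: eq_neg_iff_add_eq_0 add.commute)

lemma scaleC_diff_right: "scaleC z (x - y) = scaleC z x - scaleC z (y::'a::cstar_algebra)"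
  using scaleC_add_right[of z x "- y"] by simp

lemma scaleC_one [simp]: "scaleC 1 (x::'a::cstar_algebra) = x"
  using scaleC_of_real[of 1 x] by simp

lemma scaleC_scaleR: "scaleC z (r *\<^sub>R x) = r *\<^sub>R scaleC z (x::'a::cstar_algebra)"
  by (metis scaleC_of_real scaleC_scaleC mult.commute)

lemma scaleC_sum_right: "scaleC z (sum f F) = (\<Sum>i\<in>F. scaleC z (f i :: 'a::cstar_algebra))"
  by (induction F rule: infinite_finite_induct) (auto simp: scaleC_add_right)

lemma bounded_linear_scaleC: "bounded_linear (scaleC z :: 'a::cstar_algebra \<Rightarrow> 'a)"
  by (rule bounded_linear_intro[of _ "cmod z"])
    (auto simp: scaleC_add_right scaleC_scaleR norm_scaleC mult.commute)

lemma star_zero [simp]: "star (0::'a::cstar_algebra) = 0"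
  using star_add[of 0 "0::'a"] by simp

lemma star_minus [simp]: "star (- x) = - star (x::'a::cstar_algebra)"
  using star_add[of x "- x"] by (simp add: eq_neg_iff_add_eq_0 add.commute)

lemma star_diff: "star (x - y) = star x - star (y::'a::cstar_algebra)"
  using star_add[of x "- y"] by simp

lemma star_scaleR: "star (r *\<^sub>R x) = r *\<^sub>R star (x::'a::cstar_algebra)"
  by (metis scaleC_of_real star_scaleC complex_cnj_complex_of_real)

text \<open>One factor cancels in the C*-identity, because the norm of \<open>star x * x\<close> is
  at most \<open>norm (star x) * norm x\<close>.\<close>

lemma norm_star_le: "norm (x::'a::cstar_algebra) \<le> norm (star x)"
proof (cases "x = 0")
  case False
  have "norm x * norm x \<le> norm (star x) * norm x"
    using norm_mult_ineq[of "star x" x] by (simp add: cstar_identity power2_eq_square)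
  then show ?thesis using False by simp
qed simp

lemma norm_star [simp]: "norm (star x) = norm (x::'a::cstar_algebra)"
  using norm_star_le[of x] norm_star_le[of "star x"] by (simp add: star_star)

lemma bounded_linear_star: "bounded_linear (star :: 'a::cstar_algebra \<Rightarrow> 'a)"
  by (rule bounded_linear_intro[of _ 1]) (auto simp: star_add star_scaleR)

lemma star_one [simp]: "star (1::'a::{cstar_algebra,real_normed_algebra_1}) = 1"
proof -
  have "star (star (1::'a)) = star (star 1 * 1)" by simp
  also have "\<dots> = star 1 * star (star (1::'a))" by (rule star_mult)
  finally show ?thesis by (simp add: star_star)
qed

lemma star_mult_self_eq_0: "star x * x = 0 \<longleftrightarrow> x = (0::'a::cstar_algebra)"
  using cstar_identity[of x] by auto

section \<open>Positive elements of a unital C*-algebra\<close>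

text \<open>The square root comes from the iteration \<open>y' = (x + y\<^sup>2)/2\<close>, whose increments are
  dominated by those of the scalar iteration at \<open>x = 1\<close>; this avoids spectral theory.\<close>

primrec sqrt_iter :: "'a::real_normed_algebra_1 \<Rightarrow> nat \<Rightarrow> 'a" where
  "sqrt_iter x 0 = 0"
| "sqrt_iter x (Suc n) = (1/2) *\<^sub>R (x + sqrt_iter x n * sqrt_iter x n)"

lemma sqrt_iter_commutes: "z * x = x * z \<Longrightarrow> z * sqrt_iter x n = sqrt_iter x n * z"
proof (induction n)
  case (Suc n)
  then have "z * (sqrt_iter x n * sqrt_iter x n) = sqrt_iter x n * sqrt_iter x n * z"
    by (metis mult.assoc)
  then show ?case using Suc by (simp add: algebra_simps)
qed simp

lemma sqrt_iter_real_bounds: "0 \<le> sqrt_iter (1::real) n \<and> sqrt_iter (1::real) n \<le> 1"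
proof (induction n)
  case (Suc n)
  then have "sqrt_iter (1::real) n * sqrt_iter 1 n \<le> 1 * 1" by (intro mult_mono) auto
  then show ?case using Suc by auto
qed simp

lemma sqrt_iter_norm:
  assumes "norm x \<le> 1"
  shows "norm (sqrt_iter x n) \<le> sqrt_iter 1 n"
proof (induction n)
  case (Suc n)
  have "norm (sqrt_iter x n * sqrt_iter x n) \<le> sqrt_iter 1 n * sqrt_iter 1 n"
    by (rule order_trans[OF norm_mult_ineq]) (use Suc in \<open>intro mult_mono; simp add: sqrt_iter_real_bounds\<close>)
  then have "norm (x + sqrt_iter x n * sqrt_iter x n) \<le> 1 + sqrt_iter 1 n * sqrt_iter 1 n"
    using assms norm_triangle_ineq[of x "sqrt_iter x n * sqrt_iter x n"] by linarith
  then show ?case by simp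
qed simp

text \<open>Consecutive iterates commute, so their difference of squares factors as (a - b)(a + b).
  Submultiplicativity compares it with the same factorization of the scalar iteration, where
  equality holds.\<close>

lemma sqrt_iter_increment:
  assumes "norm x \<le> 1"
  shows "norm (sqrt_iter x (Suc n) - sqrt_iter x n) \<le> sqrt_iter 1 (Suc n) - sqrt_iter 1 n"
proof (induction n)
  case 0
  then show ?case using assms by simp
next
  case (Suc n)
  let ?a = "sqrt_iter x (Suc n)" and ?b = "sqrt_iter x n"
  let ?s = "sqrt_iter (1::real) (Suc n)" and ?t = "sqrt_iter (1::real) n"
  have comm: "?b * ?a = ?a * ?b"
    by (rule sqrt_iter_commutes) (simp add: sqrt_iter_commutes)
  have eq: "sqrt_iter x (Suc (Suc n)) - ?a = (1/2) *\<^sub>R ((?a - ?b) * (?a + ?b))"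
  proof -
    have "sqrt_iter x (Suc (Suc n)) - ?a = (1/2) *\<^sub>R (x + ?a * ?a) - (1/2) *\<^sub>R (x + ?b * ?b)"
      by (metis sqrt_iter.simps(2))
    also have "\<dots> = (1/2) *\<^sub>R (?a * ?a - ?b * ?b)"
      by (simp only: scaleR_diff_right[symmetric]) simp
    also have "?a * ?a - ?b * ?b = (?a - ?b) * (?a + ?b)"
      using comm by (simp only: ring_distribs) simp
    finally show ?thesis .
  qed
  have sum: "norm (?a + ?b) \<le> ?s + ?t"
    using sqrt_iter_norm[OF assms, of "Suc n"] sqrt_iter_norm[OF assms, of n]
      norm_triangle_ineq[of ?a ?b] by linarith
  have "norm (sqrt_iter x (Suc (Suc n)) - ?a) \<le> (1/2) * (norm (?a - ?b) * norm (?a + ?b))"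
    unfolding eq using norm_mult_ineq[of "?a - ?b" "?a + ?b"] by simp
  also have "\<dots> \<le> (1/2) * ((?s - ?t) * (?s + ?t))"
    by (intro mult_left_mono mult_mono Suc sum norm_ge_zero order_trans[OF norm_ge_zero Suc]) simp
  also have "\<dots> = (1/2) * (1 + ?s * ?s) - (1/2) * (1 + ?t * ?t)" by (simp only: ring_distribs) simp
  also have "\<dots> = sqrt_iter 1 (Suc (Suc n)) - ?s" by simp
  finally show ?case .
qed

lemma sqrt_iter_diff:
  assumes "norm x \<le> 1" "m \<le> n"
  shows "norm (sqrt_iter x n - sqrt_iter x m) \<le> sqrt_iter 1 n - sqrt_iter 1 m"
  using assms(2)
proof (induction n rule: dec_induct)
  case (step n)
  then show ?case
    using sqrt_iter_increment[OF assms(1), of n]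
      norm_triangle_ineq[of "sqrt_iter x (Suc n) - sqrt_iter x n" "sqrt_iter x n - sqrt_iter x m"]
    by simp
qed simp

text \<open>The limit y of the iteration solves y = (x + y^2)/2, which is (1 - y)^2 = 1 - x.
  Commutation and self-adjointness hold for every iterate and pass to the limit; the bound on y is
  what later makes 1 - y positive.\<close>

lemma exists_one_minus_sqrt:
  fixes x :: "'a::{cstar_algebra,real_normed_algebra_1}"
  assumes x: "norm x \<le> 1"
  obtains y where "norm y \<le> 1" "(1 - y) * (1 - y) = 1 - x"
    "\<And>z. z * x = x * z \<Longrightarrow> z * y = y * z" "star x = x \<Longrightarrow> star y = y"
proof -
  \<comment> \<open>Monotonicity of the scalar iteration is a by-product of the comparison estimate,
    which bounds a norm by the difference of two scalar iterates.\<close>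
  have mono: "sqrt_iter (1::real) m \<le> sqrt_iter 1 n" if "m \<le> n" for m n
    using order_trans[OF norm_ge_zero sqrt_iter_diff[OF _ that, of "1::real"]] by simp
  have "convergent (sqrt_iter (1::real))"
    by (rule Bseq_monoseq_convergent)
      (auto intro!: BseqI'[of _ 1] incseq_imp_monoseq mono simp: sqrt_iter_real_bounds incseq_def)
  then have "Cauchy (sqrt_iter (1::real))" by (rule convergent_Cauchy)
  have "Cauchy (sqrt_iter x)"
  proof (rule metric_CauchyI)
    fix e :: real assume "0 < e"
    from metric_CauchyD[OF \<open>Cauchy (sqrt_iter (1::real))\<close> this]
    obtain M where M: "\<And>m n. m \<ge> M \<Longrightarrow> n \<ge> M \<Longrightarrow> dist (sqrt_iter (1::real) m) (sqrt_iter 1 n) < e"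
      by auto
    have "dist (sqrt_iter x m) (sqrt_iter x n) < e" if "m \<ge> M" "n \<ge> M" for m n
    proof (cases "m \<le> n")
      case True
      then show ?thesis using sqrt_iter_diff[OF x True] M[OF that] mono[OF True]
        by (simp add: dist_norm norm_minus_commute)
    next
      case False
      then have "n \<le> m" by simp
      then show ?thesis using sqrt_iter_diff[OF x \<open>n \<le> m\<close>] M[OF that] mono[OF \<open>n \<le> m\<close>]
        by (simp add: dist_norm)
    qed
    then show "\<exists>M. \<forall>m\<ge>M. \<forall>n\<ge>M. dist (sqrt_iter x m) (sqrt_iter x n) < e" by blast
  qed
  then obtain y where y: "sqrt_iter x \<longlonglongrightarrow> y"
    using Cauchy_convergent convergent_def by blast
  have "(\<lambda>n. (1/2) *\<^sub>R (x + sqrt_iter x n * sqrt_iter x n)) \<longlonglongrightarrow> (1/2) *\<^sub>R (x + y * y)"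
    by (intro tendsto_intros y)
  moreover have "(\<lambda>n. (1/2) *\<^sub>R (x + sqrt_iter x n * sqrt_iter x n)) \<longlonglongrightarrow> y"
    using LIMSEQ_Suc[OF y] by simp
  ultimately have "y = (1/2) *\<^sub>R (x + y * y)" using LIMSEQ_unique by blast
  then have "2 *\<^sub>R y = 2 *\<^sub>R ((1/2) *\<^sub>R (x + y * y))" by simp
  then have yy: "y + y = x + y * y" by (simp add: scaleR_2)
  show ?thesis
  proof
    show "norm y \<le> 1"
      by (rule LIMSEQ_le_const2[OF tendsto_norm[OF y]])
        (use sqrt_iter_norm[OF x] sqrt_iter_real_bounds in \<open>auto intro: order_trans\<close>)
    show "(1 - y) * (1 - y) = 1 - x" using yy by (simp add: algebra_simps)
    show "z * y = y * z" if "z * x = x * z" for z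
    proof -
      have "(\<lambda>n. z * sqrt_iter x n) \<longlonglongrightarrow> z * y" "(\<lambda>n. sqrt_iter x n * z) \<longlonglongrightarrow> y * z"
        by (intro tendsto_intros y)+
      then show ?thesis using sqrt_iter_commutes[OF that] LIMSEQ_unique by auto
    qed
    show "star y = y" if "star x = x"
    proof -
      have "star (sqrt_iter x n) = sqrt_iter x n" for n
        by (induction n) (auto simp: star_scaleR star_add star_mult that)
      then show ?thesis
        using bounded_linear.tendsto[OF bounded_linear_star y] y LIMSEQ_unique by auto
    qed
  qed
qed

text \<open>For self-adjoint k the inequality says that the spectrum lies in the interval from 0 to
  2r. In this form sums are immediate, and dividing by r brings k into the range of the square root
  iteration.\<close>

definition pos_elem :: "'a::{cstar_algebra,real_normed_algebra_1} \<Rightarrow> bool" where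
  "pos_elem k \<longleftrightarrow> star k = k \<and> (\<exists>r\<ge>0. norm (of_real r - k) \<le> r)"

section \<open>The cone of positive elements and its order\<close>

lemma star_of_real [simp]: "star (of_real r :: 'a::{cstar_algebra,real_normed_algebra_1})
    = of_real r"
  by (simp add: of_real_def star_scaleR)

lemma pos_elem_of_real: "r \<ge> 0 \<Longrightarrow> pos_elem (of_real r)"
  unfolding pos_elem_def by auto

lemma pos_elem_0 [simp]: "pos_elem 0"
  using pos_elem_of_real[of 0] by simp

lemma pos_elem_add:
  assumes "pos_elem a" "pos_elem b" shows "pos_elem (a + b)"
proof -
  obtain r where r: "r \<ge> 0" "norm (of_real r - a) \<le> r" using assms pos_elem_def by blast
  obtain s where s: "s \<ge> 0" "norm (of_real s - b) \<le> s" using assms pos_elem_def by blast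
  have eq: "of_real (r + s) - (a + b) = (of_real r - a) + (of_real s - b)" by simp
  have "norm (of_real (r + s) - (a + b)) \<le> r + s"
    unfolding eq using r s norm_triangle_ineq[of "of_real r - a" "of_real s - b"] by linarith
  then show ?thesis using assms r s unfolding pos_elem_def
    by (auto simp: star_add intro!: exI[of _ "r + s"])
qed

lemma pos_elem_scaleR:
  assumes "pos_elem a" "t \<ge> 0" shows "pos_elem (t *\<^sub>R a)"
proof -
  obtain r where r: "r \<ge> 0" "norm (of_real r - a) \<le> r" using assms pos_elem_def by blast
  have "of_real (t * r) - t *\<^sub>R a = t *\<^sub>R (of_real r - a)"
    by (simp add: scaleR_diff_right of_real_def)
  then have "norm (of_real (t * r) - t *\<^sub>R a) \<le> t * r"
    using r assms by (simp add: mult_left_mono)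
  then show ?thesis using assms r unfolding pos_elem_def
    by (auto simp: star_scaleR intro!: exI[of _ "t * r"])
qed

text \<open>With x = 1 - k/r of norm at most 1, the root is sqrt r times 1 - y, where (1 - y)^2 = 1
  - x. It inherits the commutation relations of k, the substitute for lying in the closed algebra
  generated by k.\<close>

lemma pos_elem_sqrt:
  assumes "pos_elem k"
  obtains l where "star l = l" "k = l * l" "pos_elem l" "\<And>z. z * k = k * z \<Longrightarrow> z * l = l * z"
proof -
  obtain r where r: "r \<ge> 0" "norm (of_real r - k) \<le> r" using assms pos_elem_def by blast
  show ?thesis
  proof (cases "r = 0")
    case True
    then have "k = 0" using r by simp
    then show ?thesis using that[of 0] by simp
  next
    case False
    then have rp: "r > 0" using r by simp
    define x where "x = 1 - (1/r) *\<^sub>R k"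
    have "x = (1/r) *\<^sub>R (of_real r - k)"
      using rp by (simp add: x_def scaleR_diff_right of_real_def)
    then have "norm x \<le> 1" using r rp by (simp add: divide_le_eq)
    then obtain y where y: "norm y \<le> 1" "(1 - y) * (1 - y) = 1 - x"
      "\<And>z. z * x = x * z \<Longrightarrow> z * y = y * z" "star x = x \<Longrightarrow> star y = y"
      by (rule exists_one_minus_sqrt) blast
    have sx: "star x = x" using assms by (simp add: x_def star_diff star_scaleR pos_elem_def)
    define l where "l = sqrt r *\<^sub>R (1 - y)"
    show ?thesis
    proof
      show sl: "star l = l" using y(4)[OF sx] by (simp add: l_def star_scaleR star_diff)
      show "k = l * l" using rp y(2) by (simp add: l_def x_def)
      have "of_real (sqrt r) - l = sqrt r *\<^sub>R y"
        by (simp add: l_def scaleR_diff_right of_real_def)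
      then have "norm (of_real (sqrt r) - l) \<le> sqrt r"
        using y(1) rp by (simp add: mult_left_le)
      then show "pos_elem l" using sl rp unfolding pos_elem_def by (auto intro!: exI[of _ "sqrt r"])
      show "z * l = l * z" if "z * k = k * z" for z
      proof -
        have "z * x = x * z" using that by (simp add: x_def algebra_simps)
        then show ?thesis using y(3)[of z] by (simp add: l_def algebra_simps)
      qed
    qed
  qed
qed

text \<open>With \<open>v\<^sup>2 = 1 - h\<^sup>2\<close>, the element \<open>h + i v\<close> is unitary.\<close>

lemma norm_le_of_squares_sum_one:
  fixes h v :: "'a::{cstar_algebra,real_normed_algebra_1}"
  assumes h: "star h = h" and v: "star v = v" and hv: "h * v = v * h" and eq: "h * h + v * v = 1"
  shows "norm h \<le> 1" "norm v \<le> 1"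
proof -
  define u where "u = h + scaleC \<i> v"
  have su: "star u = h - scaleC \<i> v"
    using h v by (simp add: u_def star_add star_scaleC)
  have "star u * u = h * h + v * v"
    unfolding su unfolding u_def
    by (simp add: algebra_simps scaleC_scaleC mult_scaleC_left mult_scaleC_right hv scaleC_diff_right)
  then have "(norm u)\<^sup>2 = 1" using cstar_identity[of u] eq by simp
  then have "norm u = 1" using norm_ge_zero[of u] by (auto simp: power2_eq_1_iff)
  moreover have "2 *\<^sub>R h = u + star u" by (simp add: su) (simp add: u_def scaleR_2)
  then have "2 * norm h \<le> norm u + norm u"
    by (metis norm_scaleR norm_star norm_triangle_ineq abs_numeral)
  moreover have "2 *\<^sub>R scaleC \<i> v = u - star u" by (simp add: su) (simp add: u_def scaleR_2)
  then have "2 * norm (scaleC \<i> v) \<le> norm u + norm u"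
    by (metis norm_scaleR norm_star norm_triangle_ineq4 abs_numeral)
  ultimately show "norm h \<le> 1" "norm v \<le> 1" by (simp_all add: norm_scaleC)
qed

text \<open>A self-adjoint root v of 1 - h h commutes with h, so v is the partner of h in
  \<open>norm_le_of_squares_sum_one\<close>; hence v and v v are contractions.\<close>

lemma norm_one_minus_square:
  fixes h :: "'a::{cstar_algebra,real_normed_algebra_1}"
  assumes h: "star h = h" and n: "norm h \<le> 1"
  shows "norm (1 - h * h) \<le> 1"
proof -
  have "norm (h * h) \<le> 1"
    using order_trans[OF norm_mult_ineq mult_mono[OF n n]] by simp
  then obtain y where y: "(1 - y) * (1 - y) = 1 - h * h"
      "\<And>z. z * (h * h) = h * h * z \<Longrightarrow> z * y = y * z" "star (h * h) = h * h \<Longrightarrow> star y = y"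
    by (rule exists_one_minus_sqrt) blast
  have "star y = y" using y(3) h by (simp add: star_mult)
  moreover have "h * y = y * h" using y(2)[of h] by (simp add: mult.assoc)
  ultimately have "norm (1 - y) \<le> 1"
    using norm_le_of_squares_sum_one(2)[of h "1 - y"] h y(1) by (simp add: star_diff algebra_simps)
  then show ?thesis
    using order_trans[OF norm_mult_ineq[of "1 - y" "1 - y"] mult_mono[of _ 1 _ 1]] y(1) by simp
qed

lemma norm_of_real_minus_square:
  fixes l :: "'a::{cstar_algebra,real_normed_algebra_1}"
  assumes "star l = l" and "(norm l)\<^sup>2 \<le> r"
  shows "norm (of_real r - l * l) \<le> r"
proof (cases "r = 0")
  case True
  then show ?thesis using assms by simp
next
  case False
  have "r \<ge> 0" using assms(2) by (meson order_trans zero_le_power2)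
  then have rp: "r > 0" using False by simp
  have "norm l \<le> sqrt r" using assms(2) real_le_rsqrt by blast
  then have "norm ((1 / sqrt r) *\<^sub>R l) \<le> 1" using rp by (simp add: divide_le_eq)
  then have "norm (1 - ((1 / sqrt r) *\<^sub>R l) * ((1 / sqrt r) *\<^sub>R l)) \<le> 1"
    by (intro norm_one_minus_square) (simp_all add: star_scaleR assms)
  then have "norm (1 - (1/r) *\<^sub>R (l * l)) \<le> 1" using rp by simp
  moreover have "of_real r - l * l = r *\<^sub>R (1 - (1/r) *\<^sub>R (l * l))"
    using rp by (simp add: scaleR_diff_right of_real_def)
  ultimately show ?thesis using rp by simp
qed

lemma pos_elem_square: "star l = l \<Longrightarrow> pos_elem (l * l)"
  using norm_of_real_minus_square[of l "(norm l)\<^sup>2"] unfolding pos_elem_def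
  by (auto simp: star_mult intro!: exI[of _ "(norm l)\<^sup>2"])

text \<open>Turns the unspecified radius of \<open>pos_elem\<close> into any bound of the norm, by
  passing through a square root.\<close>

lemma pos_elem_bound:
  assumes "pos_elem k" "norm k \<le> r"
  shows "norm (of_real r - k) \<le> r"
proof -
  obtain l where l: "star l = l" "k = l * l" using pos_elem_sqrt[OF assms(1)] by blast
  then have "norm k = (norm l)\<^sup>2" using cstar_identity[of l] by simp
  then show ?thesis using norm_of_real_minus_square[OF l(1)] assms(2) l(2) by simp
qed

lemma pos_elem_of_real_minus:
  assumes "star k = k" "norm k \<le> r"
  shows "pos_elem (of_real r - k)"
  using assms order_trans[OF norm_ge_zero assms(2)]
  unfolding pos_elem_def by (auto simp: star_diff intro!: exI[of _ r])

text \<open>The elements a and r - a have commuting self-adjoint roots l and m. Divided by sqrt r,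
  their squares add up to 1, so l / sqrt r is a contraction. The division needs r > 0; adding an
  epsilon to r covers r = 0.\<close>

lemma pos_elem_le_of_real:
  assumes a: "pos_elem a" and b: "pos_elem (of_real r - a)" and r: "r \<ge> 0"
  shows "norm a \<le> r"
proof -
  have *: "norm a \<le> r" if b: "pos_elem (of_real r - a)" and rp: "r > 0" for r
  proof -
    obtain m where m: "star m = m" "of_real r - a = m * m"
      "\<And>z. z * (of_real r - a) = (of_real r - a) * z \<Longrightarrow> z * m = m * z"
      using pos_elem_sqrt[OF b] by metis
    obtain l where l: "star l = l" "a = l * l" using pos_elem_sqrt[OF a] by metis
    have "l * (of_real r - a) = (of_real r - a) * l"
      by (simp add: l(2) algebra_simps) (simp add: of_real_def)
    then have lm: "l * m = m * l" by (rule m(3))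
    have sum: "l * l + m * m = of_real r" using m(2) l(2) by (metis diff_add_cancel add.commute)
    let ?c = "1 / sqrt r"
    have "norm (?c *\<^sub>R l) \<le> 1"
    proof (rule norm_le_of_squares_sum_one(1))
      have "(?c *\<^sub>R l) * (?c *\<^sub>R l) + (?c *\<^sub>R m) * (?c *\<^sub>R m) = (1/r) *\<^sub>R (l * l + m * m)"
        using rp by (simp add: scaleR_add_right)
      also have "\<dots> = 1" using rp sum by (simp add: of_real_def)
      finally show "(?c *\<^sub>R l) * (?c *\<^sub>R l) + (?c *\<^sub>R m) * (?c *\<^sub>R m) = 1" .
    qed (simp_all add: star_scaleR l m lm)
    then have "norm l \<le> sqrt r" using rp by (simp add: divide_le_eq)
    then have "(norm l)\<^sup>2 \<le> r" using rp
      by (metis norm_ge_zero power_mono real_sqrt_pow2 less_imp_le)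
    then show ?thesis using cstar_identity[of l] l by simp
  qed
  have "norm a \<le> r + e" if "e > 0" for e
  proof (rule *)
    show "pos_elem (of_real (r + e) - a)"
      using pos_elem_add[OF b pos_elem_of_real[of e]] that by (simp add: algebra_simps)
  qed (use r that in simp)
  then show ?thesis by (rule field_le_epsilon)
qed

lemma pos_elem_norm_mono:
  assumes "pos_elem a" "pos_elem (b - a)"
  shows "norm a \<le> norm b"
proof (rule pos_elem_le_of_real[OF assms(1)])
  have "star b = b"
    using assms unfolding pos_elem_def by (simp add: star_diff)
  then have "pos_elem (of_real (norm b) - b)" by (rule pos_elem_of_real_minus) simp
  from pos_elem_add[OF this assms(2)] show "pos_elem (of_real (norm b) - a)" by simp
qed simp

lemma pos_elem_antisym: "pos_elem a \<Longrightarrow> pos_elem (- a) \<Longrightarrow> a = 0"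
  using pos_elem_norm_mono[of a 0] by simp

text \<open>The roots of commuting elements commute, and then k m is the square of the self-adjoint
  product of the roots.\<close>

lemma pos_elem_mult:
  assumes k: "pos_elem k" and m: "pos_elem m" and km: "k * m = m * k"
  shows "pos_elem (k * m)"
proof -
  obtain l where l: "star l = l" "k = l * l" "\<And>z. z * k = k * z \<Longrightarrow> z * l = l * z"
    using pos_elem_sqrt[OF k] by metis
  obtain j where j: "star j = j" "m = j * j" "\<And>z. z * m = m * z \<Longrightarrow> z * j = j * z"
    using pos_elem_sqrt[OF m] by metis
  have "m * l = l * m" using l(3)[of m] km by simp
  then have lj: "l * j = j * l" using j(3)[of l] by simp
  then have "k * m = (l * j) * (l * j)" using l(2) j(2) by (metis mult.assoc)
  moreover have "star (l * j) = l * j" using l(1) j(1) lj by (metis star_mult)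
  ultimately show ?thesis using pos_elem_square by metis
qed

section \<open>Positivity of \<open>star a * a\<close>\<close>

lemma one_plus_power_commutes:
  "k * (1 + k) ^ n = (1 + k) ^ n * (k::'a::real_normed_algebra_1)"
  by (induction n) (simp_all add: algebra_simps, simp add: mult.assoc[symmetric])

lemma pos_elem_Bernoulli:
  assumes k: "pos_elem k"
  shows "pos_elem ((1 + k) ^ n - 1 - of_nat n * k)"
proof (induction n)
  case (Suc n)
  let ?q = "(1 + k) ^ n - 1 - of_nat n * k"
  have comm: "k * of_nat n = of_nat n * k" by (metis mult_of_nat_commute)
  have comm': "k * (of_nat n * k) = of_nat n * (k * k)" by (metis comm mult.assoc)
  have "pos_elem (1 + k)" using pos_elem_add[OF _ k] pos_elem_of_real[of 1] by simp
  moreover have "(1 + k) * ?q = ?q * (1 + k)"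
    using one_plus_power_commutes[of k n] by (simp add: algebra_simps comm')
  ultimately have "pos_elem ((1 + k) * ?q)" using Suc by (intro pos_elem_mult)
  moreover have "pos_elem (of_nat n * (k * k))"
    using pos_elem_scaleR[OF pos_elem_mult[OF k k], of "of_nat n"]
      by (simp add: scaleR_conv_of_real)
  moreover have "(1 + k) ^ Suc n - 1 - of_nat (Suc n) * k = (1 + k) * ?q + of_nat n * (k * k)"
    by (simp add: algebra_simps comm')
  ultimately show ?case using pos_elem_add by metis
qed simp

text \<open>Here \<open>y (1 + k)\<^sup>n = (1 - y y\<^sup>*)\<^sup>n y\<close> with \<open>k = - y\<^sup>* y\<close> stays bounded, although
  \<open>k (1 + k)\<^sup>n \<ge> n k\<^sup>2\<close>.\<close>

lemma zero_of_neg_star_mult_aux: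
  fixes y :: "'a::{cstar_algebra,real_normed_algebra_1}"
  assumes k: "pos_elem (- (star y * y))" and p: "norm (1 - y * star y) \<le> 1"
  shows "y = 0"
proof -
  define k where "k = - (star y * y)"
  have kp: "pos_elem k" using k by (simp add: k_def)
  have inter: "y * (1 + k) ^ n = (1 - y * star y) ^ n * y" for n
  proof (induction n)
    case (Suc n)
    have "y * (1 + k) = (1 - y * star y) * y" by (simp add: k_def algebra_simps)
    then show ?case using Suc by (metis (no_types, lifting) mult.assoc power_Suc)
  qed simp
  have bound: "real n * (norm k)\<^sup>2 \<le> (norm y)\<^sup>2" for n
  proof -
    have "k * (1 + k) ^ n = - (star y * ((1 - y * star y) ^ n * y))"
      using inter[of n] by (metis k_def minus_mult_left mult.assoc)
    moreover have "norm ((1 - y * star y) ^ n * y) \<le> 1 * norm y"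
      by (rule order_trans[OF norm_mult_ineq])
        (intro mult_right_mono order_trans[OF norm_power_ineq] power_le_one p norm_ge_zero)
    ultimately have up: "norm (k * (1 + k) ^ n) \<le> norm y * norm y"
      using order_trans[OF norm_mult_ineq mult_left_mono[of _ "norm y"]]
      by (metis mult_1 norm_ge_zero norm_minus_cancel norm_star)
    have kk: "pos_elem (real n *\<^sub>R (k * k))" using pos_elem_scaleR[OF pos_elem_mult[OF kp kp]]
      by simp
    have comm: "k * of_nat n = of_nat n * k" by (metis mult_of_nat_commute)
    have comm': "k * (of_nat n * k) = of_nat n * (k * k)" by (metis comm mult.assoc)
    have "pos_elem (k * ((1 + k) ^ n - 1 - of_nat n * k))"
      using one_plus_power_commutes[of k n]
      by (intro pos_elem_mult kp pos_elem_Bernoulli) (simp add: algebra_simps comm')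
    from pos_elem_add[OF this kp]
    have "pos_elem (k * (1 + k) ^ n - real n *\<^sub>R (k * k))"
      by (simp add: algebra_simps scaleR_conv_of_real comm')
    from pos_elem_norm_mono[OF kk this] have "real n * norm (k * k) \<le> norm (k * (1 + k) ^ n)"
      by simp
    moreover have "norm (k * k) = (norm k)\<^sup>2"
      using cstar_identity[of k] kp by (simp add: pos_elem_def)
    ultimately show ?thesis using up by (simp add: power2_eq_square)
  qed
  have "norm k = 0"
  proof (rule ccontr)
    assume "norm k \<noteq> 0"
    then have "(norm k)\<^sup>2 > 0" by simp
    then obtain n where "real n * (norm k)\<^sup>2 > (norm y)\<^sup>2" using reals_Archimedean3 by blast
    then show False using bound[of n] by simp
  qed
  then show ?thesis using star_mult_self_eq_0[of y] by (simp add: k_def)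
qed

lemma zero_of_neg_star_mult:
  fixes y :: "'a::{cstar_algebra,real_normed_algebra_1}"
  assumes k: "pos_elem (- (star y * y))" and p: "pos_elem (y * star y)"
  shows "y = 0"
proof -
  \<comment> \<open>The scaling makes y a contraction, so that \<open>pos_elem_bound\<close> with
    radius 1 yields the second hypothesis of \<open>zero_of_neg_star_mult_aux\<close>.\<close>
  define c where "c = 1 / (norm y + 1)"
  have c: "c > 0" by (simp add: c_def add_nonneg_pos)
  have cy: "norm (c *\<^sub>R y) \<le> 1" using c by (simp add: c_def divide_le_eq)
  have 1: "pos_elem (- (star (c *\<^sub>R y) * (c *\<^sub>R y)))"
    using pos_elem_scaleR[OF k, of "c * c"] c by (simp add: star_scaleR)
  have 2: "pos_elem ((c *\<^sub>R y) * star (c *\<^sub>R y))"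
    using pos_elem_scaleR[OF p, of "c * c"] c by (simp add: star_scaleR)
  have "norm ((c *\<^sub>R y) * star (c *\<^sub>R y)) \<le> 1"
    using order_trans[OF norm_mult_ineq mult_mono[OF cy _ _ norm_ge_zero]] cy norm_star by fastforce
  from pos_elem_bound[OF 2 this] have "norm (1 - (c *\<^sub>R y) * star (c *\<^sub>R y)) \<le> 1" by simp
  from zero_of_neg_star_mult_aux[OF 1 this] show ?thesis using c by simp
qed

text \<open>In terms of the real part u and the imaginary part v of y, the sum is 2 (u u + v
  v).\<close>

lemma pos_elem_star_mult_add:
  fixes y :: "'a::{cstar_algebra,real_normed_algebra_1}"
  shows "pos_elem (star y * y + y * star y)"
proof -
  define u where "u = (1/2) *\<^sub>R (y + star y)"
  define v where "v = (1/2) *\<^sub>R scaleC \<i> (star y - y)"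
  have su: "star u = u" by (simp add: u_def star_scaleR star_add star_star add.commute)
  have sv: "star v = v"
    by (simp add: v_def star_scaleR star_diff star_star star_scaleC scaleC_diff_right)
  have "u * u = (1/4) *\<^sub>R ((y + star y) * (y + star y))" by (simp add: u_def)
  moreover have "v * v = (1/4) *\<^sub>R (- ((star y - y) * (star y - y)))"
    by (simp add: v_def mult_scaleC_left mult_scaleC_right scaleC_scaleC scaleC_scaleR)
  moreover have "2 *\<^sub>R (u * u + v * v) = (1/2) *\<^sub>R ((y + star y) * (y + star y) - (star y - y) * (star y - y))"
    unfolding calculation by (simp add: scaleR_diff_right scaleR_add_right)
  moreover have "(y + star y) * (y + star y) - (star y - y) * (star y - y)
      = 2 *\<^sub>R (star y * y + y * star y)"
    by (simp add: algebra_simps scaleR_2)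
  ultimately have "star y * y + y * star y = 2 *\<^sub>R (u * u + v * v)" by simp
  then show ?thesis
    by (simp add: pos_elem_scaleR pos_elem_add pos_elem_square su sv)
qed

text \<open>Here m is the absolute value of h and t = m - h is twice its negative part. For y = a t
  the element \<open>star y * y\<close> equals \<open>- (m * (t * t))\<close>, so its negative is
  positive; by \<open>pos_elem_star_mult_add\<close> also \<open>y * star y\<close> is positive,
  which forces y = 0. Then t annihilates h and m, hence itself.\<close>

theorem pos_elem_star_mult:
  fixes a :: "'a::{cstar_algebra,real_normed_algebra_1}"
  shows "pos_elem (star a * a)"
proof -
  define h where "h = star a * a"
  have sh: "star h = h" by (simp add: h_def star_mult star_star)
  obtain m where m: "star m = m" "h * h = m * m" "pos_elem m"
      "\<And>z. z * (h * h) = (h * h) * z \<Longrightarrow> z * m = m * z"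
    using pos_elem_sqrt[OF pos_elem_square[OF sh]] by metis
  have hm: "h * m = m * h" using m(4)[of h] by (simp add: mult.assoc)
  define t where "t = m - h"
  define y where "y = a * t"
  have st: "star t = t" by (simp add: t_def star_diff m sh)
  have ht: "h * t = - (m * t)"
    using m(2) hm by (simp add: t_def algebra_simps)
  have mt: "m * t = t * m" using hm by (simp add: t_def algebra_simps)
  have "star y * y = t * (h * t)"
    by (simp add: y_def star_mult st mult.assoc h_def)
  also have "\<dots> = - (m * (t * t))" using ht mt by (metis minus_mult_right mult.assoc)
  finally have yy: "- (star y * y) = m * (t * t)" by simp
  have "pos_elem (m * (t * t))"
  proof (rule pos_elem_mult[OF m(3) pos_elem_square[OF st]])
    show "m * (t * t) = t * t * m" using mt by (metis mult.assoc)
  qed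
  then have k: "pos_elem (- (star y * y))" using yy by simp
  have "pos_elem (y * star y)"
    using pos_elem_add[OF pos_elem_star_mult_add[of y] k] by simp
  then have "y = 0" using zero_of_neg_star_mult[OF k] by simp
  then have "h * t = 0" by (simp add: h_def y_def mult.assoc)
  then have "m * t = 0" using ht by simp
  then have "t * t = 0" using \<open>h * t = 0\<close> mt
    by (metis diff_zero left_diff_distrib t_def)
  then have "t = 0" using star_mult_self_eq_0[of t] st by simp
  then show ?thesis using m(3) by (simp add: t_def h_def)
qed

section \<open>The Hahn--Banach theorem\<close>

text \<open>Linear functionals are the minimal sublinear ones.\<close>

definition sublinear :: "('v::real_vector \<Rightarrow> real) \<Rightarrow> bool" where
  "sublinear q \<longleftrightarrow> (\<forall>x y. q (x + y) \<le> q x + q y) \<and> (\<forall>c>0. \<forall>x. q (c *\<^sub>R x) \<le> c * q x)"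

lemma sublinear_scaleR:
  assumes "sublinear q" "c > 0" shows "q (c *\<^sub>R x) = c * q x"
proof -
  have "q ((1/c) *\<^sub>R (c *\<^sub>R x)) \<le> (1/c) * q (c *\<^sub>R x)"
    using assms unfolding sublinear_def by (metis zero_less_divide_1_iff)
  then have "c * q x \<le> q (c *\<^sub>R x)" using assms(2) by (simp add: field_simps)
  then show ?thesis using assms unfolding sublinear_def by (metis order_antisym)
qed

lemma sublinear_zero: "sublinear q \<Longrightarrow> q 0 = 0"
  using sublinear_scaleR[of q 2 0] by simp

lemma sublinear_lower:
  assumes "sublinear q" shows "- q (- x) \<le> q x"
proof -
  have "q (x + - x) \<le> q x + q (- x)" using assms unfolding sublinear_def by blast
  then show ?thesis using sublinear_zero[OF assms] by simp
qed

text \<open>A sublinear minorant of q: t = 0 gives q x, and t = 1 bounds the value at - x0 by - q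
  x0. Hence a linear functional below it attains q at x0. A minimal sublinear functional is
  unchanged by its own shifts, which forces it to be odd.\<close>

definition sublinear_shift :: "('v::real_vector \<Rightarrow> real) \<Rightarrow> 'v \<Rightarrow> 'v \<Rightarrow> real" where
  "sublinear_shift q x0 x = (INF t\<in>{0..}. q (x + t *\<^sub>R x0) - t * q x0)"

lemma sublinear_shift_bound:
  assumes "sublinear q" "t \<ge> 0"
  shows "- q (- x) \<le> q (x + t *\<^sub>R x0) - t * q x0"
proof -
  have "q ((x + t *\<^sub>R x0) + - x) \<le> q (x + t *\<^sub>R x0) + q (- x)"
    using assms unfolding sublinear_def by blast
  moreover have "q (t *\<^sub>R x0) = t * q x0"
    using assms sublinear_scaleR[OF assms(1)] sublinear_zero[OF assms(1)] by (cases "t = 0") auto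
  ultimately show ?thesis by (simp add: algebra_simps)
qed

lemma sublinear_shift_le:
  assumes "sublinear q" "t \<ge> 0"
  shows "sublinear_shift q x0 x \<le> q (x + t *\<^sub>R x0) - t * q x0"
  unfolding sublinear_shift_def
  by (rule cINF_lower) (use assms sublinear_shift_bound in \<open>auto intro!: bdd_belowI2[where m =
      "- q (- x)"]\<close>)

lemma sublinear_shift_ge:
  assumes "\<And>t. t \<ge> 0 \<Longrightarrow> c \<le> q (x + t *\<^sub>R x0) - t * q x0"
  shows "c \<le> sublinear_shift q x0 x"
  unfolding sublinear_shift_def by (rule cINF_greatest) (use assms in auto)

lemma sublinear_sublinear_shift:
  assumes q: "sublinear q" shows "sublinear (sublinear_shift q x0)"
  unfolding sublinear_def
proof (intro conjI allI impI)
  fix x y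
  let ?p = "sublinear_shift q x0"
  have "?p (x + y) - (q (y + s *\<^sub>R x0) - s * q x0) \<le> ?p x" if "s \<ge> 0" for s
  proof (rule sublinear_shift_ge)
    fix t :: real assume "t \<ge> 0"
    have "?p (x + y) \<le> q ((x + y) + (t + s) *\<^sub>R x0) - (t + s) * q x0"
      using \<open>t \<ge> 0\<close> that by (intro sublinear_shift_le[OF q]) simp
    also have "(x + y) + (t + s) *\<^sub>R x0 = (x + t *\<^sub>R x0) + (y + s *\<^sub>R x0)"
      by (simp add: algebra_simps)
    also have "q \<dots> \<le> q (x + t *\<^sub>R x0) + q (y + s *\<^sub>R x0)"
      using q unfolding sublinear_def by blast
    finally show "?p (x + y) - (q (y + s *\<^sub>R x0) - s * q x0) \<le> q (x + t *\<^sub>R x0) - t * q x0"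
      by (simp add: algebra_simps)
  qed
  then have "?p (x + y) - ?p x \<le> ?p y"
    by (intro sublinear_shift_ge) (smt (verit, best))
  then show "?p (x + y) \<le> ?p x + ?p y" by simp
next
  fix c :: real and x :: 'a
  assume c: "c > 0"
  have "sublinear_shift q x0 (c *\<^sub>R x) / c \<le> sublinear_shift q x0 x"
  proof (rule sublinear_shift_ge)
    fix t :: real assume t: "t \<ge> 0"
    have "sublinear_shift q x0 (c *\<^sub>R x) \<le> q (c *\<^sub>R x + (c * t) *\<^sub>R x0) - (c * t) * q x0"
      using c t by (intro sublinear_shift_le[OF q]) simp
    also have "c *\<^sub>R x + (c * t) *\<^sub>R x0 = c *\<^sub>R (x + t *\<^sub>R x0)" by (simp add: scaleR_add_right)
    also have "q \<dots> = c * q (x + t *\<^sub>R x0)" by (rule sublinear_scaleR[OF q c])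
    finally show "sublinear_shift q x0 (c *\<^sub>R x) / c \<le> q (x + t *\<^sub>R x0) - t * q x0"
      using c by (simp add: field_simps)
  qed
  then show "sublinear_shift q x0 (c *\<^sub>R x) \<le> c * sublinear_shift q x0 x"
    using c by (simp add: field_simps)
qed

text \<open>Subadditivity of the infimum rests on comparability: of two members the smaller one
  bounds both. The common lower bound - p (- x) keeps the infima finite.\<close>

lemma sublinear_Inf_chain:
  assumes C: "C \<noteq> {}" "\<And>q. q \<in> C \<Longrightarrow> sublinear q \<and> q \<le> p"
    and chain: "\<And>q r. q \<in> C \<Longrightarrow> r \<in> C \<Longrightarrow> q \<le> r \<or> r \<le> q"
  shows "sublinear (\<lambda>x. INF q\<in>C. q x)" "\<And>q. q \<in> C \<Longrightarrow> (\<lambda>x. INF q\<in>C. q x) \<le> q"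
proof -
  let ?u = "\<lambda>x. INF q\<in>C. q x"
  have lower: "- p (- x) \<le> q x" if "q \<in> C" for q x
    using sublinear_lower[of q x] C(2)[OF that] le_funD[of q p "- x"] by force
  have le: "?u x \<le> q x" if "q \<in> C" for q x
    by (rule cINF_lower[OF _ that]) (use lower in \<open>auto intro!: bdd_belowI2[where m = "- p (- x)"]\<close>)
  show "\<And>q. q \<in> C \<Longrightarrow> ?u \<le> q" using le by (auto intro!: le_funI)
  show "sublinear ?u" unfolding sublinear_def
  proof (intro conjI allI impI)
    fix x y
    have "?u (x + y) - r y \<le> ?u x" if r: "r \<in> C" for r
    proof (rule cINF_greatest[OF C(1)])
      fix q assume q: "q \<in> C"
      have "\<exists>s\<in>C. s \<le> q \<and> s \<le> r" using chain[OF q r] q r by auto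
      then obtain s where s: "s \<in> C" "s \<le> q" "s \<le> r" by auto
      have "?u (x + y) \<le> s (x + y)" by (rule le[OF s(1)])
      also have "\<dots> \<le> s x + s y" using C(2)[OF s(1)] by (auto simp: sublinear_def)
      finally show "?u (x + y) - r y \<le> q x" using le_funD[OF s(2), of x] le_funD[OF s(3), of y]
        by simp
    qed
    then have "?u (x + y) - ?u x \<le> ?u y"
      by (intro cINF_greatest[OF C(1)]) (smt (verit, best))
    then show "?u (x + y) \<le> ?u x + ?u y" by simp
  next
    fix c :: real and x :: 'a
    assume c: "c > 0"
    have "?u (c *\<^sub>R x) / c \<le> ?u x"
    proof (rule cINF_greatest[OF C(1)])
      fix q assume q: "q \<in> C"
      show "?u (c *\<^sub>R x) / c \<le> q x"
        using le[OF q, of "c *\<^sub>R x"] c C(2)[OF q] by (simp add: sublinear_scaleR field_simps)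
    qed
    then show "?u (c *\<^sub>R x) \<le> c * ?u x" using c by (simp add: field_simps)
  qed
qed

text \<open>Zorn's lemma for the reversed order gives a minimal sublinear f below
  \<open>sublinear_shift p x0\<close>. Minimality under every further shift yields f (- x) = - f x,
  and an odd sublinear function is linear. Starting from the shift at x0 instead of p forces f x0 =
  p x0.\<close>

theorem Hahn_Banach:
  assumes p: "sublinear (p :: 'v::real_vector \<Rightarrow> real)"
  obtains f where "linear f" "\<And>x. f x \<le> p x" "f x0 = p x0"
proof -
  let ?A = "{q. sublinear q \<and> q \<le> sublinear_shift p x0}"
  have p0: "sublinear_shift p x0 x \<le> p x" for x
    using sublinear_shift_le[OF p, of 0 x0 x] by simp
  have "\<exists>m\<in>?A. \<forall>a\<in>?A. m \<ge> a \<longrightarrow> a = m"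
  proof (rule predicate_Zorn)
    show "partial_order_on ?A (relation_of (\<ge>) ?A)"
      by (rule partial_order_on_relation_ofI) (auto intro: order_trans antisym)
    fix C assume C: "C \<in> Chains (relation_of (\<ge>) ?A)"
    show "\<exists>u\<in>?A. \<forall>a\<in>C. a \<ge> u"
    proof (cases "C = {}")
      case True
      then show ?thesis using sublinear_sublinear_shift[OF p, of x0] by auto
    next
      case False
      have sub: "sublinear q \<and> q \<le> sublinear_shift p x0" if "q \<in> C" for q
        using C that by (auto simp: Chains_def relation_of_def)
      have ch: "q \<le> r \<or> r \<le> q" if "q \<in> C" "r \<in> C" for q r
        using C that by (auto simp: Chains_def relation_of_def)
      note * = sublinear_Inf_chain[OF False sub ch]
      obtain q where "q \<in> C" using False by auto
      then show ?thesis using * sub[OF \<open>q \<in> C\<close>]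
        by (intro bexI[of _ "\<lambda>x. INF q\<in>C. q x"]) (auto intro: order_trans[OF *(2)])
    qed
  qed
  then obtain f where f: "sublinear f" "f \<le> sublinear_shift p x0"
    and min: "\<And>q. sublinear q \<Longrightarrow> q \<le> sublinear_shift p x0 \<Longrightarrow> q \<le> f \<Longrightarrow> q = f" by auto
  have neg: "f (- x) = - f x" for x
  proof -
    have le: "sublinear_shift f x \<le> f"
      using sublinear_shift_le[OF f(1), of 0 x] by (auto intro!: le_funI)
    have "sublinear_shift f x = f"
      by (rule min[OF sublinear_sublinear_shift[OF f(1)] order_trans[OF le f(2)] le])
    then have "f (- x) \<le> - f x"
      using sublinear_shift_le[OF f(1), of 1 x "- x"] sublinear_zero[OF f(1)] by simp
    then show ?thesis using sublinear_lower[OF f(1), of x] by simp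
  qed
  have add: "f (x + y) = f x + f y" for x y
  proof -
    have "f (x + y) \<le> f x + f y" "f (- x + - y) \<le> f (- x) + f (- y)"
      using f(1) unfolding sublinear_def by blast+
    then show ?thesis using neg[of "x + y"] by (simp add: neg)
  qed
  have "f (c *\<^sub>R x) = c * f x" for c x
  proof -
    consider "c > 0" | "c = 0" | "c < 0" by linarith
    then show ?thesis
    proof cases
      case 3
      then have "f ((- c) *\<^sub>R x) = (- c) * f x" using sublinear_scaleR[OF f(1), of "- c"] by simp
      then show ?thesis using neg[of "c *\<^sub>R x"] by simp
    qed (use sublinear_scaleR[OF f(1)] sublinear_zero[OF f(1)] in auto)
  qed
  then have lin: "linear f" by (intro linearI) (auto simp: add)
  have le: "f x \<le> p x" for x using le_funD[OF f(2), of x] p0[of x] by simp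
  have "f (- x0) \<le> - p x0"
    using le_funD[OF f(2), of "- x0"] sublinear_shift_le[OF p, of 1 x0 "- x0"] sublinear_zero[OF p]
      by simp
  then have "f x0 = p x0" using neg[of x0] le[of x0] by simp
  with lin le show ?thesis by (rule that)
qed

section \<open>Unitization\<close>

datatype 'a unitization = Unitization (scalar_part: complex) (base_part: 'a)

definition unit_left :: "'a::cstar_algebra unitization \<Rightarrow> 'a \<Rightarrow> 'a" where
  "unit_left u x = scaleC (scalar_part u) x + base_part u * x"

lemma bounded_linear_unit_left: "bounded_linear (unit_left u)"
  unfolding unit_left_def
  by (intro bounded_linear_add bounded_linear_scaleC bounded_linear_mult_right)

instantiation unitization :: (cstar_algebra) "{real_vector, ring_1}"
begin

definition "0 = Unitization 0 0"
definition "1 = Unitization 1 0"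
definition "u + v = Unitization (scalar_part u + scalar_part v) (base_part u + base_part v)"
definition "u - v = Unitization (scalar_part u - scalar_part v) (base_part u - base_part v)"
definition "- u = Unitization (- scalar_part u) (- base_part u)"
definition "u * v = Unitization (scalar_part u * scalar_part v)
  (scaleC (scalar_part u) (base_part v) + scaleC (scalar_part v) (base_part u) + base_part u * base_part v)"
definition "r *\<^sub>R u = Unitization (of_real r * scalar_part u) (r *\<^sub>R base_part u)"
instance
  by standard
    (auto simp: zero_unitization_def one_unitization_def plus_unitization_def minus_unitization_def
      uminus_unitization_def times_unitization_def scaleR_unitization_def unitization.expand
      algebra_simps scaleC_add_right scaleC_add_left scaleC_scaleC mult_scaleC_left mult_scaleC_right)

end

lemma unitization_parts [simp]:
  "scalar_part 0 = 0" "base_part 0 = 0" "scalar_part 1 = 1" "base_part 1 = 0"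
  "scalar_part (u + v) = scalar_part u + scalar_part v" "base_part (u + v)
      = base_part u + base_part v"
  "scalar_part (u - v) = scalar_part u - scalar_part v" "base_part (u - v)
      = base_part u - base_part v"
  "scalar_part (- u) = - scalar_part u" "base_part (- u) = - base_part u"
  "scalar_part (u * v) = scalar_part u * scalar_part v"
  "base_part (u * v) = scaleC (scalar_part u) (base_part v) + scaleC (scalar_part v) (base_part u)
    + base_part u * base_part v"
  "scalar_part (r *\<^sub>R u) = of_real r * scalar_part u" "base_part (r *\<^sub>R u) = r *\<^sub>R base_part u"
  by (simp_all add: zero_unitization_def one_unitization_def plus_unitization_def minus_unitization_def
      uminus_unitization_def times_unitization_def scaleR_unitization_def)

text \<open>The maximum makes this a norm also when \<open>'a\<close> already has a unit.\<close>

definition unit_norm :: "'a::cstar_algebra unitization \<Rightarrow> real" where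
  "unit_norm u = max (cmod (scalar_part u)) (onorm (unit_left u))"

lemma unit_left_add: "unit_left (u + v) = (\<lambda>x. unit_left u x + unit_left v x)"
  by (auto simp: unit_left_def scaleC_add_left algebra_simps)

lemma unit_left_mult: "unit_left (u * v) = unit_left u \<circ> unit_left v"
  by (auto simp: unit_left_def scaleC_add_left scaleC_add_right scaleC_scaleC mult_scaleC_left
      mult_scaleC_right algebra_simps)

lemma unit_left_scaleR: "unit_left (r *\<^sub>R u) = (\<lambda>x. r *\<^sub>R unit_left u x)"
  by (auto simp: unit_left_def scaleR_add_right scaleC_of_real simp flip: scaleC_scaleC)

lemma unit_norm_unit_left: "norm (unit_left u x) \<le> unit_norm u * norm x"
proof -
  have "norm (unit_left u x) \<le> onorm (unit_left u) * norm x"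
    by (rule onorm[OF bounded_linear_unit_left])
  then show ?thesis by (rule order_trans) (auto simp: unit_norm_def intro: mult_right_mono)
qed

lemma unit_norm_le:
  assumes "cmod (scalar_part u) \<le> c" "\<And>x. norm (unit_left u x) \<le> c * norm x"
  shows "unit_norm u \<le> c"
proof -
  have "0 \<le> c" using assms(1) norm_ge_zero order_trans by blast
  then have "onorm (unit_left u) \<le> c" by (rule onorm_bound) (rule assms(2))
  then show ?thesis using assms(1) by (simp add: unit_norm_def)
qed

lemma unit_norm_scalar_part: "cmod (scalar_part u) \<le> unit_norm u"
  by (simp add: unit_norm_def)

text \<open>Letting u act on \<open>star b\<close> and removing the scalar contribution leaves
  \<open>b * star b\<close>, whose norm is the square of that of b. With
  \<open>unit_norm_parts\<close> this makes the norm equivalent to the sum of the norms of the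
  parts, from which completeness is obtained.\<close>

lemma unit_norm_base_part: "norm (base_part u) \<le> 2 * unit_norm u"
proof (cases "base_part u = 0")
  case True
  then show ?thesis using order_trans[OF norm_ge_zero unit_norm_scalar_part[of u]] by simp
next
  case False
  let ?b = "base_part u"
  have "(norm ?b)\<^sup>2 = norm (unit_left u (star ?b) - scaleC (scalar_part u) (star ?b))"
    using cstar_identity[of "star ?b"] by (simp add: unit_left_def star_star)
  also have "\<dots> \<le> norm (unit_left u (star ?b)) + norm (scaleC (scalar_part u) (star ?b))"
    by (rule norm_triangle_ineq4)
  also have "\<dots> \<le> unit_norm u * norm ?b + unit_norm u * norm ?b"
    using unit_norm_unit_left[of u "star ?b"] unit_norm_scalar_part[of u]
    by (intro add_mono) (auto simp: norm_scaleC intro: mult_right_mono)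
  finally have "norm ?b * norm ?b \<le> (2 * unit_norm u) * norm ?b"
    by (simp add: power2_eq_square algebra_simps)
  then show ?thesis using False by simp
qed

lemma unit_norm_parts: "unit_norm u \<le> cmod (scalar_part u) + norm (base_part u)"
proof (rule unit_norm_le)
  fix x
  have "norm (unit_left u x) \<le> norm (scaleC (scalar_part u) x) + norm (base_part u * x)"
    unfolding unit_left_def by (rule norm_triangle_ineq)
  also have "\<dots> \<le> cmod (scalar_part u) * norm x + norm (base_part u) * norm x"
    by (intro add_mono norm_mult_ineq) (simp add: norm_scaleC)
  finally show "norm (unit_left u x) \<le> (cmod (scalar_part u) + norm (base_part u)) * norm x"
    by (simp add: algebra_simps)
qed simp

instantiation unitization :: (cstar_algebra) real_normed_algebra_1
begin

definition "norm u = unit_norm (u :: 'a unitization)"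
definition "sgn u = u /\<^sub>R norm (u :: 'a unitization)"
definition "dist u v = norm (u - v :: 'a unitization)"
definition uniformity_unitization :: "('a unitization \<times> 'a unitization) filter" where
  "uniformity_unitization = (INF e\<in>{0<..}. principal {(x, y). dist x y < e})"
definition open_unitization :: "'a unitization set \<Rightarrow> bool" where
  "open_unitization U \<longleftrightarrow> (\<forall>x\<in>U. \<forall>\<^sub>F (x', y) in uniformity. x' = x \<longrightarrow> y \<in> U)"

instance
proof
  fix u v :: "'a unitization" and r :: real
  show "sgn u = u /\<^sub>R norm u" by (rule sgn_unitization_def)
  show "dist u v = norm (u - v)" by (rule dist_unitization_def)
  show "(uniformity :: ('a unitization \<times> 'a unitization) filter)
      = (INF e\<in>{0<..}. principal {(x, y). dist x y < e})"
    by (rule uniformity_unitization_def)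
  show "open U \<longleftrightarrow> (\<forall>x\<in>U. \<forall>\<^sub>F (x', y) in uniformity. x' = x \<longrightarrow> y \<in> U)" for U :: "'a unitization set"
    by (rule open_unitization_def)
  show "norm u = 0 \<longleftrightarrow> u = 0" unfolding norm_unitization_def
  proof
    assume "unit_norm u = 0"
    then have "scalar_part u = 0" "base_part u = 0"
      using unit_norm_scalar_part[of u] unit_norm_base_part[of u] by auto
    then show "u = 0" by (simp add: unitization.expand)
  next
    assume "u = 0"
    then show "unit_norm u = 0" using unit_norm_parts[of u] unit_norm_scalar_part[of u] by simp
  qed
  show "norm (u + v) \<le> norm u + norm v" unfolding norm_unitization_def
  proof (rule unit_norm_le)
    show "cmod (scalar_part (u + v)) \<le> unit_norm u + unit_norm v"
      using norm_triangle_ineq[of "scalar_part u" "scalar_part v"] unit_norm_scalar_part[of u]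
          unit_norm_scalar_part[of v]
      by simp
    show "norm (unit_left (u + v) x) \<le> (unit_norm u + unit_norm v) * norm x" for x
      using norm_triangle_ineq[of "unit_left u x" "unit_left v x"] unit_norm_unit_left[of u x]
          unit_norm_unit_left[of v x]
      by (simp add: unit_left_add algebra_simps)
  qed
  have mult: "unit_norm (u * v) \<le> unit_norm u * unit_norm v" for u v :: "'a unitization"
  proof (rule unit_norm_le)
    have "0 \<le> unit_norm u" using unit_norm_scalar_part[of u] norm_ge_zero order_trans by blast
    then show "cmod (scalar_part (u * v)) \<le> unit_norm u * unit_norm v"
      using unit_norm_scalar_part[of u] unit_norm_scalar_part[of v]
        by (simp add: norm_mult mult_mono)
    show "norm (unit_left (u * v) x) \<le> unit_norm u * unit_norm v * norm x" for x
      using unit_norm_unit_left[of u "unit_left v x"] mult_left_mono[OF unit_norm_unit_left[of v x] \<open>0 \<le> unit_norm u\<close>]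
      by (simp add: unit_left_mult mult.assoc)
  qed
  then show "norm (u * v) \<le> norm u * norm v" unfolding norm_unitization_def .
  show "norm (r *\<^sub>R u) = \<bar>r\<bar> * norm u" unfolding norm_unitization_def
  proof -
    have "onorm (\<lambda>x. r *\<^sub>R unit_left u x) = \<bar>r\<bar> * onorm (unit_left u)"
      by (rule onorm_scaleR[OF bounded_linear_unit_left])
    then show "unit_norm (r *\<^sub>R u) = \<bar>r\<bar> * unit_norm u"
      by (simp add: unit_norm_def unit_left_scaleR norm_mult max_mult_distrib_left)
  qed
  show "norm (1 :: 'a unitization) = 1" unfolding norm_unitization_def
    using unit_norm_parts[of "1 :: 'a unitization"] unit_norm_scalar_part[of "1 :: 'a unitization"]
      by simp
  show "(r *\<^sub>R u) * v = r *\<^sub>R (u * v)" "u * r *\<^sub>R v = r *\<^sub>R (u * v)"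
    by (auto intro!: unitization.expand simp: scaleC_scaleR scaleR_add_right scaleC_of_real
        simp flip: scaleC_scaleC)
qed

end

lemmas norm_unitization_le = unit_norm_le[folded norm_unitization_def]
lemmas norm_unit_left = unit_norm_unit_left[folded norm_unitization_def]
lemmas norm_scalar_part = unit_norm_scalar_part[folded norm_unitization_def]
lemmas norm_base_part = unit_norm_base_part[folded norm_unitization_def]
lemmas norm_unitization_parts = unit_norm_parts[folded norm_unitization_def]

instantiation unitization :: (cstar_algebra) cstar_algebra
begin

definition "scaleC z u = Unitization (z * scalar_part u) (scaleC z (base_part u))"
definition "star u = Unitization (cnj (scalar_part u)) (star (base_part u))"

instance
proof
  fix u v :: "'a unitization" and z w :: complex and r :: real
  note defs = scaleC_unitization_def star_unitization_def
  show "scaleC z (u + v) = scaleC z u + scaleC z v" "scaleC (z + w) u = scaleC z u + scaleC w u"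
    "scaleC z (scaleC w u) = scaleC (z * w) u" "scaleC (complex_of_real r) u = r *\<^sub>R u"
    "scaleC z u * v = scaleC z (u * v)" "u * scaleC z v = scaleC z (u * v)" "star (star u) = u"
    "star (u + v) = star u + star v" "star (scaleC z u) = scaleC (cnj z) (star u)"
    "star (u * v) = star v * star u"
    by (auto intro!: unitization.expand simp: defs scaleC_add_right scaleC_add_left scaleC_scaleC
      mult_scaleC_left mult_scaleC_right algebra_simps scaleC_of_real star_star star_add star_scaleC star_mult)
  have le: "norm (scaleC z u) \<le> cmod z * norm u" for z and u :: "'a unitization"
  proof (rule norm_unitization_le)
    show "cmod (scalar_part (scaleC z u)) \<le> cmod z * norm u"
      using norm_scalar_part[of u] by (simp add: defs norm_mult mult_left_mono)
    show "norm (unit_left (scaleC z u) x) \<le> cmod z * norm u * norm x" for x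
    proof -
      have "unit_left (scaleC z u) x = scaleC z (unit_left u x)"
        by (simp add: unit_left_def defs scaleC_add_right scaleC_scaleC mult_scaleC_left)
      then show ?thesis using mult_left_mono[OF norm_unit_left[of u x], of "cmod z"]
        by (simp add: norm_scaleC mult.assoc)
    qed
  qed
  show "norm (scaleC z u) = cmod z * norm u"
  proof (cases "z = 0")
    case True
    then have "scaleC z u = 0" by (auto intro!: unitization.expand simp: defs)
    then show ?thesis using True by simp
  next
    case False
    have "u = scaleC (inverse z) (scaleC z u)" using False
      by (auto intro!: unitization.expand simp: defs scaleC_scaleC)
    then have "norm u \<le> inverse (cmod z) * norm (scaleC z u)"
      using le[of "inverse z" "scaleC z u"] by (simp add: norm_inverse)
    then have "cmod z * norm u \<le> norm (scaleC z u)" using False by (simp add: field_simps)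
    then show ?thesis using le[of z u] by simp
  qed
  \<comment> \<open>Only this inequality is proved directly, separately for the scalar part and for
    left multiplication; the isometry of the involution and then the C*-identity follow
    formally.\<close>
  have square: "(norm u)\<^sup>2 \<le> norm (star u * u)" for u :: "'a unitization"
  proof -
    let ?K = "norm (star u * u)"
    have "norm u \<le> sqrt ?K"
    proof (rule norm_unitization_le)
      have "(cmod (scalar_part u))\<^sup>2 = cmod (scalar_part (star u * u))"
        by (simp add: defs norm_mult power2_eq_square)
      also have "\<dots> \<le> ?K" by (rule norm_scalar_part)
      finally show "cmod (scalar_part u) \<le> sqrt ?K" by (rule real_le_rsqrt)
      fix x
      have "star (unit_left u x) * unit_left u x = star x * unit_left (star u * u) x"
        by (simp add: unit_left_def defs star_add star_mult star_scaleC scaleC_add_right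
          scaleC_add_left scaleC_scaleC mult_scaleC_left mult_scaleC_right algebra_simps)
      then have "(norm (unit_left u x))\<^sup>2 = norm (star x * unit_left (star u * u) x)"
        using cstar_identity[of "unit_left u x"] by simp
      also have "\<dots> \<le> norm x * (?K * norm x)"
        by (rule order_trans[OF norm_mult_ineq])
          (use norm_unit_left[of "star u * u" x] in \<open>simp add: mult_left_mono\<close>)
      finally have "(norm (unit_left u x))\<^sup>2 \<le> ?K * (norm x)\<^sup>2"
        by (simp add: power2_eq_square algebra_simps)
      then have "norm (unit_left u x) \<le> sqrt (?K * (norm x)\<^sup>2)" by (rule real_le_rsqrt)
      then show "norm (unit_left u x) \<le> sqrt ?K * norm x" by (simp add: real_sqrt_mult)
    qed
    then show ?thesis by (metis norm_ge_zero power_mono real_sqrt_pow2)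
  qed
  have star_le: "norm u \<le> norm (star u)" for u :: "'a unitization"
  proof (cases "u = 0")
    case False
    have "norm u * norm u \<le> norm (star u) * norm u"
      using square[of u] norm_mult_ineq[of "star u" u] by (simp add: power2_eq_square)
    then show ?thesis using False by simp
  qed simp
  have "star (star u) = u" by (auto intro!: unitization.expand simp: defs star_star)
  then have "norm (star u) = norm u" using star_le[of u] star_le[of "star u"] by simp
  then show "norm (star u * u) = (norm u)\<^sup>2"
    using square[of u] norm_mult_ineq[of "star u" u] by (simp add: power2_eq_square)
next
  fix X :: "nat \<Rightarrow> 'a unitization"
  assume X: "Cauchy X"
  have "Cauchy (\<lambda>n. scalar_part (X n))"
  proof (rule metric_CauchyI)
    fix e :: real assume "e > 0"
    from metric_CauchyD[OF X this] obtain M where M: "\<forall>m\<ge>M. \<forall>n\<ge>M. dist (X m) (X n) < e" by auto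
    have "dist (scalar_part (X m)) (scalar_part (X n)) < e" if "m \<ge> M" "n \<ge> M" for m n
      using norm_scalar_part[of "X m - X n"] M that by (fastforce simp: dist_norm)
    then show "\<exists>M. \<forall>m\<ge>M. \<forall>n\<ge>M. dist (scalar_part (X m)) (scalar_part (X n)) < e" by blast
  qed
  then obtain z where z: "(\<lambda>n. scalar_part (X n)) \<longlonglongrightarrow> z" using Cauchy_convergent convergent_def
    by blast
  have "Cauchy (\<lambda>n. base_part (X n))"
  proof (rule metric_CauchyI)
    fix e :: real assume "e > 0"
    then have "e / 2 > 0" by simp
    from metric_CauchyD[OF X this] obtain M where M: "\<forall>m\<ge>M. \<forall>n\<ge>M. dist (X m) (X n) < e / 2" by auto
    have "dist (base_part (X m)) (base_part (X n)) < e" if "m \<ge> M" "n \<ge> M" for m n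
      using norm_base_part[of "X m - X n"] M that by (fastforce simp: dist_norm)
    then show "\<exists>M. \<forall>m\<ge>M. \<forall>n\<ge>M. dist (base_part (X m)) (base_part (X n)) < e" by blast
  qed
  then obtain b where b: "(\<lambda>n. base_part (X n)) \<longlonglongrightarrow> b" using Cauchy_convergent convergent_def by blast
  have "(\<lambda>n. cmod (scalar_part (X n) - z) + norm (base_part (X n) - b)) \<longlonglongrightarrow> cmod (z - z) + norm (b - b)"
    by (intro tendsto_intros z b)
  then have lim: "(\<lambda>n. cmod (scalar_part (X n) - z) + norm (base_part (X n) - b)) \<longlonglongrightarrow> 0" by simp
  have "norm (X n - Unitization z b) \<le> cmod (scalar_part (X n) - z) + norm (base_part (X n) - b)" for n
    using norm_unitization_parts[of "X n - Unitization z b"] by simp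
  then have "(\<lambda>n. X n - Unitization z b) \<longlonglongrightarrow> 0"
    by (intro Lim_null_comparison[OF _ lim] always_eventually) blast
  then have "X \<longlonglongrightarrow> Unitization z b" by (rule LIM_zero_cancel)
  then show "convergent X" by (auto simp: convergent_def)
qed

end

abbreviation unit_embed :: "'a::cstar_algebra \<Rightarrow> 'a unitization" where
  "unit_embed \<equiv> Unitization 0"

lemma unit_embed_simps:
  "unit_embed (x + y) = unit_embed x + unit_embed y" "unit_embed (x - y)
      = unit_embed x - unit_embed y"
  "unit_embed (x * y) = unit_embed x * unit_embed y" "unit_embed (star x) = star (unit_embed x)"
  "unit_embed (scaleC z x) = scaleC z (unit_embed x)" "unit_embed (r *\<^sub>R x) = r *\<^sub>R unit_embed x"
  "unit_embed 0 = 0"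
  by (auto intro!: unitization.expand simp: star_unitization_def scaleC_unitization_def)

lemma norm_unit_embed [simp]: "norm (unit_embed b) = norm b"
proof (rule antisym)
  show "norm (unit_embed b) \<le> norm b" using norm_unitization_parts[of "unit_embed b"] by simp
  show "norm b \<le> norm (unit_embed b)"
  proof (cases "b = 0")
    case False
    have "norm b * norm b \<le> norm (unit_embed b) * norm b"
      using norm_unit_left[of "unit_embed b" "star b"] cstar_identity[of "star b"]
      by (simp add: unit_left_def star_star power2_eq_square)
    then show ?thesis using False by simp
  qed simp
qed

section \<open>States\<close>

text \<open>Positive functionals of norm at most 1, zero included: this makes sense without a unit
  and passes from the unitization to the algebra by restriction.\<close>

definition cstar_state :: "('b::cstar_algebra \<Rightarrow> complex) \<Rightarrow> bool" where
  "cstar_state \<rho> \<longleftrightarrow> (\<forall>x y. \<rho> (x + y) = \<rho> x + \<rho> y) \<and> (\<forall>z x. \<rho> (scaleC z x) = z * \<rho> x) \<and>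
    (\<forall>x. \<rho> (star x) = cnj (\<rho> x)) \<and> (\<forall>x. 0 \<le> Re (\<rho> (star x * x))) \<and> (\<forall>x. cmod (\<rho> x) \<le> norm x)"

definition positive :: "'b::cstar_algebra \<Rightarrow> bool" where
  "positive h \<longleftrightarrow> pos_elem (unit_embed h)"

lemma positive_star_mult [simp]: "positive (star x * x)"
  unfolding positive_def unit_embed_simps by (rule pos_elem_star_mult)

lemma positive_0 [simp]: "positive 0"
  by (simp add: positive_def unit_embed_simps)

lemma positive_add: "positive x \<Longrightarrow> positive y \<Longrightarrow> positive (x + y)"
  unfolding positive_def unit_embed_simps by (rule pos_elem_add)

lemma positive_sum: "(\<And>i. i \<in> F \<Longrightarrow> positive (f i)) \<Longrightarrow> positive (sum f F)"
  by (induction F rule: infinite_finite_induct) (auto intro: positive_add)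

text \<open>Keeps the set of which \<open>upper_bound\<close> takes the infimum bounded
  below.\<close>

lemma pos_elem_lower_bound:
  fixes x :: "'a::{cstar_algebra,real_normed_algebra_1}"
  assumes "star x = x" "pos_elem (of_real r - x)"
  shows "- norm x \<le> r"
proof (rule ccontr)
  assume "\<not> - norm x \<le> r"
  then have r: "- r > norm x" by simp
  have 1: "pos_elem (of_real (- r) + x)"
    using pos_elem_of_real_minus[of "- x" "- r"] assms(1) r by simp
  have eq: "- (of_real (- r) + x) = of_real r - x" by simp
  have "of_real (- r) + x = 0" using pos_elem_antisym[OF 1] assms(2) unfolding eq by simp
  then have "x = of_real r" by (simp add: algebra_simps)
  then show False using r norm_ge_zero[of x] by simp
qed

text \<open>The largest point of the spectrum of the real part of x. A real linear functional below
  it is nonnegative on positive elements and zero on skew-adjoint ones.\<close>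

definition upper_bound :: "'a::{cstar_algebra,real_normed_algebra_1} \<Rightarrow> real" where
  "upper_bound x = Inf {r. pos_elem (of_real r - (1/2) *\<^sub>R (x + star x))}"

lemma norm_real_part_le: "norm ((1/2) *\<^sub>R (x + star x)) \<le> norm (x::'a::cstar_algebra)"
  using norm_triangle_ineq[of x "star x"] by simp

lemma star_real_part: "star ((1/2) *\<^sub>R (x + star x)) = (1/2) *\<^sub>R (x + star (x::'a::cstar_algebra))"
  by (simp add: star_scaleR star_add star_star add.commute)

lemma upper_bound_le:
  assumes "pos_elem (of_real r - (1/2) *\<^sub>R (x + star x))"
  shows "upper_bound x \<le> r"
  unfolding upper_bound_def
proof (rule cInf_lower)
  show "bdd_below {r. pos_elem (of_real r - (1/2) *\<^sub>R (x + star x))}"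
    using pos_elem_lower_bound[OF star_real_part] by (intro bdd_belowI) blast
qed (use assms in simp)

lemma upper_bound_ge:
  assumes "\<And>r. pos_elem (of_real r - (1/2) *\<^sub>R (x + star x)) \<Longrightarrow> c \<le> r"
  shows "c \<le> upper_bound x"
  unfolding upper_bound_def
proof (rule cInf_greatest)
  have "pos_elem (of_real (norm x) - (1/2) *\<^sub>R (x + star x))"
    by (rule pos_elem_of_real_minus[OF star_real_part norm_real_part_le])
  then show "{r. pos_elem (of_real r - (1/2) *\<^sub>R (x + star x))} \<noteq> {}" by blast
qed (use assms in simp)

lemma upper_bound_norm: "upper_bound x \<le> norm x"
  by (rule upper_bound_le[OF pos_elem_of_real_minus[OF star_real_part norm_real_part_le]])

lemma sublinear_upper_bound: "sublinear upper_bound"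
  unfolding sublinear_def
proof (intro conjI allI impI)
  fix x y :: 'a
  have "upper_bound (x + y) - s \<le> upper_bound x"
    if s: "pos_elem (of_real s - (1/2) *\<^sub>R (y + star y))" for s
  proof (rule upper_bound_ge)
    fix r assume r: "pos_elem (of_real r - (1/2) *\<^sub>R (x + star x))"
    have "upper_bound (x + y) \<le> r + s"
      using pos_elem_add[OF r s] by (intro upper_bound_le) (simp add: star_add algebra_simps)
    then show "upper_bound (x + y) - s \<le> r" by simp
  qed
  then have "upper_bound (x + y) - upper_bound x \<le> upper_bound y"
    by (intro upper_bound_ge) (smt (verit, best))
  then show "upper_bound (x + y) \<le> upper_bound x + upper_bound y" by simp
next
  fix c :: real and x :: 'a assume c: "c > 0"
  have "upper_bound (c *\<^sub>R x) / c \<le> upper_bound x"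
  proof (rule upper_bound_ge)
    fix r assume r: "pos_elem (of_real r - (1/2) *\<^sub>R (x + star x))"
    have "c *\<^sub>R (of_real r - (1/2) *\<^sub>R (x + star x))
        = of_real (c * r) - (1/2) *\<^sub>R (c *\<^sub>R x + star (c *\<^sub>R x))"
      by (simp add: of_real_def star_scaleR scaleR_diff_right scaleR_add_right)
    then have "upper_bound (c *\<^sub>R x) \<le> c * r"
      using pos_elem_scaleR[OF r, of c] c by (intro upper_bound_le) simp
    then show "upper_bound (c *\<^sub>R x) / c \<le> r" using c by (simp add: field_simps)
  qed
  then show "upper_bound (c *\<^sub>R x) \<le> c * upper_bound x" using c by (simp add: field_simps)
qed

text \<open>At a positive h the sublinear function \<open>upper_bound\<close> takes the value
  \<open>norm h\<close>, so a Hahn-Banach functional that touches it there has the required value;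
  being dominated by it gives positivity and the norm bound.\<close>

lemma exists_state_unital:
  fixes h :: "'a::{cstar_algebra,real_normed_algebra_1}"
  assumes h: "pos_elem h"
  obtains \<rho> where "cstar_state \<rho>" "\<rho> h = of_real (norm h)"
proof -
  obtain f where f: "linear f" "\<And>x. f x \<le> upper_bound x" "f h = upper_bound h"
    using Hahn_Banach[OF sublinear_upper_bound] by blast
  interpret f: linear f by (rule f(1))
  have sh: "star h = h" using h by (simp add: pos_elem_def)
  have fh: "f h = norm h"
  proof (rule antisym)
    show "f h \<le> norm h" using upper_bound_norm[of h] f(3) by simp
    show "norm h \<le> f h" unfolding f(3)
    proof (rule upper_bound_ge)
      fix r assume "pos_elem (of_real r - (1/2) *\<^sub>R (h + star h))"
      then have r: "pos_elem (of_real r - h)" using sh by (simp add: scaleR_2[symmetric])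
      have "pos_elem (of_real r :: 'a)" using pos_elem_add[OF r h] by simp
      have "r \<ge> 0"
      proof (rule ccontr)
        assume "\<not> r \<ge> 0"
        then have "pos_elem (- of_real r :: 'a)" using pos_elem_of_real[of "- r"] by simp
        then have "(of_real r :: 'a) = 0" using pos_elem_antisym \<open>pos_elem (of_real r :: 'a)\<close>
          by blast
        then show False using \<open>\<not> r \<ge> 0\<close> by simp
      qed
      then show "norm h \<le> r" using pos_elem_le_of_real[OF h r] by simp
    qed
  qed
  have skew: "f x \<le> 0" if "star x = - x" for x
    using f(2)[of x] upper_bound_le[of 0 x] that by simp
  have skew0: "f x = 0" if "star x = - x" for x
    using skew[of x] skew[of "- x"] that by (simp add: f.neg)
  have pos: "f k \<ge> 0" if k: "pos_elem k" for k
  proof -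
    have "star k = k" using k by (simp add: pos_elem_def)
    then have "(1/2) *\<^sub>R (- k + star (- k)) = - k" by (simp add: scaleR_2[symmetric])
    then have "upper_bound (- k) \<le> 0" using k upper_bound_le[of 0 "- k"] by simp
    then show ?thesis using f(2)[of "- k"] by (simp add: f.neg)
  qed
  have fstar: "f (star x) = f x" for x
  proof -
    have "f (x - star x) = 0" by (rule skew0) (simp add: star_diff star_star)
    then show ?thesis by (simp add: f.diff)
  qed
  \<comment> \<open>The complex linear functional with real part f.\<close>
  define \<rho> where "\<rho> x = Complex (f x) (- f (scaleC \<i> x))" for x
  have scale: "scaleC z x = Re z *\<^sub>R x + Im z *\<^sub>R scaleC \<i> x" for z and x :: 'a
  proof -
    have "scaleC z x = scaleC (of_real (Re z) + of_real (Im z) * \<i>) x"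
      by (metis complex_eq mult.commute)
    then show ?thesis by (simp only: scaleC_add_left scaleC_scaleC[symmetric] scaleC_of_real)
  qed
  have ii: "scaleC \<i> (scaleC \<i> x) = - x" for x :: 'a by (simp add: scaleC_scaleC)
  have hom: "\<rho> (scaleC z x) = z * \<rho> x" for z x
  proof -
    have "f (scaleC z x) = Re z * f x + Im z * f (scaleC \<i> x)"
      by (subst scale) (simp add: f.add f.scale)
    moreover have "f (scaleC \<i> (scaleC z x)) = Re z * f (scaleC \<i> x) - Im z * f x"
    proof -
      have "scaleC \<i> (scaleC z x) = scaleC z (scaleC \<i> x)" by (simp add: scaleC_scaleC mult.commute)
      then show ?thesis by (simp add: scale[of z "scaleC \<i> x"] f.add f.diff f.scale ii f.neg)
    qed
    ultimately show ?thesis by (simp add: \<rho>_def complex_eq_iff algebra_simps)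
  qed
  have re: "Re (\<rho> x) \<le> norm x" for x
    using f(2)[of x] upper_bound_norm[of x] by (simp add: \<rho>_def)
  have bound: "cmod (\<rho> x) \<le> norm x" for x
  proof (cases "\<rho> x = 0")
    case False
    \<comment> \<open>A phase that rotates the value of \<rho> to its modulus, so that the bound on
      the real part applies.\<close>
    define w where "w = cnj (\<rho> x) / cmod (\<rho> x)"
    have "cmod w = 1" using False by (simp add: w_def norm_divide)
    moreover have "\<rho> (scaleC w x) = of_real (cmod (\<rho> x))"
      using False by (simp add: hom w_def complex_norm_square[symmetric] power2_eq_square mult.commute)
    ultimately show ?thesis using re[of "scaleC w x"] by (simp add: norm_scaleC)
  qed simp
  have "cstar_state \<rho>" unfolding cstar_state_def
  proof (intro conjI allI)
    show "\<rho> (x + y) = \<rho> x + \<rho> y" for x y by (simp add: \<rho>_def f.add scaleC_add_right complex_eq_iff)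
    show "\<rho> (star x) = cnj (\<rho> x)" for x
    proof -
      have "f (scaleC \<i> (star x)) = f (- star (scaleC \<i> x))" by (simp add: star_scaleC)
      then show ?thesis by (simp only: \<rho>_def f.neg fstar) (simp add: complex_eq_iff fstar)
    qed
    show "0 \<le> Re (\<rho> (star x * x))" for x using pos[OF pos_elem_star_mult[of x]] by (simp add: \<rho>_def)
  qed (rule hom bound)+
  moreover have "\<rho> h = of_real (norm h)"
    using fh skew0[of "scaleC \<i> h"] sh by (simp add: \<rho>_def complex_eq_iff star_scaleC)
  ultimately show ?thesis by (rule that)
qed

theorem exists_state:
  assumes "positive (h :: 'b::cstar_algebra)"
  obtains \<rho> where "cstar_state \<rho>" "\<rho> h = of_real (norm h)"
proof -
  obtain \<rho> where \<rho>: "cstar_state \<rho>" "\<rho> (unit_embed h) = of_real (norm (unit_embed h))"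
    using exists_state_unital[of "unit_embed h"] assms by (auto simp: positive_def)
  have "cstar_state (\<lambda>x. \<rho> (unit_embed x))"
    using \<rho>(1) norm_unit_embed unfolding cstar_state_def unit_embed_simps by metis
  then show ?thesis using that \<rho>(2) by simp
qed

text \<open>The difference of \<open>norm b ^ 2\<close> and \<open>star b * b\<close> lives only in
  the unitization. Its root is split into a real scalar and a base part n, so that it can be applied
  to elements of the algebra itself and transported by homomorphisms.\<close>

lemma square_root_defect:
  fixes b :: "'b::cstar_algebra"
  obtains \<mu> :: real and n where "star n = n"
    "Unitization (of_real \<mu>) n * Unitization (of_real \<mu>) n
        = of_real ((norm b)\<^sup>2) - unit_embed (star b * b)"
proof -
  have "pos_elem (of_real ((norm b)\<^sup>2) - unit_embed (star b * b))"
  proof (rule pos_elem_of_real_minus)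
    show "star (unit_embed (star b * b)) = unit_embed (star b * b)"
      by (simp add: star_mult star_star flip: unit_embed_simps)
    show "norm (unit_embed (star b * b)) \<le> (norm b)\<^sup>2" by (simp add: cstar_identity)
  qed
  then obtain l where l: "star l = l" "of_real ((norm b)\<^sup>2) - unit_embed (star b * b) = l * l"
    by (rule pos_elem_sqrt) blast
  have "cnj (scalar_part l) = scalar_part l" "star (base_part l) = base_part l"
    using l(1) by (metis star_unitization_def unitization.sel)+
  then have "scalar_part l = of_real (Re (scalar_part l))" by (simp add: complex_eq_iff)
  then have "l = Unitization (of_real (Re (scalar_part l))) (base_part l)"
    by (metis unitization.collapse)
  then show ?thesis using that \<open>star (base_part l) = base_part l\<close> l(2) by metis
qed

lemma scalar_part_of_real [simp]: "scalar_part (of_real r) = of_real r" "base_part (of_real r) = 0"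
  by (simp_all add: of_real_def)

text \<open>With l the root from \<open>square_root_defect\<close>, the witness is l w, that is
  \<open>\<mu> *\<^sub>R w + n * w\<close>, which lies in the algebra itself.\<close>

lemma star_mult_le_norm_square:
  fixes b w :: "'b::cstar_algebra"
  obtains z where "(norm b)\<^sup>2 *\<^sub>R (star w * w) - star (b * w) * (b * w) = star z * z"
proof -
  obtain \<mu> n where n: "star n = n"
    "Unitization (of_real \<mu>) n * Unitization (of_real \<mu>) n
        = of_real ((norm b)\<^sup>2) - unit_embed (star b * b)"
    by (rule square_root_defect)
  have "scalar_part (Unitization (of_real \<mu>) n * Unitization (of_real \<mu>) n) = of_real ((norm b)\<^sup>2)"
    "base_part (Unitization (of_real \<mu>) n * Unitization (of_real \<mu>) n) = - (star b * b)"
    unfolding n(2) by (simp_all del: of_real_power)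
  then have \<mu>: "\<mu> * \<mu> = (norm b)\<^sup>2" and base: "\<mu> *\<^sub>R n + \<mu> *\<^sub>R n + n * n = - (star b * b)"
    by (simp_all add: scaleC_of_real flip: of_real_mult of_real_power)
  have "star (\<mu> *\<^sub>R w + n * w) * (\<mu> *\<^sub>R w + n * w)
      = (\<mu> * \<mu>) *\<^sub>R (star w * w) + star w * ((\<mu> *\<^sub>R n + \<mu> *\<^sub>R n + n * n) * w)"
    by (simp add: star_add star_scaleR star_mult n(1) algebra_simps)
  also have "\<dots> = (norm b)\<^sup>2 *\<^sub>R (star w * w) - star (b * w) * (b * w)"
    unfolding base \<mu> by (simp add: star_mult mult.assoc)
  finally show ?thesis using that by metis
qed

text \<open>Applying f to the base part of the root and keeping its scalar part exhibits the
  difference of \<open>norm b ^ 2\<close> and \<open>star (f b) * f b\<close> as a square in the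
  unitization.\<close>

lemma star_hom_norm_le:
  fixes f :: "'b::cstar_algebra \<Rightarrow> 'b"
  assumes f: "star_hom f"
  shows "norm (f b) \<le> norm b"
proof -
  have f_add: "f (x + y) = f x + f y" and f_mult: "f (x * y) = f x * f y"
    and f_scale: "f (scaleC z x) = scaleC z (f x)" and f_star: "f (star x) = star (f x)" for x y z
    using f by (auto simp: star_hom_def)
  obtain \<mu> n where n: "star n = n"
    "Unitization (of_real \<mu>) n * Unitization (of_real \<mu>) n
        = of_real ((norm b)\<^sup>2) - unit_embed (star b * b)"
    by (rule square_root_defect)
  have parts: "scalar_part (Unitization (of_real \<mu>) n * Unitization (of_real \<mu>) n)
      = of_real ((norm b)\<^sup>2)"
    "base_part (Unitization (of_real \<mu>) n * Unitization (of_real \<mu>) n) = - (star b * b)"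
    unfolding n(2) by (simp_all del: of_real_power)
  have f0: "f 0 = 0" using f_scale[of 0 0] by simp
  let ?l = "Unitization (of_real \<mu>) (f n)"
  have sl: "star ?l = ?l" by (simp add: star_unitization_def n(1) flip: f_star)
  have "f (star b * b) = - base_part (?l * ?l)"
  proof -
    have "f (- (star b * b)) = base_part (?l * ?l)"
      unfolding parts(2)[symmetric] by (simp add: f_add f_mult f_scale)
    moreover have "f (- (star b * b)) = - f (star b * b)"
      using f_scale[of "-1" "star b * b"] by simp
    ultimately show ?thesis by (metis minus_minus)
  qed
  then have "of_real ((norm b)\<^sup>2) - unit_embed (star (f b) * f b) = ?l * ?l"
    using parts(1) by (intro unitization.expand) (simp add: f_mult f_star del: of_real_power)
  then have "pos_elem (of_real ((norm b)\<^sup>2) - unit_embed (star (f b) * f b))"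
    using pos_elem_square[OF sl] by simp
  then have "norm (unit_embed (star (f b) * f b)) \<le> (norm b)\<^sup>2"
    using positive_star_mult[of "f b"] unfolding positive_def by (intro pos_elem_le_of_real) auto
  then have "(norm (f b))\<^sup>2 \<le> (norm b)\<^sup>2" by (simp add: cstar_identity)
  then show ?thesis using norm_ge_zero power2_le_imp_le by blast
qed

section \<open>Calculus with states and the Cauchy-Schwarz inequality\<close>

lemma state_add: "cstar_state \<rho> \<Longrightarrow> \<rho> (x + y) = \<rho> x + \<rho> y"
  and state_scaleC: "cstar_state \<rho> \<Longrightarrow> \<rho> (scaleC z x) = z * \<rho> x"
  and state_star: "cstar_state \<rho> \<Longrightarrow> \<rho> (star x) = cnj (\<rho> x)"
  and state_nonneg: "cstar_state \<rho> \<Longrightarrow> 0 \<le> Re (\<rho> (star x * x))"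
  and state_norm: "cstar_state \<rho> \<Longrightarrow> cmod (\<rho> x) \<le> norm x"
  by (simp_all add: cstar_state_def)

lemma state_zero: "cstar_state \<rho> \<Longrightarrow> \<rho> 0 = 0"
  using state_scaleC[of \<rho> 0 0] by simp

lemma state_scaleR: "cstar_state \<rho> \<Longrightarrow> \<rho> (r *\<^sub>R x) = r *\<^sub>R \<rho> x"
  by (simp add: state_scaleC scaleR_conv_of_real flip: scaleC_of_real)

lemma state_minus: "cstar_state \<rho> \<Longrightarrow> \<rho> (- x) = - \<rho> x"
  using state_scaleR[of \<rho> "-1" x] by simp

lemma state_diff: "cstar_state \<rho> \<Longrightarrow> \<rho> (x - y) = \<rho> x - \<rho> y"
  using state_add[of \<rho> x "- y"] by (simp add: state_minus)

lemma state_sum: "cstar_state \<rho> \<Longrightarrow> \<rho> (sum f F) = (\<Sum>i\<in>F. \<rho> (f i))"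
  by (induction F rule: infinite_finite_induct) (auto simp: state_add state_zero)

lemma bounded_linear_state: "cstar_state \<rho> \<Longrightarrow> bounded_linear \<rho>"
  by (rule bounded_linear_intro[of _ 1]) (auto simp: state_add state_scaleR state_norm)

lemma state_Im_zero: "cstar_state \<rho> \<Longrightarrow> Im (\<rho> (star x * x)) = 0"
  using state_star[of \<rho> "star x * x"] by (simp add: star_mult star_star complex_eq_iff)

lemma state_Re_le_norm: "cstar_state \<rho> \<Longrightarrow> Re (\<rho> x) \<le> norm x"
  using state_norm[of \<rho> x] complex_Re_le_cmod[of "\<rho> x"] by simp

lemma positive_norm_le:
  assumes "positive h" "\<And>\<rho>. cstar_state \<rho> \<Longrightarrow> Re (\<rho> h) \<le> c"
  shows "norm h \<le> c"
proof -
  obtain \<rho> where "cstar_state \<rho>" "\<rho> h = of_real (norm h)" by (rule exists_state[OF assms(1)])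
  then show ?thesis using assms(2)[of \<rho>] by simp
qed

text \<open>The quadratic form is tested along z = - t times the conjugate of c. For b > 0 the
  choice t = 1/b gives the claim; for b = 0 a large t forces c = 0.\<close>

lemma Cauchy_Schwarz_from_quadratic:
  fixes a b :: real and c :: complex
  assumes q: "\<And>z. 0 \<le> a + 2 * Re (z * c) + (cmod z)\<^sup>2 * b" and b: "b \<ge> 0"
  shows "(cmod c)\<^sup>2 \<le> a * b"
proof -
  have key: "0 \<le> a - 2 * t * (cmod c)\<^sup>2 + t\<^sup>2 * (cmod c)\<^sup>2 * b" for t
  proof -
    have "Re (complex_of_real (- t) * cnj c * c) = - t * (cmod c)\<^sup>2"
      by (simp add: mult.assoc complex_norm_square[symmetric] mult.commute[of "cnj c"]
          flip: of_real_power of_real_mult of_real_minus)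
    moreover have "(cmod (complex_of_real (- t) * cnj c))\<^sup>2 = t\<^sup>2 * (cmod c)\<^sup>2"
      by (simp add: norm_mult power_mult_distrib)
    ultimately show ?thesis using q[of "complex_of_real (- t) * cnj c"] by simp
  qed
  show ?thesis
  proof (cases "b = 0")
    case True
    have "cmod c = 0"
    proof (rule ccontr)
      assume "cmod c \<noteq> 0"
      then have "(cmod c)\<^sup>2 > 0" by simp
      \<comment> \<open>The value of t is chosen so that the right hand side of \<open>key\<close>
        becomes -1.\<close>
      then show False using key[of "(a + 1) / (2 * (cmod c)\<^sup>2)"] True by simp
    qed
    then show ?thesis using True by simp
  next
    case False
    then have "b > 0" using b by simp
    then have "0 \<le> a - (cmod c)\<^sup>2 / b" using key[of "1 / b"]
      by (simp add: power2_eq_square field_simps)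
    then show ?thesis using \<open>b > 0\<close> by (simp add: field_simps)
  qed
qed

lemma state_Cauchy_Schwarz:
  assumes \<rho>: "cstar_state \<rho>"
  shows "(cmod (\<rho> (star x * y)))\<^sup>2 \<le> Re (\<rho> (star x * x)) * Re (\<rho> (star y * y))"
proof (rule Cauchy_Schwarz_from_quadratic)
  fix z
  have "star (x + scaleC z y) * (x + scaleC z y) = star x * x + scaleC z (star x * y)
      + star (scaleC z (star x * y)) + scaleC (cnj z * z) (star y * y)"
    by (simp add: star_add star_mult star_scaleC star_star algebra_simps mult_scaleC_left
        mult_scaleC_right scaleC_add_right scaleC_scaleC)
  then have "Re (\<rho> (star (x + scaleC z y) * (x + scaleC z y)))
      = Re (\<rho> (star x * x)) + 2 * Re (z * \<rho> (star x * y)) + (cmod z)\<^sup>2 * Re (\<rho> (star y * y))"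
    using state_Im_zero[OF \<rho>, of y]
    by (simp add: state_add[OF \<rho>] state_star[OF \<rho>] state_scaleC[OF \<rho>] cmod_power2)
      (simp add: power2_eq_square)
  then show "0 \<le> Re (\<rho> (star x * x)) + 2 * Re (z * \<rho> (star x * y)) + (cmod z)\<^sup>2 * Re (\<rho> (star y * y))"
    using state_nonneg[OF \<rho>, of "x + scaleC z y"] by linarith
qed (rule state_nonneg[OF \<rho>])

section \<open>The Hilbert module of square-summable families\<close>

text \<open>Phrasing the Cauchy criterion through finite sets that avoid F0 allows it to be
  transferred from one family to another by comparing finite sums.\<close>

lemma summable_on_iff_tails:
  fixes f :: "'a \<Rightarrow> 'b::banach"
  shows "f summable_on UNIV \<longleftrightarrow>
    (\<forall>e>0. \<exists>F0. finite F0 \<and> (\<forall>F. finite F \<and> F \<inter> F0 = {} \<longrightarrow> norm (sum f F) < e))"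
proof (intro iffI allI impI)
  fix e :: real assume f: "f summable_on UNIV" and e: "e > 0"
  then have "(sum f \<longlongrightarrow> infsum f UNIV) (finite_subsets_at_top UNIV)"
    using infsum_tendsto by blast
  then have "\<forall>\<^sub>F F in finite_subsets_at_top UNIV. dist (sum f F) (infsum f UNIV) < e / 2"
    using e by (intro tendstoD) auto
  then obtain F0 where F0: "finite F0"
    "\<And>F. finite F \<Longrightarrow> F0 \<subseteq> F \<Longrightarrow> dist (sum f F) (infsum f UNIV) < e / 2"
    unfolding eventually_finite_subsets_at_top by auto
  have "norm (sum f F) < e" if F: "finite F" "F \<inter> F0 = {}" for F
  proof -
    have "sum f (F \<union> F0) = sum f F + sum f F0" using F F0(1) by (intro sum.union_disjoint) auto
    then have "norm (sum f F) = dist (sum f (F \<union> F0)) (sum f F0)" by (simp add: dist_norm)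
    also have "\<dots> \<le> dist (sum f (F \<union> F0)) (infsum f UNIV) + dist (sum f F0) (infsum f UNIV)"
      by (rule dist_triangle2)
    also have "\<dots> < e" using F0(2)[of "F \<union> F0"] F0(2)[of F0] F F0(1) by simp
    finally show ?thesis .
  qed
  then show "\<exists>F0. finite F0 \<and> (\<forall>F. finite F \<and> F \<inter> F0 = {} \<longrightarrow> norm (sum f F) < e)"
    using F0(1) by blast
next
  assume tails: "\<forall>e>0. \<exists>F0. finite F0 \<and> (\<forall>F. finite F \<and> F \<inter> F0 = {} \<longrightarrow> norm (sum f F) < e)"
  have "\<exists>P. eventually P (finite_subsets_at_top UNIV) \<and>
      (\<forall>F F'. P F \<and> P F' \<longrightarrow> dist (sum f F) (sum f F') < e)" if e: "e > 0" for e
  proof -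
    obtain F0 where F0: "finite F0" "\<And>F. finite F \<Longrightarrow> F \<inter> F0 = {} \<Longrightarrow> norm (sum f F) < e / 2"
      using tails e by (meson half_gt_zero)
    let ?P = "\<lambda>F. finite F \<and> F0 \<subseteq> F"
    have "dist (sum f F) (sum f F') < e" if "?P F" "?P F'" for F F'
    proof -
      have *: "dist (sum f F) (sum f F0) < e / 2" if "?P F" for F
        using F0(2)[of "F - F0"] that F0(1) by (simp add: dist_norm sum_diff Diff_Int_distrib2)
      then show ?thesis using *[OF that(1)] *[OF that(2)] dist_triangle2[of "sum f F"
          "sum f F'" "sum f F0"]
        by linarith
    qed
    moreover have "eventually ?P (finite_subsets_at_top UNIV)"
      using F0(1) unfolding eventually_finite_subsets_at_top by auto
    ultimately show ?thesis by blast
  qed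
  then have "cauchy_filter (filtermap (sum f) (finite_subsets_at_top UNIV))"
    by (simp add: cauchy_filter_metric_filtermap)
  moreover have "complete (UNIV::'b set)"
    by (meson Cauchy_convergent UNIV_I complete_def convergent_def)
  ultimately obtain L where "(sum f \<longlongrightarrow> L) (finite_subsets_at_top UNIV)"
    using complete_uniform[where S=UNIV] by (force simp add: filterlim_def)
  then show "f summable_on UNIV" using summable_on_def has_sum_def by blast
qed

text \<open>The norm of a positive finite sum is attained at a state, and there f is dominated by g.
  So the tails of f are no larger than those of g.\<close>

lemma summable_on_state_comparison:
  fixes f g :: "'g \<Rightarrow> 'b::cstar_algebra"
  assumes g: "g summable_on UNIV" and f: "\<And>t. positive (f t)"
    and le: "\<And>\<rho> t. cstar_state \<rho> \<Longrightarrow> Re (\<rho> (f t)) \<le> Re (\<rho> (g t))"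
  shows "f summable_on UNIV"
  unfolding summable_on_iff_tails
proof (intro allI impI)
  fix e :: real assume "e > 0"
  with g obtain F0 where F0: "finite F0" "\<And>F. finite F \<Longrightarrow> F \<inter> F0 = {} \<Longrightarrow> norm (sum g F) < e"
    unfolding summable_on_iff_tails by meson
  have "norm (sum f F) < e" if "finite F" "F \<inter> F0 = {}" for F
  proof -
    have "norm (sum f F) \<le> norm (sum g F)"
    proof (rule positive_norm_le)
      fix \<rho> :: "'b \<Rightarrow> complex" assume \<rho>: "cstar_state \<rho>"
      have "Re (\<rho> (sum f F)) \<le> Re (\<rho> (sum g F))"
        by (simp add: state_sum[OF \<rho>] sum_mono le[OF \<rho>])
      also have "\<dots> \<le> norm (sum g F)" by (rule state_Re_le_norm[OF \<rho>])
      finally show "Re (\<rho> (sum f F)) \<le> norm (sum g F)" .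
    qed (rule positive_sum[OF f])
    then show ?thesis using F0(2)[OF that] by simp
  qed
  then show "\<exists>F0. finite F0 \<and> (\<forall>F. finite F \<and> F \<inter> F0 = {} \<longrightarrow> norm (sum f F) < e)"
    using F0(1) by blast
qed

lemma ell2_summable: "\<xi> \<in> ell2 \<Longrightarrow> (\<lambda>t. star (\<xi> t) * \<xi> t) summable_on UNIV"
  by (simp add: ell2_def)

lemma ell2_scaleC:
  assumes "\<xi> \<in> ell2" shows "(\<lambda>t. scaleC z (\<xi> t)) \<in> ell2"
proof -
  have "(\<lambda>t. scaleC (cnj z * z) (star (\<xi> t) * \<xi> t)) summable_on UNIV"
    by (rule summable_on_bounded_linear[OF bounded_linear_scaleC ell2_summable[OF assms], unfolded o_def])
  then show ?thesis
    by (simp add: ell2_def star_scaleC mult_scaleC_left mult_scaleC_right scaleC_scaleC mult.commute)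
qed

lemma ell2_add:
  assumes "\<xi> \<in> ell2" "\<eta> \<in> ell2" shows "(\<lambda>t. \<xi> t + \<eta> t) \<in> ell2"
proof -
  have "(\<lambda>t. 2 *\<^sub>R (star (\<xi> t) * \<xi> t) + 2 *\<^sub>R (star (\<eta> t) * \<eta> t)) summable_on UNIV"
    by (intro summable_on_add summable_on_scaleR_right ell2_summable assms)
  then have "(\<lambda>t. star (\<xi> t + \<eta> t) * (\<xi> t + \<eta> t)) summable_on UNIV"
  proof (rule summable_on_state_comparison)
    fix \<rho> :: "'b \<Rightarrow> complex" and t assume \<rho>: "cstar_state \<rho>"
    have "2 *\<^sub>R (star (\<xi> t) * \<xi> t) + 2 *\<^sub>R (star (\<eta> t) * \<eta> t)
        = star (\<xi> t + \<eta> t) * (\<xi> t + \<eta> t) + star (\<xi> t - \<eta> t) * (\<xi> t - \<eta> t)"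
      by (simp add: star_add star_diff scaleR_2 algebra_simps)
    then show "Re (\<rho> (star (\<xi> t + \<eta> t) * (\<xi> t + \<eta> t)))
        \<le> Re (\<rho> (2 *\<^sub>R (star (\<xi> t) * \<xi> t) + 2 *\<^sub>R (star (\<eta> t) * \<eta> t)))"
      using state_nonneg[OF \<rho>, of "\<xi> t - \<eta> t"] by (simp only: state_add[OF \<rho>]) simp
  qed simp
  then show ?thesis by (simp add: ell2_def)
qed

lemma ell2_finite_support: "finite {t. \<xi> t \<noteq> 0} \<Longrightarrow> \<xi> \<in> ell2"
  unfolding ell2_def by (auto intro!: finite_nonzero_values_imp_summable_on elim!: rev_finite_subset)

lemma ell2_zero [simp]: "(\<lambda>t. 0) \<in> ell2"
  by (rule ell2_finite_support) simp

lemma ell2_scaleR: "\<xi> \<in> ell2 \<Longrightarrow> (\<lambda>t. r *\<^sub>R \<xi> t) \<in> ell2"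
  using ell2_scaleC[of \<xi> "of_real r"] by (simp add: scaleC_of_real)

lemma ell2_minus: "\<xi> \<in> ell2 \<Longrightarrow> (\<lambda>t. - \<xi> t) \<in> ell2"
  using ell2_scaleR[of \<xi> "-1"] by simp

lemma ell2_diff: "\<xi> \<in> ell2 \<Longrightarrow> \<eta> \<in> ell2 \<Longrightarrow> (\<lambda>t. \<xi> t - \<eta> t) \<in> ell2"
  using ell2_add[OF _ ell2_minus] by simp

lemma ell2_sum: "(\<And>i. i \<in> F \<Longrightarrow> \<xi> i \<in> ell2) \<Longrightarrow> (\<lambda>t. \<Sum>i\<in>F. \<xi> i t) \<in> ell2"
  by (induction F rule: infinite_finite_induct) (auto intro: ell2_add)

text \<open>Polarization over the fourth roots of unity: the weights z in \<open>q z\<close> cancel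
  every term except \<open>star (\<xi> t) * \<eta> t\<close>, which is counted four times.\<close>

lemma ell2_inner_summable:
  assumes "\<xi> \<in> ell2" "\<eta> \<in> ell2"
  shows "(\<lambda>t. star (\<xi> t) * \<eta> t) summable_on UNIV"
proof -
  define q where "q z t = scaleC z (star (\<eta> t + scaleC z (\<xi> t)) * (\<eta> t + scaleC z (\<xi> t)))" for z t
  have "q z summable_on UNIV" for z
    unfolding q_def
    by (intro summable_on_bounded_linear[OF bounded_linear_scaleC, unfolded o_def] ell2_summable
        ell2_add ell2_scaleC assms)
  then have "(\<lambda>t. (1/4) *\<^sub>R (q 1 t + q \<i> t + q (-1) t + q (-\<i>) t)) summable_on UNIV"
    by (intro summable_on_scaleR_right summable_on_add)
  moreover have "(1/4) *\<^sub>R (q 1 t + q \<i> t + q (-1) t + q (-\<i>) t) = star (\<xi> t) * \<eta> t" for t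
  proof -
    have *: "q z t = scaleC z (star (\<eta> t) * \<eta> t) + scaleC (z * z) (star (\<eta> t) * \<xi> t)
      + scaleC (z * cnj z) (star (\<xi> t) * \<eta> t) + scaleC (z * cnj z * z) (star (\<xi> t) * \<xi> t)" for z
      by (simp add: q_def star_add star_scaleC algebra_simps mult_scaleC_left mult_scaleC_right
          scaleC_add_right scaleC_scaleC)
    have "q 1 t + q \<i> t + q (-1) t + q (-\<i>) t = 4 *\<^sub>R (star (\<xi> t) * \<eta> t)"
      unfolding * using scaleR_add_left[of 2 2 "star (\<xi> t) * \<eta> t"] by (simp add: scaleR_2)
    then show ?thesis by simp
  qed
  ultimately show ?thesis by simp
qed

lemma ell2_inner_add_right:
  "\<xi> \<in> ell2 \<Longrightarrow> \<eta> \<in> ell2 \<Longrightarrow> \<zeta> \<in> ell2 \<Longrightarrow>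
    ell2_inner \<xi> (\<lambda>t. \<eta> t + \<zeta> t) = ell2_inner \<xi> \<eta> + ell2_inner \<xi> \<zeta>"
  unfolding ell2_inner_def by (simp add: distrib_left infsum_add ell2_inner_summable)

lemma ell2_inner_scaleC_right:
  "\<xi> \<in> ell2 \<Longrightarrow> \<eta> \<in> ell2 \<Longrightarrow> ell2_inner \<xi> (\<lambda>t. scaleC z (\<eta> t)) = scaleC z (ell2_inner \<xi> \<eta>)"
  unfolding ell2_inner_def mult_scaleC_right
  by (intro infsumI has_sum_bounded_linear[OF bounded_linear_scaleC, unfolded o_def]
      has_sum_infsum ell2_inner_summable)

lemma ell2_inner_star:
  "\<xi> \<in> ell2 \<Longrightarrow> \<eta> \<in> ell2 \<Longrightarrow> star (ell2_inner \<xi> \<eta>) = ell2_inner \<eta> \<xi>"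
  unfolding ell2_inner_def
  using infsumI[OF has_sum_bounded_linear[OF bounded_linear_star
        has_sum_infsum[OF ell2_inner_summable[of \<xi> \<eta>]], unfolded o_def]]
  by (simp add: star_mult star_star)

lemma ell2_inner_add_left:
  "\<xi> \<in> ell2 \<Longrightarrow> \<eta> \<in> ell2 \<Longrightarrow> \<zeta> \<in> ell2 \<Longrightarrow>
    ell2_inner (\<lambda>t. \<eta> t + \<zeta> t) \<xi> = ell2_inner \<eta> \<xi> + ell2_inner \<zeta> \<xi>"
  using arg_cong[OF ell2_inner_add_right[of \<xi> \<eta> \<zeta>], of star]
  by (simp add: star_add ell2_inner_star ell2_add)

lemma ell2_inner_scaleC_left:
  "\<xi> \<in> ell2 \<Longrightarrow> \<eta> \<in> ell2 \<Longrightarrow> ell2_inner (\<lambda>t. scaleC z (\<eta> t)) \<xi> = scaleC (cnj z) (ell2_inner \<eta> \<xi>)"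
  using arg_cong[OF ell2_inner_scaleC_right[of \<xi> \<eta> z], of star]
  by (simp add: star_scaleC ell2_inner_star ell2_scaleC)

lemma ell2_inner_diff_right:
  "\<xi> \<in> ell2 \<Longrightarrow> \<eta> \<in> ell2 \<Longrightarrow> \<zeta> \<in> ell2 \<Longrightarrow>
    ell2_inner \<xi> (\<lambda>t. \<eta> t - \<zeta> t) = ell2_inner \<xi> \<eta> - ell2_inner \<xi> \<zeta>"
  using ell2_inner_add_right[of \<xi> "\<lambda>t. \<eta> t - \<zeta> t" \<zeta>] by (simp add: ell2_diff)

lemma ell2_inner_diff_left:
  "\<xi> \<in> ell2 \<Longrightarrow> \<eta> \<in> ell2 \<Longrightarrow> \<zeta> \<in> ell2 \<Longrightarrow>
    ell2_inner (\<lambda>t. \<eta> t - \<zeta> t) \<xi> = ell2_inner \<eta> \<xi> - ell2_inner \<zeta> \<xi>"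
  using arg_cong[OF ell2_inner_diff_right[of \<xi> \<eta> \<zeta>], of star]
  by (simp add: star_diff ell2_inner_star ell2_diff)

lemma ell2_inner_zero [simp]: "ell2_inner (\<lambda>t. 0) \<xi> = 0" "ell2_inner \<xi> (\<lambda>t. 0) = 0"
  by (simp_all add: ell2_inner_def)

lemma ell2_inner_sum_right:
  "\<xi> \<in> ell2 \<Longrightarrow> (\<And>i. i \<in> F \<Longrightarrow> \<eta> i \<in> ell2) \<Longrightarrow>
    ell2_inner \<xi> (\<lambda>t. \<Sum>i\<in>F. \<eta> i t) = (\<Sum>i\<in>F. ell2_inner \<xi> (\<eta> i))"
  by (induction F rule: infinite_finite_induct) (auto simp: ell2_inner_add_right ell2_sum)

lemma state_ell2_inner:
  assumes "cstar_state \<rho>" "\<xi> \<in> ell2" "\<eta> \<in> ell2"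
  shows "((\<lambda>t. \<rho> (star (\<xi> t) * \<eta> t)) has_sum \<rho> (ell2_inner \<xi> \<eta>)) UNIV"
  unfolding ell2_inner_def
  by (rule has_sum_bounded_linear[OF bounded_linear_state[OF assms(1)] has_sum_infsum[OF
        ell2_inner_summable[OF assms(2,3)]], unfolded o_def])

text \<open>The squared seminorm of \<xi> in the Hilbert space that the module and the state
  determine; norm estimates in the module are reduced to these numbers.\<close>

definition state_square :: "('b::cstar_algebra \<Rightarrow> complex) \<Rightarrow> ('g \<Rightarrow> 'b) \<Rightarrow> real" where
  "state_square \<rho> \<xi> = Re (\<rho> (ell2_inner \<xi> \<xi>))"

lemma state_square_has_sum:
  "cstar_state \<rho> \<Longrightarrow> \<xi> \<in> ell2 \<Longrightarrow> ((\<lambda>t. Re (\<rho> (star (\<xi> t) * \<xi> t))) has_sum state_square \<rho> \<xi>) UNIV"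
  unfolding state_square_def by (intro has_sum_Re state_ell2_inner)

lemma state_square_nonneg: "cstar_state \<rho> \<Longrightarrow> \<xi> \<in> ell2 \<Longrightarrow> 0 \<le> state_square \<rho> \<xi>"
  using state_square_has_sum[of \<rho> \<xi>] by (rule has_sum_nonneg) (auto simp: state_nonneg)

lemma state_square_sum_le:
  assumes "cstar_state \<rho>" "\<xi> \<in> ell2" "finite F"
  shows "(\<Sum>t\<in>F. Re (\<rho> (star (\<xi> t) * \<xi> t))) \<le> state_square \<rho> \<xi>"
  by (rule finite_sum_le_has_sum[OF state_square_has_sum[OF assms(1,2)]])
    (auto simp: assms state_nonneg)

lemma state_inner_real:
  assumes "cstar_state \<rho>" "\<xi> \<in> ell2"
  shows "\<rho> (ell2_inner \<xi> \<xi>) = of_real (state_square \<rho> \<xi>)"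
  using state_star[OF assms(1), of "ell2_inner \<xi> \<xi>"] ell2_inner_star[OF assms(2,2)]
  by (simp add: state_square_def complex_eq_iff)

lemma ell2_norm_nonneg [simp]: "0 \<le> ell2_norm \<xi>"
  by (simp add: ell2_norm_def)

lemma ell2_norm_square: "(ell2_norm \<xi>)\<^sup>2 = norm (ell2_inner \<xi> \<xi>)"
  by (simp add: ell2_norm_def)

lemma state_square_le_norm: "cstar_state \<rho> \<Longrightarrow> state_square \<rho> \<xi> \<le> (ell2_norm \<xi>)\<^sup>2"
  by (simp add: state_square_def ell2_norm_square state_Re_le_norm)

text \<open>Positivity is at hand for finite sums, so the bound is shown for partial sums and then
  passed to the limit.\<close>

lemma ell2_norm_le_states:
  fixes \<xi> :: "'g \<Rightarrow> 'b::cstar_algebra"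
  assumes \<xi>: "\<xi> \<in> ell2" and c: "c \<ge> 0" and le: "\<And>\<rho>. cstar_state \<rho> \<Longrightarrow> state_square \<rho> \<xi> \<le> c\<^sup>2"
  shows "ell2_norm \<xi> \<le> c"
proof -
  let ?f = "\<lambda>t. star (\<xi> t) * \<xi> t"
  have fin: "norm (sum ?f F) \<le> c\<^sup>2" if "finite F" for F
  proof (rule positive_norm_le)
    show "Re (\<rho> (sum ?f F)) \<le> c\<^sup>2" if "cstar_state \<rho>" for \<rho>
      using state_square_sum_le[OF that \<xi> \<open>finite F\<close>] le[OF that] by (simp add: state_sum[OF that])
  qed (rule positive_sum, simp)
  have "(sum ?f \<longlongrightarrow> ell2_inner \<xi> \<xi>) (finite_subsets_at_top UNIV)"
    unfolding ell2_inner_def by (rule infsum_tendsto[OF ell2_summable[OF \<xi>]])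
  then have "norm (ell2_inner \<xi> \<xi>) \<le> c\<^sup>2"
    by (rule Lim_norm_ubound[rotated])
      (auto intro!: eventually_finite_subsets_at_top_weakI fin)
  then show ?thesis using c by (metis ell2_norm_square power2_le_imp_le)
qed

lemma state_inner_Cauchy_Schwarz:
  assumes \<rho>: "cstar_state \<rho>" and \<xi>: "\<xi> \<in> ell2" and \<eta>: "\<eta> \<in> ell2"
  shows "(cmod (\<rho> (ell2_inner \<xi> \<eta>)))\<^sup>2 \<le> state_square \<rho> \<xi> * state_square \<rho> \<eta>"
proof (rule Cauchy_Schwarz_from_quadratic)
  fix z
  have z\<eta>: "(\<lambda>t. scaleC z (\<eta> t)) \<in> ell2" by (rule ell2_scaleC[OF \<eta>])
  have sum: "(\<lambda>t. \<xi> t + scaleC z (\<eta> t)) \<in> ell2" by (rule ell2_add[OF \<xi> z\<eta>])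
  have "\<rho> (ell2_inner (\<lambda>t. \<xi> t + scaleC z (\<eta> t)) (\<lambda>t. \<xi> t + scaleC z (\<eta> t)))
      = \<rho> (ell2_inner \<xi> \<xi>) + z * \<rho> (ell2_inner \<xi> \<eta>) + cnj (z * \<rho> (ell2_inner \<xi> \<eta>))
        + z * cnj z * \<rho> (ell2_inner \<eta> \<eta>)"
    using state_star[OF \<rho>, of "ell2_inner \<xi> \<eta>"]
    by (simp add: ell2_inner_add_left ell2_inner_add_right sum \<xi> \<eta> z\<eta> ell2_inner_scaleC_left
        ell2_inner_scaleC_right ell2_inner_star state_add[OF \<rho>] state_scaleC[OF \<rho>] scaleC_add_right algebra_simps)
  then have "state_square \<rho> (\<lambda>t. \<xi> t + scaleC z (\<eta> t))
      = state_square \<rho> \<xi> + 2 * Re (z * \<rho> (ell2_inner \<xi> \<eta>)) + (cmod z)\<^sup>2 * state_square \<rho> \<eta>"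
    by (simp only: state_square_def[of \<rho> "\<lambda>t. \<xi> t + scaleC z (\<eta> t)"] state_inner_real[OF \<rho> \<xi>]
        state_inner_real[OF \<rho> \<eta>] complex_norm_square[symmetric]) simp
  then show "0 \<le> state_square \<rho> \<xi> + 2 * Re (z * \<rho> (ell2_inner \<xi> \<eta>)) + (cmod z)\<^sup>2 * state_square \<rho> \<eta>"
    using state_square_nonneg[OF \<rho> sum] by simp
qed (rule state_square_nonneg[OF \<rho> \<eta>])

lemma state_inner_le:
  assumes \<rho>: "cstar_state \<rho>" and \<xi>: "\<xi> \<in> ell2" and \<eta>: "\<eta> \<in> ell2"
  shows "cmod (\<rho> (ell2_inner \<xi> \<eta>)) \<le> sqrt (state_square \<rho> \<xi>) * sqrt (state_square \<rho> \<eta>)"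
  using real_le_rsqrt[OF state_inner_Cauchy_Schwarz[OF assms]] by (simp add: real_sqrt_mult)

lemma sqrt_state_square_le:
  "cstar_state \<rho> \<Longrightarrow> sqrt (state_square \<rho> \<xi>) \<le> ell2_norm \<xi>"
  using state_square_le_norm[of \<rho> \<xi>] by (simp add: real_le_lsqrt)

lemma state_inner_le_norm:
  assumes \<rho>: "cstar_state \<rho>" and \<xi>: "\<xi> \<in> ell2" and \<eta>: "\<eta> \<in> ell2"
  shows "cmod (\<rho> (ell2_inner \<xi> \<eta>)) \<le> ell2_norm \<xi> * ell2_norm \<eta>"
  by (rule order_trans[OF state_inner_le[OF assms]])
    (intro mult_mono sqrt_state_square_le \<rho> real_sqrt_ge_zero state_square_nonneg \<eta> ell2_norm_nonneg)

lemma ell2_norm_eq_zero: "\<xi> \<in> ell2 \<Longrightarrow> ell2_norm \<xi> = 0 \<Longrightarrow> \<xi> t = 0"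
proof -
  assume \<xi>: "\<xi> \<in> ell2" and 0: "ell2_norm \<xi> = 0"
  have "norm (star (\<xi> t) * \<xi> t) \<le> 0"
  proof (rule positive_norm_le)
    fix \<rho> :: "'b \<Rightarrow> complex" assume "cstar_state \<rho>"
    then show "Re (\<rho> (star (\<xi> t) * \<xi> t)) \<le> 0"
      using state_square_sum_le[of \<rho> \<xi> "{t}"] state_square_le_norm[of \<rho> \<xi>] \<xi> 0 by simp
  qed simp
  then show ?thesis by (simp add: star_mult_self_eq_0)
qed

lemma norm_le_ell2_norm:
  fixes \<xi> :: "'g \<Rightarrow> 'b::cstar_algebra"
  assumes \<xi>: "\<xi> \<in> ell2" shows "norm (\<xi> t) \<le> ell2_norm \<xi>"
proof -
  have "norm (star (\<xi> t) * \<xi> t) \<le> (ell2_norm \<xi>)\<^sup>2"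
  proof (rule positive_norm_le)
    fix \<rho> :: "'b \<Rightarrow> complex" assume "cstar_state \<rho>"
    then show "Re (\<rho> (star (\<xi> t) * \<xi> t)) \<le> (ell2_norm \<xi>)\<^sup>2"
      using state_square_sum_le[of \<rho> \<xi> "{t}"] state_square_le_norm[of \<rho> \<xi>] \<xi> by simp
  qed simp
  then have "(norm (\<xi> t))\<^sup>2 \<le> (ell2_norm \<xi>)\<^sup>2" by (simp add: cstar_identity)
  then show ?thesis by (rule power2_le_imp_le) simp
qed

lemma state_square_add:
  assumes \<rho>: "cstar_state \<rho>" and \<xi>: "\<xi> \<in> ell2" and \<eta>: "\<eta> \<in> ell2"
  shows "state_square \<rho> (\<lambda>t. \<xi> t + \<eta> t)
    = state_square \<rho> \<xi> + 2 * Re (\<rho> (ell2_inner \<xi> \<eta>)) + state_square \<rho> \<eta>"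
  using state_star[OF \<rho>, of "ell2_inner \<xi> \<eta>"]
  by (simp add: state_square_def ell2_inner_add_left ell2_inner_add_right ell2_add \<xi> \<eta>
      ell2_inner_star state_add[OF \<rho>])

lemma ell2_norm_triangle:
  assumes \<xi>: "\<xi> \<in> ell2" and \<eta>: "\<eta> \<in> ell2"
  shows "ell2_norm (\<lambda>t. \<xi> t + \<eta> t) \<le> ell2_norm \<xi> + ell2_norm \<eta>"
proof (rule ell2_norm_le_states)
  fix \<rho> :: "'b \<Rightarrow> complex" assume \<rho>: "cstar_state \<rho>"
  have "Re (\<rho> (ell2_inner \<xi> \<eta>)) \<le> ell2_norm \<xi> * ell2_norm \<eta>"
    using state_inner_le_norm[OF \<rho> \<xi> \<eta>] complex_Re_le_cmod order_trans by blast
  then show "state_square \<rho> (\<lambda>t. \<xi> t + \<eta> t) \<le> (ell2_norm \<xi> + ell2_norm \<eta>)\<^sup>2"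
    using state_square_le_norm[OF \<rho>, of \<xi>] state_square_le_norm[OF \<rho>, of \<eta>]
    by (simp add: state_square_add[OF \<rho> \<xi> \<eta>] power2_sum)
qed (auto intro: ell2_add \<xi> \<eta>)

lemma ell2_norm_scaleC:
  assumes "\<xi> \<in> ell2" shows "ell2_norm (\<lambda>t. scaleC z (\<xi> t)) = cmod z * ell2_norm \<xi>"
proof -
  have "ell2_inner (\<lambda>t. scaleC z (\<xi> t)) (\<lambda>t. scaleC z (\<xi> t)) = scaleC (cnj z * z) (ell2_inner \<xi> \<xi>)"
    by (simp add: ell2_inner_scaleC_left ell2_inner_scaleC_right assms ell2_scaleC scaleC_scaleC mult.commute)
  then show ?thesis by (simp add: ell2_norm_def norm_scaleC norm_mult real_sqrt_mult)
qed

lemma ell2_norm_zero [simp]: "ell2_norm (\<lambda>t. 0) = 0"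
  by (simp add: ell2_norm_def)

lemma ell2_norm_sum_le:
  "(\<And>i. i \<in> F \<Longrightarrow> \<xi> i \<in> ell2) \<Longrightarrow> ell2_norm (\<lambda>t. \<Sum>i\<in>F. \<xi> i t) \<le> (\<Sum>i\<in>F. ell2_norm (\<xi> i))"
proof (induction F rule: infinite_finite_induct)
  case (insert x F)
  then show ?case using ell2_norm_triangle[of "\<xi> x" "\<lambda>t. \<Sum>i\<in>F. \<xi> i t"] by (fastforce simp: ell2_sum)
qed auto

lemma state_mult_left_le:
  assumes \<rho>: "cstar_state \<rho>" and "norm b \<le> K"
  shows "Re (\<rho> (star (b * w) * (b * w))) \<le> K\<^sup>2 * Re (\<rho> (star w * w))"
proof -
  obtain z where z: "(norm b)\<^sup>2 *\<^sub>R (star w * w) - star (b * w) * (b * w) = star z * z"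
    by (rule star_mult_le_norm_square)
  have "0 \<le> Re (\<rho> ((norm b)\<^sup>2 *\<^sub>R (star w * w) - star (b * w) * (b * w)))"
    unfolding z by (rule state_nonneg[OF \<rho>])
  then have "Re (\<rho> (star (b * w) * (b * w))) \<le> (norm b)\<^sup>2 * Re (\<rho> (star w * w))"
    by (simp add: state_diff[OF \<rho>] state_scaleR[OF \<rho>])
  also have "\<dots> \<le> K\<^sup>2 * Re (\<rho> (star w * w))"
    by (intro mult_right_mono power_mono assms state_nonneg) auto
  finally show ?thesis .
qed

lemma
  assumes \<xi>: "\<xi> \<in> ell2" and b: "\<And>t. norm (b t) \<le> K"
  shows ell2_mult_left: "(\<lambda>t. b t * \<xi> t) \<in> ell2"
    and ell2_norm_mult_left: "ell2_norm (\<lambda>t. b t * \<xi> t) \<le> K * ell2_norm \<xi>"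
proof -
  have K: "K \<ge> 0" using order_trans[OF norm_ge_zero b] .
  have "(\<lambda>t. star (b t * \<xi> t) * (b t * \<xi> t)) summable_on UNIV"
    using summable_on_scaleR_right[OF ell2_summable[OF \<xi>], of "K\<^sup>2"]
    by (rule summable_on_state_comparison) (simp_all add: state_scaleR state_mult_left_le b)
  then show in_ell2: "(\<lambda>t. b t * \<xi> t) \<in> ell2" by (simp add: ell2_def)
  show "ell2_norm (\<lambda>t. b t * \<xi> t) \<le> K * ell2_norm \<xi>"
  proof (rule ell2_norm_le_states[OF in_ell2])
    fix \<rho> :: "'b \<Rightarrow> complex" assume \<rho>: "cstar_state \<rho>"
    have "state_square \<rho> (\<lambda>t. b t * \<xi> t) \<le> K\<^sup>2 * state_square \<rho> \<xi>"
      by (rule has_sum_mono[OF state_square_has_sum[OF \<rho> in_ell2] has_sum_cmult_right[OF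
          state_square_has_sum[OF \<rho> \<xi>]]])
        (auto intro: state_mult_left_le[OF \<rho> b])
    also have "\<dots> \<le> K\<^sup>2 * (ell2_norm \<xi>)\<^sup>2" by (intro mult_left_mono state_square_le_norm \<rho>) simp
    finally show "state_square \<rho> (\<lambda>t. b t * \<xi> t) \<le> (K * ell2_norm \<xi>)\<^sup>2"
      by (simp add: power_mult_distrib)
  qed (use K in simp)
qed

lemma ell2_inner_mult_left:
  "ell2_inner (\<lambda>t. b t * \<xi> t) \<eta> = ell2_inner \<xi> (\<lambda>t. star (b t) * \<eta> t)"
  by (simp add: ell2_inner_def star_mult mult.assoc)

lemma
  assumes "bij f"
  shows ell2_reindex: "\<xi> \<in> ell2 \<Longrightarrow> (\<lambda>t. \<xi> (f t)) \<in> ell2"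
    and ell2_inner_reindex: "ell2_inner (\<lambda>t. \<xi> (f t)) (\<lambda>t. \<eta> (f t)) = ell2_inner \<xi> \<eta>"
proof -
  show "\<xi> \<in> ell2 \<Longrightarrow> (\<lambda>t. \<xi> (f t)) \<in> ell2" unfolding ell2_def
    using summable_on_reindex_bij_betw[OF assms, of "\<lambda>t. star (\<xi> t) * \<xi> t"] by simp
  show "ell2_inner (\<lambda>t. \<xi> (f t)) (\<lambda>t. \<eta> (f t)) = ell2_inner \<xi> \<eta>" unfolding ell2_inner_def
    by (rule infsum_reindex_bij_betw[OF assms])
qed

definition ell2_single :: "'g \<Rightarrow> 'b::cstar_algebra \<Rightarrow> 'g \<Rightarrow> 'b" where
  "ell2_single t b = (\<lambda>u. if u = t then b else 0)"

lemma ell2_single [simp]: "ell2_single t b \<in> ell2"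
  by (rule ell2_finite_support) (simp add: ell2_single_def)

lemma ell2_inner_single: "ell2_inner (ell2_single t b) \<xi> = star b * \<xi> t"
proof -
  have "((\<lambda>u. star (ell2_single t b u) * \<xi> u) has_sum (star b * \<xi> t)) UNIV"
    by (rule has_sum_finite_neutralI[of "{t}"]) (auto simp: ell2_single_def)
  then show ?thesis unfolding ell2_inner_def by (rule infsumI)
qed

lemma ell2_norm_single [simp]: "ell2_norm (ell2_single t b) = norm b"
  by (simp add: ell2_norm_def ell2_inner_single) (simp add: ell2_single_def cstar_identity)

section \<open>Adjointable operators\<close>

lemma adjointable_ell2: "T \<in> adjointable \<Longrightarrow> \<xi> \<in> ell2 \<Longrightarrow> T \<xi> \<in> ell2"
  by (auto simp: adjointable_def)

lemma adjointable_adjoint: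
  assumes "T \<in> adjointable"
  obtains S where "S \<in> ell2 \<rightarrow>\<^sub>E ell2" "is_adjoint T S"
  using assms by (auto simp: adjointable_def)

lemma is_adjointD:
  "is_adjoint T S \<Longrightarrow> \<xi> \<in> ell2 \<Longrightarrow> \<eta> \<in> ell2 \<Longrightarrow> ell2_inner (T \<xi>) \<eta> = ell2_inner \<xi> (S \<eta>)"
  by (auto simp: is_adjoint_def)

lemma ell2_eqI:
  assumes "\<xi> \<in> ell2" "\<eta> \<in> ell2" "\<And>\<zeta>. \<zeta> \<in> ell2 \<Longrightarrow> ell2_inner \<xi> \<zeta> = ell2_inner \<eta> \<zeta>"
  shows "\<xi> = \<eta>"
proof
  fix t
  have d: "(\<lambda>t. \<xi> t - \<eta> t) \<in> ell2" by (intro ell2_diff assms)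
  then have "ell2_inner (\<lambda>t. \<xi> t - \<eta> t) (\<lambda>t. \<xi> t - \<eta> t) = 0"
    by (simp add: ell2_inner_diff_left[OF d assms(1,2)] assms(3))
  then have "ell2_norm (\<lambda>t. \<xi> t - \<eta> t) = 0" by (simp add: ell2_norm_def)
  from ell2_norm_eq_zero[OF d this, of t] show "\<xi> t = \<eta> t" by simp
qed

lemma adjointable_add:
  assumes T: "T \<in> adjointable" and "\<xi> \<in> ell2" "\<eta> \<in> ell2"
  shows "T (\<lambda>t. \<xi> t + \<eta> t) = (\<lambda>t. T \<xi> t + T \<eta> t)"
proof -
  obtain S where S: "S \<in> ell2 \<rightarrow>\<^sub>E ell2" "is_adjoint T S" by (rule adjointable_adjoint[OF T])
  have Sm: "S \<zeta> \<in> ell2" if "\<zeta> \<in> ell2" for \<zeta> using S(1) that by auto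
  show ?thesis
    by (rule ell2_eqI) (auto simp: Sm adjointable_ell2[OF T] ell2_add assms ell2_inner_add_left
        is_adjointD[OF S(2)])
qed

lemma adjointable_scaleC:
  assumes T: "T \<in> adjointable" and "\<xi> \<in> ell2"
  shows "T (\<lambda>t. scaleC z (\<xi> t)) = (\<lambda>t. scaleC z (T \<xi> t))"
proof -
  obtain S where S: "S \<in> ell2 \<rightarrow>\<^sub>E ell2" "is_adjoint T S" by (rule adjointable_adjoint[OF T])
  have Sm: "S \<zeta> \<in> ell2" if "\<zeta> \<in> ell2" for \<zeta> using S(1) that by auto
  show ?thesis
    by (rule ell2_eqI) (auto simp: Sm adjointable_ell2[OF T] ell2_scaleC assms ell2_inner_scaleC_left
        is_adjointD[OF S(2)])
qed

lemma adjointable_zero: "T \<in> adjointable \<Longrightarrow> T (\<lambda>t. 0) = (\<lambda>t. 0)"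
  using adjointable_scaleC[of T "\<lambda>t. 0" 0] by simp

lemma adjointable_diff:
  assumes "T \<in> adjointable" "\<xi> \<in> ell2" "\<eta> \<in> ell2"
  shows "T (\<lambda>t. \<xi> t - \<eta> t) = (\<lambda>t. T \<xi> t - T \<eta> t)"
  using adjointable_add[OF assms(1) ell2_diff[OF assms(2,3)] assms(3)] by (auto simp: fun_eq_iff)

lemma adjointable_bdd:
  assumes "T \<in> adjointable"
  shows "bdd_above {ell2_norm (T \<xi>) | \<xi>. \<xi> \<in> ell2 \<and> ell2_norm \<xi> \<le> 1}"
proof -
  obtain K where K: "\<And>\<xi>. \<xi> \<in> ell2 \<Longrightarrow> ell2_norm (T \<xi>) \<le> K * ell2_norm \<xi>"
    using assms by (auto simp: adjointable_def)
  show ?thesis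
  proof (rule bdd_aboveI)
    fix x assume "x \<in> {ell2_norm (T \<xi>) | \<xi>. \<xi> \<in> ell2 \<and> ell2_norm \<xi> \<le> 1}"
    then obtain \<xi> where \<xi>: "\<xi> \<in> ell2" "ell2_norm \<xi> \<le> 1" "x = ell2_norm (T \<xi>)" by auto
    have "K * ell2_norm \<xi> \<le> \<bar>K\<bar> * 1" using \<xi>(2) by (intro mult_mono) auto
    then show "x \<le> \<bar>K\<bar>" using K[OF \<xi>(1)] \<xi>(3) by simp
  qed
qed

lemma op_norm_nonneg:
  assumes "T \<in> adjointable" shows "0 \<le> op_norm T"
proof -
  have "ell2_norm (T (\<lambda>t. 0)) \<le> op_norm T" unfolding op_norm_def
    by (rule cSup_upper[OF _ adjointable_bdd[OF assms]]) (auto intro!: exI[of _ "\<lambda>t. 0"])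
  then show ?thesis using ell2_norm_nonneg order_trans by blast
qed

lemma op_norm_bound:
  assumes T: "T \<in> adjointable" and \<xi>: "\<xi> \<in> ell2"
  shows "ell2_norm (T \<xi>) \<le> op_norm T * ell2_norm \<xi>"
proof (cases "ell2_norm \<xi> = 0")
  case True
  then have "\<xi> = (\<lambda>t. 0)" using ell2_norm_eq_zero[OF \<xi>] by auto
  then show ?thesis by (simp add: adjointable_zero[OF T])
next
  case False
  then have pos: "ell2_norm \<xi> > 0" using ell2_norm_nonneg[of \<xi>] by linarith
  let ?c = "complex_of_real (1 / ell2_norm \<xi>)"
  have "ell2_norm (T (\<lambda>t. scaleC ?c (\<xi> t))) \<le> op_norm T" unfolding op_norm_def
    by (rule cSup_upper[OF _ adjointable_bdd[OF T]])
      (use pos \<xi> in \<open>auto intro!: exI[of _ "\<lambda>t. scaleC ?c (\<xi> t)"] simp: ell2_scaleC ell2_norm_scaleC norm_divide\<close>)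
  then have "ell2_norm (T \<xi>) / ell2_norm \<xi> \<le> op_norm T"
    using pos by (simp add: adjointable_scaleC[OF T \<xi>] ell2_norm_scaleC adjointable_ell2[OF T \<xi>] norm_divide)
  then show ?thesis using pos by (simp add: field_simps)
qed

lemma op_norm_le:
  assumes "K \<ge> 0" "\<And>\<xi>. \<xi> \<in> ell2 \<Longrightarrow> ell2_norm (T \<xi>) \<le> K * ell2_norm \<xi>"
  shows "op_norm T \<le> K"
  unfolding op_norm_def
proof (rule cSup_least)
  show "{ell2_norm (T \<xi>) | \<xi>. \<xi> \<in> ell2 \<and> ell2_norm \<xi> \<le> 1} \<noteq> {}"
    using ell2_zero ell2_norm_zero by fastforce
  fix x assume "x \<in> {ell2_norm (T \<xi>) | \<xi>. \<xi> \<in> ell2 \<and> ell2_norm \<xi> \<le> 1}"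
  then obtain \<xi> where \<xi>: "\<xi> \<in> ell2" "ell2_norm \<xi> \<le> 1" "x = ell2_norm (T \<xi>)" by auto
  have "K * ell2_norm \<xi> \<le> K * 1" using \<xi>(2) assms(1) by (intro mult_left_mono) auto
  then show "x \<le> K" using assms(2)[OF \<xi>(1)] \<xi>(3) by simp
qed

lemma is_adjoint_sym:
  assumes "is_adjoint T S" "\<And>\<xi>. \<xi> \<in> ell2 \<Longrightarrow> T \<xi> \<in> ell2" "\<And>\<xi>. \<xi> \<in> ell2 \<Longrightarrow> S \<xi> \<in> ell2"
  shows "is_adjoint S T"
  unfolding is_adjoint_def
proof (intro ballI)
  fix \<xi> \<eta> :: "'a \<Rightarrow> 'b" assume \<xi>: "\<xi> \<in> ell2" and \<eta>: "\<eta> \<in> ell2"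
  show "ell2_inner (S \<xi>) \<eta> = ell2_inner \<xi> (T \<eta>)"
    using arg_cong[OF is_adjointD[OF assms(1) \<eta> \<xi>], of star]
    by (simp add: ell2_inner_star assms \<xi> \<eta>)
qed

lemma adjointableI:
  assumes "T \<in> ell2 \<rightarrow>\<^sub>E ell2" "S \<in> ell2 \<rightarrow>\<^sub>E ell2" "is_adjoint T S"
    "\<And>\<xi>. \<xi> \<in> ell2 \<Longrightarrow> ell2_norm (T \<xi>) \<le> K * ell2_norm \<xi>"
  shows "T \<in> adjointable"
  using assms by (auto simp: adjointable_def)

text \<open>The inner product of \<open>S \<zeta>\<close> with itself is that of
  \<open>T (S \<zeta>)\<close> with \<zeta>. This bounds the square of the norm of
  \<open>S \<zeta>\<close> by K times that norm times \<open>ell2_norm \<zeta>\<close>, and one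
  factor cancels.\<close>

lemma adjoint_norm_le:
  assumes T: "T \<in> adjointable" and S: "\<And>\<xi>. \<xi> \<in> ell2 \<Longrightarrow> S \<xi> \<in> ell2" "is_adjoint T S"
    and K: "\<And>\<xi>. \<xi> \<in> ell2 \<Longrightarrow> ell2_norm (T \<xi>) \<le> K * ell2_norm \<xi>" "K \<ge> 0" and \<zeta>: "\<zeta> \<in> ell2"
  shows "ell2_norm (S \<zeta>) \<le> K * ell2_norm \<zeta>"
proof -
  let ?s = "ell2_norm (S \<zeta>)"
  have "?s \<le> sqrt (K * ?s * ell2_norm \<zeta>)"
  proof (rule ell2_norm_le_states)
    fix \<rho> :: "'b \<Rightarrow> complex" assume \<rho>: "cstar_state \<rho>"
    have "state_square \<rho> (S \<zeta>) = Re (\<rho> (ell2_inner (T (S \<zeta>)) \<zeta>))"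
      by (simp add: state_square_def is_adjointD[OF S(2)] S \<zeta>)
    also have "\<dots> \<le> ell2_norm (T (S \<zeta>)) * ell2_norm \<zeta>"
      using state_inner_le_norm[OF \<rho> adjointable_ell2[OF T S(1)[OF \<zeta>]] \<zeta>] complex_Re_le_cmod order_trans by blast
    also have "\<dots> \<le> K * ?s * ell2_norm \<zeta>" by (intro mult_right_mono K S \<zeta>) simp
    finally show "state_square \<rho> (S \<zeta>) \<le> (sqrt (K * ?s * ell2_norm \<zeta>))\<^sup>2" using K(2) by simp
  qed (use S \<zeta> K in auto)
  then have "?s\<^sup>2 \<le> (sqrt (K * ?s * ell2_norm \<zeta>))\<^sup>2" by (intro power_mono) auto
  then have "?s * ?s \<le> (K * ell2_norm \<zeta>) * ?s" using K(2)
    by (simp add: power2_eq_square algebra_simps)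
  then show ?thesis using K(2) ell2_norm_nonneg[of "S \<zeta>"]
    by (cases "?s = 0") (auto simp: mult_le_cancel_right)
qed

lemma adjoint_adjointable:
  assumes T: "T \<in> adjointable" and S: "S \<in> ell2 \<rightarrow>\<^sub>E ell2" "is_adjoint T S"
  shows "S \<in> adjointable" "op_norm S \<le> op_norm T"
proof -
  have b: "ell2_norm (S \<zeta>) \<le> op_norm T * ell2_norm \<zeta>" if "\<zeta> \<in> ell2" for \<zeta>
    by (rule adjoint_norm_le[OF T _ S(2) op_norm_bound[OF T] op_norm_nonneg[OF T] that]) (use S in auto)
  show "S \<in> adjointable"
    by (rule adjointableI[OF S(1) _ is_adjoint_sym[OF S(2)] b]) (use T S in \<open>auto simp: adjointable_def\<close>)
  show "op_norm S \<le> op_norm T" by (rule op_norm_le[OF op_norm_nonneg[OF T] b])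
qed

lemma adjoint_unique:
  assumes "is_adjoint T S" "is_adjoint T S'" "S \<in> ell2 \<rightarrow>\<^sub>E ell2" "S' \<in> ell2 \<rightarrow>\<^sub>E ell2"
    "\<And>\<xi>. \<xi> \<in> ell2 \<Longrightarrow> T \<xi> \<in> ell2"
  shows "S = S'"
proof (rule PiE_ext[OF assms(3,4)])
  fix \<eta> :: "'a \<Rightarrow> 'b" assume \<eta>: "\<eta> \<in> ell2"
  show "S \<eta> = S' \<eta>"
  proof (rule ell2_eqI)
    fix \<zeta> :: "'a \<Rightarrow> 'b" assume \<zeta>: "\<zeta> \<in> ell2"
    have "S \<eta> \<in> ell2" "S' \<eta> \<in> ell2" using assms \<eta> by auto
    moreover have "ell2_inner \<zeta> (S \<eta>) = ell2_inner \<zeta> (S' \<eta>)"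
      using is_adjointD[OF assms(1) \<zeta> \<eta>] is_adjointD[OF assms(2) \<zeta> \<eta>] by simp
    ultimately show "ell2_inner (S \<eta>) \<zeta> = ell2_inner (S' \<eta>) \<zeta>"
      using ell2_inner_star[OF \<zeta>, of "S \<eta>"] ell2_inner_star[OF \<zeta>, of "S' \<eta>"] by simp
  qed (use assms \<eta> in auto)
qed

text \<open>Iterating the Cauchy--Schwarz inequality upgrades a norm bound to a bound for every state.\<close>

lemma iterated_square_bound:
  fixes a :: "nat \<Rightarrow> real"
  assumes nonneg: "\<And>m. 0 \<le> a m" and step: "\<And>m. (a m)\<^sup>2 \<le> N * a (Suc m)" and "N \<ge> 0"
    and bound: "\<And>m. a m \<le> C * K ^ (2 ^ m)" and "K \<ge> 0"
  shows "a 0 \<le> K * N"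
proof (rule ccontr)
  assume neg: "\<not> a 0 \<le> K * N"
  have "N \<noteq> 0" using step[of 0] neg by auto
  then have N: "N > 0" using \<open>N \<ge> 0\<close> by simp
  have a0: "a 0 > 0" using neg \<open>K \<ge> 0\<close> N by (smt (verit) mult_nonneg_nonneg)
  \<comment> \<open>Each step at least squares the quotient of a m by N.\<close>
  have lower: "N * (a 0 / N) ^ (2 ^ m) \<le> a m" for m
  proof (induction m)
    case (Suc m)
    have "N * (N * (a 0 / N) ^ (2 ^ Suc m)) = (N * (a 0 / N) ^ (2 ^ m))\<^sup>2"
      by (simp add: power2_eq_square power_mult power_add[symmetric] mult_2 algebra_simps)
    also have "\<dots> \<le> (a m)\<^sup>2" using Suc N a0 by (intro power_mono) auto
    also have "\<dots> \<le> N * a (Suc m)" by (rule step)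
    finally show ?case using N by simp
  qed (use N in simp)
  have "K > 0"
  proof (rule ccontr)
    assume "\<not> K > 0"
    then have "a 0 \<le> 0" using bound[of 0] \<open>K \<ge> 0\<close> by simp
    then show False using a0 by simp
  qed
  define r where "r = a 0 / (K * N)"
  have r: "r > 1" using neg \<open>K > 0\<close> N by (simp add: r_def field_simps)
  have "N * r ^ (2 ^ m) \<le> C" for m
  proof -
    have "N * (a 0 / N) ^ (2 ^ m) \<le> C * K ^ (2 ^ m)" using lower bound order_trans by blast
    moreover have "a 0 / N = r * K" using \<open>K > 0\<close> N by (simp add: r_def)
    ultimately show ?thesis using \<open>K > 0\<close> by (simp add: power_mult_distrib)
  qed
  moreover have "\<exists>m. C / N < r ^ m" using real_arch_pow[OF r] by blast
  then obtain m where "C / N < r ^ m" by blast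
  moreover have "r ^ m \<le> r ^ (2 ^ m)" using r by (intro power_increasing) (auto intro: less_imp_le)
  ultimately have "C < N * r ^ (2 ^ m)" using N
    by (simp add: field_simps) (smt (verit) mult_left_mono)
  then show False using \<open>\<And>m. N * r ^ (2 ^ m) \<le> C\<close>[of m] by simp
qed

text \<open>Let S be the adjoint of T and U = S T. The values under \<rho> of the inner products of
  \<xi> with U^(2^m) \<xi> satisfy the hypotheses of \<open>iterated_square_bound\<close> by
  Cauchy-Schwarz. The result means that T acts on the Hilbert space of every state with norm at most
  \<open>op_norm T\<close>.\<close>

theorem state_square_adjointable_le:
  assumes T: "T \<in> adjointable" and \<rho>: "cstar_state \<rho>" and \<xi>: "\<xi> \<in> ell2"
  shows "state_square \<rho> (T \<xi>) \<le> (op_norm T)\<^sup>2 * state_square \<rho> \<xi>"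
proof -
  obtain S where S: "S \<in> ell2 \<rightarrow>\<^sub>E ell2" "is_adjoint T S" by (rule adjointable_adjoint[OF T])
  note S' = adjoint_adjointable[OF T S]
  have adj: "is_adjoint S T"
    by (rule is_adjoint_sym[OF S(2)]) (use T S in \<open>auto simp: adjointable_def\<close>)
  let ?U = "\<lambda>\<zeta>. S (T \<zeta>)"
  let ?K = "(op_norm T)\<^sup>2"
  have U: "(?U ^^ n) \<xi> \<in> ell2" for n
    by (induction n) (auto simp: \<xi> adjointable_ell2[OF T] adjointable_ell2[OF S'(1)])
  have Unorm: "ell2_norm ((?U ^^ n) \<xi>) \<le> ?K ^ n * ell2_norm \<xi>" for n
  proof (induction n)
    case (Suc n)
    let ?z = "(?U ^^ n) \<xi>"
    have "ell2_norm (S (T ?z)) \<le> op_norm S * ell2_norm (T ?z)"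
      by (rule op_norm_bound[OF S'(1) adjointable_ell2[OF T U]])
    also have "\<dots> \<le> op_norm T * (op_norm T * ell2_norm ?z)"
      by (intro mult_mono S' op_norm_bound T U op_norm_nonneg ell2_norm_nonneg)
    also have "\<dots> \<le> op_norm T * (op_norm T * (?K ^ n * ell2_norm \<xi>))"
      by (intro mult_left_mono Suc op_norm_nonneg T)
    finally show ?case by (simp add: power2_eq_square mult.assoc)
  qed simp
  have shift: "ell2_inner ((?U ^^ m) \<xi>) ((?U ^^ n) \<xi>) = ell2_inner \<xi> ((?U ^^ (m + n)) \<xi>)" for m n
  proof (induction m arbitrary: n)
    case (Suc m)
    have "ell2_inner ((?U ^^ Suc m) \<xi>) ((?U ^^ n) \<xi>)
        = ell2_inner (T ((?U ^^ m) \<xi>)) (T ((?U ^^ n) \<xi>))"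
      using is_adjointD[OF adj adjointable_ell2[OF T U] U] by simp
    also have "\<dots> = ell2_inner ((?U ^^ m) \<xi>) ((?U ^^ Suc n) \<xi>)"
      using is_adjointD[OF S(2) U adjointable_ell2[OF T U]] by simp
    also have "\<dots> = ell2_inner \<xi> ((?U ^^ (m + Suc n)) \<xi>)" by (rule Suc)
    finally show ?case by simp
  qed simp
  \<comment> \<open>Every term is the value at U^(2^m), written as a square so that it is visibly
    nonnegative: for m > 0 with half the exponent, for m = 0 with T in place of a root of U.\<close>
  define a where "a m = (if m = 0 then state_square \<rho> (T \<xi>) else state_square \<rho> ((?U ^^ (2 ^ (m - 1))) \<xi>))" for m
  have a: "complex_of_real (a m) = \<rho> (ell2_inner \<xi> ((?U ^^ (2 ^ m)) \<xi>))" for m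
  proof (cases m)
    case 0
    then show ?thesis using is_adjointD[OF S(2) \<xi> adjointable_ell2[OF T \<xi>]]
      by (simp add: a_def state_inner_real[OF \<rho> adjointable_ell2[OF T \<xi>], symmetric])
  next
    case (Suc k)
    then show ?thesis using shift[of "2 ^ k" "2 ^ k"]
      by (simp add: a_def state_inner_real[OF \<rho> U, symmetric] mult_2)
  qed
  have "a 0 \<le> ?K * state_square \<rho> \<xi>"
  proof (rule iterated_square_bound)
    show "0 \<le> a m" for m
      by (simp add: a_def state_square_nonneg[OF \<rho>] U adjointable_ell2[OF T \<xi>])
    show "(a m)\<^sup>2 \<le> state_square \<rho> \<xi> * a (Suc m)" for m
    proof -
      have "(a m)\<^sup>2 = (cmod (\<rho> (ell2_inner \<xi> ((?U ^^ (2 ^ m)) \<xi>))))\<^sup>2"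
        by (simp add: a[symmetric])
      also have "\<dots> \<le> state_square \<rho> \<xi> * state_square \<rho> ((?U ^^ (2 ^ m)) \<xi>)"
        by (rule state_inner_Cauchy_Schwarz[OF \<rho> \<xi> U])
      finally show ?thesis by (simp add: a_def)
    qed
    show "a m \<le> (ell2_norm \<xi>)\<^sup>2 * ?K ^ (2 ^ m)" for m
    proof -
      have "a m \<le> cmod (complex_of_real (a m))" by simp
      also have "\<dots> \<le> ell2_norm \<xi> * ell2_norm ((?U ^^ (2 ^ m)) \<xi>)"
        unfolding a by (rule state_inner_le_norm[OF \<rho> \<xi> U])
      also have "\<dots> \<le> ell2_norm \<xi> * (?K ^ (2 ^ m) * ell2_norm \<xi>)"
        by (intro mult_left_mono Unorm) simp
      finally show ?thesis by (simp add: power2_eq_square algebra_simps)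
    qed
  qed (use state_square_nonneg[OF \<rho> \<xi>] in auto)
  then show ?thesis by (simp add: a_def)
qed

section \<open>Algebraic operations and the norm on adjointable operators\<close>

lemma op_apply [simp]:
  assumes "\<xi> \<in> ell2"
  shows "op_zero \<xi> = (\<lambda>t. 0)" "op_add S T \<xi> = (\<lambda>t. S \<xi> t + T \<xi> t)"
    "op_diff S T \<xi> = (\<lambda>t. S \<xi> t - T \<xi> t)" "op_scale z T \<xi> = (\<lambda>t. scaleC z (T \<xi> t))"
  using assms by (simp_all add: op_zero_def op_add_def op_diff_def op_scale_def)

lemma op_add_PiE:
  "(\<And>\<xi>. \<xi> \<in> ell2 \<Longrightarrow> S \<xi> \<in> ell2) \<Longrightarrow> (\<And>\<xi>. \<xi> \<in> ell2 \<Longrightarrow> T \<xi> \<in> ell2) \<Longrightarrow> op_add S T \<in> ell2 \<rightarrow>\<^sub>E ell2"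
  by (rule PiE_I) (simp_all add: ell2_add op_add_def)

lemma op_scale_PiE: "(\<And>\<xi>. \<xi> \<in> ell2 \<Longrightarrow> T \<xi> \<in> ell2) \<Longrightarrow> op_scale z T \<in> ell2 \<rightarrow>\<^sub>E ell2"
  by (rule PiE_I) (simp_all add: ell2_scaleC op_scale_def)

lemma compose_PiE:
  "(\<And>\<xi>. \<xi> \<in> ell2 \<Longrightarrow> S \<xi> \<in> ell2) \<Longrightarrow> (\<And>\<xi>. \<xi> \<in> ell2 \<Longrightarrow> T \<xi> \<in> ell2) \<Longrightarrow> compose ell2 S T \<in> ell2 \<rightarrow>\<^sub>E ell2"
  by (rule PiE_I) (simp_all add: compose_def)

lemma op_zero_adjointable: "op_zero \<in> adjointable"
  by (rule adjointableI[of _ op_zero 0]) (auto simp: is_adjoint_def op_zero_def)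

lemma is_adjoint_op_add:
  assumes "is_adjoint S S'" "is_adjoint T T'"
    "\<And>\<xi>. \<xi> \<in> ell2 \<Longrightarrow> S \<xi> \<in> ell2" "\<And>\<xi>. \<xi> \<in> ell2 \<Longrightarrow> T \<xi> \<in> ell2"
    "\<And>\<xi>. \<xi> \<in> ell2 \<Longrightarrow> S' \<xi> \<in> ell2" "\<And>\<xi>. \<xi> \<in> ell2 \<Longrightarrow> T' \<xi> \<in> ell2"
  shows "is_adjoint (op_add S T) (op_add S' T')"
  unfolding is_adjoint_def
  using assms by (simp add: ell2_inner_add_left ell2_inner_add_right is_adjointD)

lemma op_add_adjointable:
  assumes S: "S \<in> adjointable" and T: "T \<in> adjointable"
  shows "op_add S T \<in> adjointable"
proof -
  obtain S' where S': "S' \<in> ell2 \<rightarrow>\<^sub>E ell2" "is_adjoint S S'" by (rule adjointable_adjoint[OF S])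
  obtain T' where T': "T' \<in> ell2 \<rightarrow>\<^sub>E ell2" "is_adjoint T T'" by (rule adjointable_adjoint[OF T])
  show ?thesis
  proof (rule adjointableI)
    show "is_adjoint (op_add S T) (op_add S' T')"
      using S' T' S T by (intro is_adjoint_op_add) (auto simp: adjointable_ell2)
    show "op_add S T \<in> ell2 \<rightarrow>\<^sub>E ell2" "op_add S' T' \<in> ell2 \<rightarrow>\<^sub>E ell2"
      by (intro op_add_PiE adjointable_ell2[OF S] adjointable_ell2[OF T] PiE_mem[OF S'(1)]
          PiE_mem[OF T'(1)]; assumption)+
    show "ell2_norm (op_add S T \<xi>) \<le> (op_norm S + op_norm T) * ell2_norm \<xi>" if "\<xi> \<in> ell2" for \<xi>
      using ell2_norm_triangle[of "S \<xi>" "T \<xi>"] op_norm_bound[OF S that] op_norm_bound[OF T that] that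
      by (simp add: adjointable_ell2 S T algebra_simps)
  qed
qed

lemma is_adjoint_op_scale:
  assumes "is_adjoint T T'" "\<And>\<xi>. \<xi> \<in> ell2 \<Longrightarrow> T \<xi> \<in> ell2" "\<And>\<xi>. \<xi> \<in> ell2 \<Longrightarrow> T' \<xi> \<in> ell2"
  shows "is_adjoint (op_scale z T) (op_scale (cnj z) T')"
  unfolding is_adjoint_def
  using assms by (simp add: ell2_inner_scaleC_left ell2_inner_scaleC_right is_adjointD)

lemma op_scale_adjointable:
  assumes T: "T \<in> adjointable"
  shows "op_scale z T \<in> adjointable"
proof -
  obtain T' where T': "T' \<in> ell2 \<rightarrow>\<^sub>E ell2" "is_adjoint T T'" by (rule adjointable_adjoint[OF T])
  show ?thesis
  proof (rule adjointableI)
    show "is_adjoint (op_scale z T) (op_scale (cnj z) T')"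
      using T' T by (intro is_adjoint_op_scale) (auto simp: adjointable_ell2)
    show "op_scale z T \<in> ell2 \<rightarrow>\<^sub>E ell2" "op_scale (cnj z) T' \<in> ell2 \<rightarrow>\<^sub>E ell2"
      by (intro op_scale_PiE adjointable_ell2[OF T] PiE_mem[OF T'(1)]; assumption)+
    show "ell2_norm (op_scale z T \<xi>) \<le> (cmod z * op_norm T) * ell2_norm \<xi>" if "\<xi> \<in> ell2" for \<xi>
      using mult_left_mono[OF op_norm_bound[OF T that], of "cmod z"] that
      by (simp add: ell2_norm_scaleC adjointable_ell2 T mult.assoc)
  qed
qed

lemma op_diff_eq: "S \<in> adjointable \<Longrightarrow> T \<in> adjointable \<Longrightarrow> op_diff S T = op_add S (op_scale (-1) T)"
  unfolding op_diff_def op_add_def by (rule restrict_ext) simp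

lemma op_diff_adjointable:
  "S \<in> adjointable \<Longrightarrow> T \<in> adjointable \<Longrightarrow> op_diff S T \<in> adjointable"
  by (simp add: op_diff_eq op_add_adjointable op_scale_adjointable)

lemma is_adjoint_compose:
  assumes "is_adjoint S S'" "is_adjoint T T'"
    "\<And>\<xi>. \<xi> \<in> ell2 \<Longrightarrow> T \<xi> \<in> ell2" "\<And>\<xi>. \<xi> \<in> ell2 \<Longrightarrow> S' \<xi> \<in> ell2"
  shows "is_adjoint (compose ell2 S T) (compose ell2 T' S')"
  unfolding is_adjoint_def using assms by (simp add: compose_eq is_adjointD)

lemma compose_adjointable:
  assumes S: "S \<in> adjointable" and T: "T \<in> adjointable"
  shows "compose ell2 S T \<in> adjointable" "op_norm (compose ell2 S T) \<le> op_norm S * op_norm T"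
proof -
  obtain S' where S': "S' \<in> ell2 \<rightarrow>\<^sub>E ell2" "is_adjoint S S'" by (rule adjointable_adjoint[OF S])
  obtain T' where T': "T' \<in> ell2 \<rightarrow>\<^sub>E ell2" "is_adjoint T T'" by (rule adjointable_adjoint[OF T])
  have b: "ell2_norm (compose ell2 S T \<xi>) \<le> (op_norm S * op_norm T) * ell2_norm \<xi>" if
      "\<xi> \<in> ell2" for \<xi>
    using op_norm_bound[OF S adjointable_ell2[OF T that]]
      mult_left_mono[OF op_norm_bound[OF T that] op_norm_nonneg[OF S]] that
    by (simp add: compose_eq mult.assoc)
  show "compose ell2 S T \<in> adjointable"
  proof (rule adjointableI[OF _ _ _ b])
    show "is_adjoint (compose ell2 S T) (compose ell2 T' S')"
      using S' T' S T by (intro is_adjoint_compose) (auto simp: adjointable_ell2)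
    show "compose ell2 S T \<in> ell2 \<rightarrow>\<^sub>E ell2" "compose ell2 T' S' \<in> ell2 \<rightarrow>\<^sub>E ell2"
      by (intro compose_PiE adjointable_ell2[OF S] adjointable_ell2[OF T] PiE_mem[OF S'(1)]
          PiE_mem[OF T'(1)]; assumption)+
  qed auto
  show "op_norm (compose ell2 S T) \<le> op_norm S * op_norm T"
    by (rule op_norm_le[OF _ b]) (simp add: op_norm_nonneg S T)
qed

lemma op_norm_triangle:
  assumes S: "S \<in> adjointable" and T: "T \<in> adjointable"
  shows "op_norm (op_add S T) \<le> op_norm S + op_norm T"
proof (rule op_norm_le)
  show "ell2_norm (op_add S T \<xi>) \<le> (op_norm S + op_norm T) * ell2_norm \<xi>" if "\<xi> \<in> ell2" for \<xi>
    using ell2_norm_triangle[of "S \<xi>" "T \<xi>"] op_norm_bound[OF S that] op_norm_bound[OF T that] that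
    by (simp add: adjointable_ell2 S T algebra_simps)
qed (simp add: op_norm_nonneg S T)

lemma op_norm_scale:
  assumes T: "T \<in> adjointable"
  shows "op_norm (op_scale z T) \<le> cmod z * op_norm T"
proof (rule op_norm_le)
  show "ell2_norm (op_scale z T \<xi>) \<le> cmod z * op_norm T * ell2_norm \<xi>" if "\<xi> \<in> ell2" for \<xi>
    using mult_left_mono[OF op_norm_bound[OF T that], of "cmod z"] that
    by (simp add: ell2_norm_scaleC adjointable_ell2 T mult.assoc)
qed (simp add: op_norm_nonneg T)

lemma op_norm_diff_triangle:
  assumes "S \<in> adjointable" "T \<in> adjointable" "U \<in> adjointable"
  shows "op_norm (op_diff S U) \<le> op_norm (op_diff S T) + op_norm (op_diff T U)"
proof -
  have "op_diff S U = op_add (op_diff S T) (op_diff T U)"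
    unfolding op_diff_def op_add_def by (rule restrict_ext) simp
  then show ?thesis using op_norm_triangle[OF op_diff_adjointable op_diff_adjointable] assms
    by metis
qed

lemma op_norm_diff_commute:
  assumes "S \<in> adjointable" "T \<in> adjointable"
  shows "op_norm (op_diff S T) = op_norm (op_diff T S)"
proof -
  have "op_norm (op_diff S T) \<le> op_norm (op_diff T S)" if "S \<in> adjointable" "T \<in> adjointable"
    for S T :: "('a, 'b) op"
  proof -
    have "op_diff S T = op_scale (-1) (op_diff T S)"
      unfolding op_diff_def op_scale_def by (rule restrict_ext) simp
    then show ?thesis using op_norm_scale[OF op_diff_adjointable[OF that(2,1)], of "-1"] by simp
  qed
  then show ?thesis using assms by (metis order_antisym)
qed

lemma op_norm_diff_self: "op_norm (op_diff T T) = 0"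
proof -
  have "op_diff T T = op_zero" unfolding op_diff_def op_zero_def by (rule restrict_ext) simp
  moreover have "op_norm op_zero \<le> 0" by (rule op_norm_le) auto
  ultimately show ?thesis using op_norm_nonneg[OF op_zero_adjointable] by (metis order_antisym)
qed

lemma op_norm_le_diff:
  assumes "S \<in> adjointable" "T \<in> adjointable"
  shows "op_norm S \<le> op_norm T + op_norm (op_diff S T)"
proof -
  have "S \<in> extensional ell2" using assms by (auto simp: adjointable_def PiE_def)
  then have "S = op_add T (op_diff S T)"
    unfolding op_diff_def op_add_def by (intro extensionalityI[of S ell2]) auto
  then show ?thesis using op_norm_triangle[OF assms(2) op_diff_adjointable[OF assms]] by metis
qed

section \<open>Norm closures of operator algebras\<close>

definition op_closure :: "('g, 'b::cstar_algebra) op set \<Rightarrow> ('g, 'b) op set" where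
  "op_closure X = {T \<in> adjointable. \<forall>\<epsilon>>0. \<exists>S\<in>X. op_norm (op_diff T S) < \<epsilon>}"

lemma op_closureD:
  "T \<in> op_closure X \<Longrightarrow> T \<in> adjointable"
  "T \<in> op_closure X \<Longrightarrow> \<epsilon> > 0 \<Longrightarrow> \<exists>S\<in>X. op_norm (op_diff T S) < \<epsilon>"
  by (auto simp: op_closure_def)

lemma op_closure_subset: "X \<subseteq> adjointable \<Longrightarrow> X \<subseteq> op_closure X"
  by (auto simp: op_closure_def op_norm_diff_self intro!: bexI)

lemma op_closure_closed:
  assumes X: "X \<subseteq> adjointable" and T: "T \<in> adjointable"
    and approx: "\<And>\<epsilon>. \<epsilon> > 0 \<Longrightarrow> \<exists>S\<in>op_closure X. op_norm (op_diff T S) < \<epsilon>"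
  shows "T \<in> op_closure X"
  unfolding op_closure_def
proof (intro CollectI conjI T allI impI)
  fix \<epsilon> :: real assume "\<epsilon> > 0"
  then obtain S where S: "S \<in> op_closure X" "op_norm (op_diff T S) < \<epsilon> / 2"
    using approx[of "\<epsilon> / 2"] by auto
  then obtain U where U: "U \<in> X" "op_norm (op_diff S U) < \<epsilon> / 2"
    using op_closureD(2)[of S X "\<epsilon> / 2"] \<open>\<epsilon> > 0\<close> by auto
  have "op_norm (op_diff T U) \<le> op_norm (op_diff T S) + op_norm (op_diff S U)"
    using X U S by (intro op_norm_diff_triangle T) (auto dest: op_closureD)
  then show "\<exists>S\<in>X. op_norm (op_diff T S) < \<epsilon>" using U S by (intro bexI[of _ U]) auto
qed

lemma op_norm_diff_add:
  assumes "S \<in> adjointable" "T \<in> adjointable" "S' \<in> adjointable" "T' \<in> adjointable"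
  shows "op_norm (op_diff (op_add S T) (op_add S' T'))
      \<le> op_norm (op_diff S S') + op_norm (op_diff T T')"
proof -
  have "op_diff (op_add S T) (op_add S' T') = op_add (op_diff S S') (op_diff T T')"
    unfolding op_diff_def op_add_def by (rule restrict_ext) (simp add: algebra_simps)
  then show ?thesis using op_norm_triangle[OF op_diff_adjointable op_diff_adjointable] assms
    by metis
qed

lemma op_norm_diff_scale:
  assumes "T \<in> adjointable" "T' \<in> adjointable"
  shows "op_norm (op_diff (op_scale z T) (op_scale z T')) \<le> cmod z * op_norm (op_diff T T')"
proof -
  have "op_diff (op_scale z T) (op_scale z T') = op_scale z (op_diff T T')"
    unfolding op_diff_def op_scale_def by (rule restrict_ext) (simp add: scaleC_diff_right)
  then show ?thesis using op_norm_scale[OF op_diff_adjointable] assms by metis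
qed

lemma op_norm_diff_compose:
  assumes S: "S \<in> adjointable" and T: "T \<in> adjointable" and S': "S' \<in> adjointable" and T':
      "T' \<in> adjointable"
  shows "op_norm (op_diff (compose ell2 S T) (compose ell2 S' T'))
    \<le> op_norm S * op_norm (op_diff T T') + op_norm (op_diff S S') * op_norm T'"
proof -
  have eq: "op_diff (compose ell2 S T) (compose ell2 S' T')
      = op_add (compose ell2 S (op_diff T T')) (compose ell2 (op_diff S S') T')"
    unfolding op_diff_def op_add_def
    by (rule restrict_ext) (simp add: compose_eq adjointable_diff[OF S] adjointable_ell2 T T')
  have "op_norm (op_diff (compose ell2 S T) (compose ell2 S' T'))
      \<le> op_norm (compose ell2 S (op_diff T T')) + op_norm (compose ell2 (op_diff S S') T')"
    unfolding eq by (intro op_norm_triangle compose_adjointable(1) op_diff_adjointable assms)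
  also have "\<dots> \<le> op_norm S * op_norm (op_diff T T') + op_norm (op_diff S S') * op_norm T'"
    using compose_adjointable(2)[OF S op_diff_adjointable[OF T T']]
      compose_adjointable(2)[OF op_diff_adjointable[OF S S'] T'] by (rule add_mono)
  finally show ?thesis .
qed

lemma op_norm_diff_adjoint:
  assumes S: "S \<in> adjointable" and T: "T \<in> adjointable" and S': "S' \<in> adjointable" and T':
      "T' \<in> adjointable"
    and adj: "is_adjoint S S'" "is_adjoint T T'"
  shows "op_norm (op_diff S' T') \<le> op_norm (op_diff S T)"
proof (rule adjoint_adjointable(2)[OF op_diff_adjointable[OF S T]])
  show "op_diff S' T' \<in> ell2 \<rightarrow>\<^sub>E ell2" using op_diff_adjointable[OF S' T']
    by (simp add: adjointable_def)
  show "is_adjoint (op_diff S T) (op_diff S' T')" unfolding is_adjoint_def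
    by (simp add: ell2_inner_diff_left ell2_inner_diff_right adjointable_ell2 S T S' T'
        is_adjointD[OF adj(1)] is_adjointD[OF adj(2)])
qed

lemma op_cstar_subalgebra_closure:
  assumes X: "X \<subseteq> adjointable" and zero: "op_zero \<in> X"
    and add: "\<And>S T. S \<in> X \<Longrightarrow> T \<in> X \<Longrightarrow> op_add S T \<in> X"
    and mult: "\<And>S T. S \<in> X \<Longrightarrow> T \<in> X \<Longrightarrow> compose ell2 S T \<in> X"
    and scale: "\<And>z T. T \<in> X \<Longrightarrow> op_scale z T \<in> X"
    and adj: "\<And>T. T \<in> X \<Longrightarrow> \<exists>S\<in>X. is_adjoint T S"
  shows "op_cstar_subalgebra (op_closure X)"
  unfolding op_cstar_subalgebra_def
proof (intro conjI ballI allI impI)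
  show "op_closure X \<subseteq> adjointable" by (auto dest: op_closureD)
  show "op_zero \<in> op_closure X" using op_closure_subset[OF X] zero by blast
  fix S T assume S: "S \<in> op_closure X" and T: "T \<in> op_closure X"
  have aS: "S \<in> adjointable" and aT: "T \<in> adjointable" using S T by (auto dest: op_closureD)
  show "op_add S T \<in> op_closure X" unfolding op_closure_def
  proof (intro CollectI conjI allI impI op_add_adjointable aS aT)
    fix \<epsilon> :: real assume "\<epsilon> > 0"
    then obtain S' T' where S': "S' \<in> X" "op_norm (op_diff S S') < \<epsilon> / 2"
      and T': "T' \<in> X" "op_norm (op_diff T T') < \<epsilon> / 2"
      using op_closureD(2)[OF S, of "\<epsilon> / 2"] op_closureD(2)[OF T, of "\<epsilon> / 2"] by auto
    then have "S' \<in> adjointable" "T' \<in> adjointable" using X by auto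
    then have "op_norm (op_diff (op_add S T) (op_add S' T')) < \<epsilon>"
      using op_norm_diff_add[OF aS aT, of S' T'] S'(2) T'(2) by simp
    then show "\<exists>U\<in>X. op_norm (op_diff (op_add S T) U) < \<epsilon>"
      using add[OF S'(1) T'(1)] by blast
  qed
  show "compose ell2 S T \<in> op_closure X" unfolding op_closure_def
  proof (intro CollectI conjI allI impI compose_adjointable aS aT)
    fix \<epsilon> :: real assume \<epsilon>: "\<epsilon> > 0"
    \<comment> \<open>Since \<delta> is at most 1, T' has norm at most \<open>op_norm T + 1\<close>.
      The total error is then at most \<delta> times \<open>op_norm S + op_norm T + 1\<close>, and
      the constant 2 makes it strictly smaller than \<epsilon>.\<close>
    define \<delta> where "\<delta> = min 1 (\<epsilon> / (op_norm S + op_norm T + 2))"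
    have pos: "op_norm S + op_norm T + 2 > 0" using op_norm_nonneg[OF aS] op_norm_nonneg[OF aT]
      by simp
    have "\<delta> \<le> \<epsilon> / (op_norm S + op_norm T + 2)" by (simp add: \<delta>_def)
    then have \<delta>: "\<delta> > 0" "\<delta> \<le> 1" "\<delta> * (op_norm S + op_norm T + 2) \<le> \<epsilon>"
      using \<epsilon> pos by (simp_all only: pos_le_divide_eq[symmetric]) (simp_all add: \<delta>_def)
    obtain S' T' where S': "S' \<in> X" "op_norm (op_diff S S') < \<delta>"
      and T': "T' \<in> X" "op_norm (op_diff T T') < \<delta>"
      using op_closureD(2)[OF S \<delta>(1)] op_closureD(2)[OF T \<delta>(1)] by auto
    have aS': "S' \<in> adjointable" and aT': "T' \<in> adjointable" using S' T' X by auto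
    have nT': "op_norm T' \<le> op_norm T + 1"
      using op_norm_le_diff[OF aT' aT] op_norm_diff_commute[OF aT aT'] T'(2) \<delta>(2) by simp
    have "op_norm (op_diff (compose ell2 S T) (compose ell2 S' T'))
      \<le> op_norm S * op_norm (op_diff T T') + op_norm (op_diff S S') * op_norm T'"
      by (rule op_norm_diff_compose[OF aS aT aS' aT'])
    also have "\<dots> \<le> op_norm S * \<delta> + \<delta> * (op_norm T + 1)"
      using S' T' nT' \<delta>
        by (intro add_mono mult_mono op_norm_nonneg op_diff_adjointable aS aS' aT aT') auto
    also have "\<dots> < \<delta> * (op_norm S + op_norm T + 2)" using \<delta>(1) by (simp add: algebra_simps)
    finally show "\<exists>U\<in>X. op_norm (op_diff (compose ell2 S T) U) < \<epsilon>"
      using \<delta>(3) S' T' by (intro bexI[of _ "compose ell2 S' T'"] mult) auto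
  qed
next
  fix z T assume T: "T \<in> op_closure X"
  then have aT: "T \<in> adjointable" by (auto dest: op_closureD)
  show "op_scale z T \<in> op_closure X" unfolding op_closure_def
  proof (intro CollectI conjI allI impI op_scale_adjointable aT)
    fix \<epsilon> :: real assume \<epsilon>: "\<epsilon> > 0"
    \<comment> \<open>The added 1 covers z = 0.\<close>
    have zpos: "cmod z + 1 > 0" by (simp add: add_nonneg_pos)
    then have "\<epsilon> / (cmod z + 1) > 0" using \<epsilon> by simp
    then obtain T' where T': "T' \<in> X" "op_norm (op_diff T T') < \<epsilon> / (cmod z + 1)"
      using op_closureD(2)[OF T] by blast
    then have "(cmod z + 1) * op_norm (op_diff T T') < \<epsilon>"
      using zpos by (simp only: pos_less_divide_eq mult.commute)
    moreover have "cmod z * op_norm (op_diff T T') \<le> (cmod z + 1) * op_norm (op_diff T T')"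
      using op_norm_nonneg[OF op_diff_adjointable[OF aT, of T']] T' X
        by (intro mult_right_mono) auto
    moreover have "op_norm (op_diff (op_scale z T) (op_scale z T'))
        \<le> cmod z * op_norm (op_diff T T')"
      using T' X aT by (intro op_norm_diff_scale) auto
    ultimately show "\<exists>U\<in>X. op_norm (op_diff (op_scale z T) U) < \<epsilon>"
      using T' by (intro bexI[of _ "op_scale z T'"] scale) auto
  qed
next
  fix T assume T: "T \<in> op_closure X"
  then have aT: "T \<in> adjointable" by (auto dest: op_closureD)
  obtain S where S: "S \<in> ell2 \<rightarrow>\<^sub>E ell2" "is_adjoint T S" by (rule adjointable_adjoint[OF aT])
  have aS: "S \<in> adjointable" by (rule adjoint_adjointable(1)[OF aT S])
  have "S \<in> op_closure X" unfolding op_closure_def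
  proof (intro CollectI conjI allI impI aS)
    fix \<epsilon> :: real assume \<epsilon>: "\<epsilon> > 0"
    obtain T' where T': "T' \<in> X" "op_norm (op_diff T T') < \<epsilon>" using op_closureD(2)[OF T \<epsilon>] by auto
    obtain S' where S': "S' \<in> X" "is_adjoint T' S'" using adj[OF T'(1)] by auto
    have "op_norm (op_diff S S') \<le> op_norm (op_diff T T')"
      using T' S' X by (intro op_norm_diff_adjoint aS aT S) auto
    then show "\<exists>U\<in>X. op_norm (op_diff S U) < \<epsilon>" using S' T' by (intro bexI[of _ S']) auto
  qed
  then show "\<exists>S\<in>op_closure X. is_adjoint T S" using S by blast
next
  fix T assume "T \<in> adjointable" "\<forall>\<epsilon>>0. \<exists>S\<in>op_closure X. op_norm (op_diff T S) < \<epsilon>"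
  then show "T \<in> op_closure X" by (intro op_closure_closed[OF X]) auto
qed

section \<open>Reduced crossed products\<close>

locale cstar_dynamics =
  fixes \<alpha> :: "'g::group_add \<Rightarrow> 'b::cstar_algebra \<Rightarrow> 'b"
  assumes action: "cstar_action \<alpha>"
begin

lemma act_add: "\<alpha> s (x + y) = \<alpha> s x + \<alpha> s y"
  and act_mult: "\<alpha> s (x * y) = \<alpha> s x * \<alpha> s y"
  and act_scaleC: "\<alpha> s (scaleC z x) = scaleC z (\<alpha> s x)"
  and act_star: "\<alpha> s (star x) = star (\<alpha> s x)"
  and act_unit [simp]: "\<alpha> 0 x = x"
  and act_plus: "\<alpha> (s + t) x = \<alpha> s (\<alpha> t x)"
  using action by (auto simp: cstar_action_def star_hom_def)

lemma act_zero [simp]: "\<alpha> s 0 = 0"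
  using act_scaleC[of s 0 0] by simp

lemma act_inverse [simp]: "\<alpha> (- s) (\<alpha> s x) = x" "\<alpha> s (\<alpha> (- s) x) = x"
  using act_plus[of "- s" s x] act_plus[of s "- s" x] by simp_all

lemma act_scaleR: "\<alpha> s (r *\<^sub>R x) = r *\<^sub>R \<alpha> s x"
  using act_scaleC[of s "of_real r" x] by (simp add: scaleC_of_real)

lemma act_diff: "\<alpha> s (x - y) = \<alpha> s x - \<alpha> s y"
  using act_add[of s "x - y" y] by simp

lemma act_sum: "\<alpha> s (sum f F) = (\<Sum>i\<in>F. \<alpha> s (f i))"
  by (induction F rule: infinite_finite_induct) (auto simp: act_add)

lemma norm_act_le: "norm (\<alpha> s x) \<le> norm x"
  using action star_hom_norm_le by (auto simp: cstar_action_def)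

lemma norm_act [simp]: "norm (\<alpha> s x) = norm x"
  using norm_act_le[of s x] norm_act_le[of "- s" "\<alpha> s x"] by simp

lemma bounded_linear_act: "bounded_linear (\<alpha> s)"
  by (rule bounded_linear_intro[of _ 1]) (auto simp: act_add act_scaleR)

text \<open>The operator \<open>\<pi>(b) \<lambda>\<^sub>s\<close>.\<close>

definition monomial :: "'g \<Rightarrow> 'b \<Rightarrow> ('g, 'b) op" where
  "monomial s b = (\<lambda>\<xi>\<in>ell2. \<lambda>t. \<alpha> (- t) b * \<xi> (- s + t))"

lemma bij_left_translation: "bij (\<lambda>t::'g. s + t)"
  by (rule bij_betwI[of _ _ _ "\<lambda>t. - s + t"]) (auto simp: add.assoc[symmetric])

lemma ell2_translate: "\<xi> \<in> ell2 \<Longrightarrow> (\<lambda>t::'g. \<xi> (s + t)) \<in> ell2"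
  by (rule ell2_reindex[OF bij_left_translation])

lemma ell2_norm_translate: "ell2_norm (\<lambda>t::'g. \<xi> (s + t)) = ell2_norm \<xi>"
  by (simp add: ell2_norm_def ell2_inner_reindex[OF bij_left_translation])

lemma monomial_apply: "\<xi> \<in> ell2 \<Longrightarrow> monomial s b \<xi> = (\<lambda>t. \<alpha> (- t) b * \<xi> (- s + t))"
  by (simp add: monomial_def)

lemma monomial_ell2: "\<xi> \<in> ell2 \<Longrightarrow> monomial s b \<xi> \<in> ell2"
  unfolding monomial_apply by (rule ell2_mult_left[where K = "norm b"]) (auto intro: ell2_translate)

lemma monomial_norm_bound: "\<xi> \<in> ell2 \<Longrightarrow> ell2_norm (monomial s b \<xi>) \<le> norm b * ell2_norm \<xi>"
  unfolding monomial_apply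
  using ell2_norm_mult_left[OF ell2_translate[of \<xi> "- s"], of "\<lambda>t. \<alpha> (- t) b" "norm b"]
  by (simp add: ell2_norm_translate)

text \<open>Substituting s + t for t in the inner product moves the shift to \<eta>, and the action
  turns the coefficient into \<open>\<alpha> (- s) (star b)\<close>.\<close>

lemma monomial_adjoint: "is_adjoint (monomial s b) (monomial (- s) (\<alpha> (- s) (star b)))"
  unfolding is_adjoint_def
proof (intro ballI)
  fix \<xi> \<eta> :: "'g \<Rightarrow> 'b" assume \<xi>: "\<xi> \<in> ell2" and \<eta>: "\<eta> \<in> ell2"
  have "ell2_inner (monomial s b \<xi>) \<eta> = ell2_inner (\<lambda>t. \<xi> (- s + t)) (\<lambda>t. star (\<alpha> (- t) b) * \<eta> t)"
    unfolding monomial_apply[OF \<xi>] by (rule ell2_inner_mult_left)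
  also have "\<dots> = ell2_inner (\<lambda>t. \<xi> (- s + (s + t))) (\<lambda>t. star (\<alpha> (- (s + t)) b) * \<eta> (s + t))"
    by (rule ell2_inner_reindex[OF bij_left_translation, symmetric])
  also have "\<dots> = ell2_inner \<xi> (monomial (- s) (\<alpha> (- s) (star b)) \<eta>)"
    unfolding monomial_apply[OF \<eta>] minus_add act_plus minus_minus act_star
    by (simp add: add.assoc[symmetric])
  finally show "ell2_inner (monomial s b \<xi>) \<eta> = ell2_inner \<xi> (monomial (- s) (\<alpha> (- s) (star b)) \<eta>)" .
qed

lemma monomial_PiE: "monomial s b \<in> ell2 \<rightarrow>\<^sub>E ell2"
  by (rule PiE_I) (simp_all add: monomial_ell2, simp add: monomial_def)

lemma monomial_adjointable [simp]: "monomial s b \<in> adjointable"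
  by (rule adjointableI[OF monomial_PiE monomial_PiE monomial_adjoint monomial_norm_bound])

lemma op_norm_monomial: "op_norm (monomial s b) \<le> norm b"
  by (rule op_norm_le[OF norm_ge_zero monomial_norm_bound])

lemma monomial_compose: "compose ell2 (monomial s b) (monomial t c) = monomial (s + t) (b * \<alpha> s c)"
proof (rule extensionalityI[of _ ell2])
  fix \<xi> :: "'g \<Rightarrow> 'b" assume \<xi>: "\<xi> \<in> ell2"
  have "monomial s b (monomial t c \<xi>) = (\<lambda>u. \<alpha> (- u) b * monomial t c \<xi> (- s + u))"
    by (rule monomial_apply[OF monomial_ell2[OF \<xi>]])
  also have "\<dots> = monomial (s + t) (b * \<alpha> s c) \<xi>"
    unfolding monomial_apply[OF \<xi>]
    by (simp only: minus_add act_plus act_mult mult.assoc add.assoc minus_minus)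
  finally show "compose ell2 (monomial s b) (monomial t c) \<xi> = monomial (s + t) (b * \<alpha> s c) \<xi>"
    by (simp add: compose_eq[OF \<xi>])
qed (simp_all add: monomial_def compose_def)

lemma monomial_add: "monomial s (b + c) = op_add (monomial s b) (monomial s c)"
  by (rule extensionalityI[of _ ell2])
    (simp_all add: monomial_apply act_add algebra_simps, simp_all add: monomial_def op_add_def)

lemma monomial_scale: "monomial s (scaleC z b) = op_scale z (monomial s b)"
  by (rule extensionalityI[of _ ell2])
    (simp_all add: monomial_apply act_scaleC mult_scaleC_left, simp_all add: monomial_def op_scale_def)

lemma monomial_diff: "monomial s (b - c) = op_diff (monomial s b) (monomial s c)"
  by (rule extensionalityI[of _ ell2])
    (simp_all add: monomial_apply act_diff algebra_simps, simp_all add: monomial_def op_diff_def)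

lemma monomial_zero: "monomial s 0 = op_zero"
  by (rule extensionalityI[of _ ell2])
    (simp_all add: monomial_apply, simp_all add: monomial_def op_zero_def)

lemma op_norm_monomial_diff: "op_norm (op_diff (monomial s b) (monomial s c)) \<le> norm (b - c)"
  unfolding monomial_diff[symmetric] by (rule op_norm_monomial)

section \<open>Finite sums of monomials and their norm closure\<close>

lemma coeff_op_shift_op:
  "\<xi> \<in> ell2 \<Longrightarrow> coeff_op \<alpha> b (shift_op s \<xi>) = monomial s b \<xi>"
  using ell2_translate[of \<xi> "- s"] by (simp add: coeff_op_def shift_op_def monomial_apply)

text \<open>Coefficients are kept as finitely supported functions because these form a real vector
  space, on which seminorms and linear functionals can be considered.\<close>

definition cp_op :: "('g \<Rightarrow>\<^sub>0 'b) \<Rightarrow> ('g, 'b) op" where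
  "cp_op d = (\<lambda>\<xi>\<in>ell2. \<lambda>t. \<Sum>s\<in>Poly_Mapping.keys d. monomial s (Poly_Mapping.lookup d s) \<xi> t)"

lemma cp_op_superset:
  assumes "finite F" "Poly_Mapping.keys d \<subseteq> F" "\<xi> \<in> ell2"
  shows "cp_op d \<xi> = (\<lambda>t. \<Sum>s\<in>F. monomial s (Poly_Mapping.lookup d s) \<xi> t)"
proof -
  have "monomial s (Poly_Mapping.lookup d s) \<xi> t = 0" if "s \<notin> Poly_Mapping.keys d" for s t
    using that assms(3) by (simp add: in_keys_iff monomial_zero)
  then show ?thesis using assms by (auto simp: cp_op_def intro!: sum.mono_neutral_left)
qed

lemma cp_op_zero: "cp_op 0 = op_zero"
  by (simp add: cp_op_def op_zero_def)

lemma cp_op_single: "cp_op (Poly_Mapping.single s b) = monomial s b"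
proof (rule extensionalityI[of _ ell2])
  fix \<xi> :: "'g \<Rightarrow> 'b" assume "\<xi> \<in> ell2"
  then show "cp_op (Poly_Mapping.single s b) \<xi> = monomial s b \<xi>"
    by (subst cp_op_superset[of "{s}"]) auto
qed (simp_all add: cp_op_def monomial_def)

lemma cp_op_add: "cp_op (d + e) = op_add (cp_op d) (cp_op e)"
proof (rule extensionalityI[of _ ell2])
  fix \<xi> :: "'g \<Rightarrow> 'b" assume \<xi>: "\<xi> \<in> ell2"
  let ?F = "Poly_Mapping.keys d \<union> Poly_Mapping.keys e"
  have "cp_op (d + e) \<xi> = (\<lambda>t. \<Sum>s\<in>?F. monomial s (Poly_Mapping.lookup (d + e) s) \<xi> t)"
    by (rule cp_op_superset[OF _ keys_add \<xi>]) simp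
  also have "\<dots> = (\<lambda>t. (\<Sum>s\<in>?F. monomial s (Poly_Mapping.lookup d s) \<xi> t)
      + (\<Sum>s\<in>?F. monomial s (Poly_Mapping.lookup e s) \<xi> t))"
    by (simp add: lookup_add monomial_add \<xi> sum.distrib)
  also have "\<dots> = op_add (cp_op d) (cp_op e) \<xi>"
    using \<xi> by (simp add: cp_op_superset[of ?F])
  finally show "cp_op (d + e) \<xi> = op_add (cp_op d) (cp_op e) \<xi>" .
qed (simp_all add: cp_op_def op_add_def)

lemma poly_mapping_eq_sum_single:
  "d = (\<Sum>s\<in>Poly_Mapping.keys d. Poly_Mapping.single s (Poly_Mapping.lookup d s))"
  by (rule poly_mapping_eqI) (auto simp: lookup_sum lookup_single when_def in_keys_iff)

lemma cp_op_induct [consumes 1, case_names zero add]: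
  assumes "\<And>s. Poly_Mapping.lookup d s \<in> D"
    and "P op_zero"
    and "\<And>s b e. b \<in> D \<Longrightarrow> P (cp_op e) \<Longrightarrow> P (op_add (monomial s b) (cp_op e))"
  shows "P (cp_op d)"
proof -
  have "P (cp_op (\<Sum>s\<in>F. Poly_Mapping.single s (Poly_Mapping.lookup d s)))" if "finite F" for F
    using that by (induction F) (auto simp: cp_op_zero cp_op_add cp_op_single assms)
  then show ?thesis by (subst poly_mapping_eq_sum_single) simp
qed

lemma cp_op_adjointable [simp]: "cp_op d \<in> adjointable"
  by (rule cp_op_induct[of d UNIV]) (auto intro: op_zero_adjointable op_add_adjointable)

lemma algebraic_crossed_product_eq:
  assumes "0 \<in> D"
  shows "algebraic_crossed_product \<alpha> D = {cp_op d | d. \<forall>s. Poly_Mapping.lookup d s \<in> D}"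
proof (intro set_eqI iffI)
  fix T assume "T \<in> algebraic_crossed_product \<alpha> D"
  then obtain F d where F: "finite F" "\<forall>s\<in>F. d s \<in> D"
    and T: "T = (\<lambda>\<xi>\<in>ell2. \<lambda>t. \<Sum>s\<in>F. coeff_op \<alpha> (d s) (shift_op s \<xi>) t)"
    unfolding algebraic_crossed_product_def by auto
  define e where "e = Abs_poly_mapping (\<lambda>s. if s \<in> F then d s else 0)"
  have e: "Poly_Mapping.lookup e s = (if s \<in> F then d s else 0)" for s
    unfolding e_def by (subst lookup_Abs_poly_mapping) (auto intro: finite_subset[OF _ F(1)])
  have "T = cp_op e" unfolding T
  proof (rule extensionalityI[of _ ell2])
    fix \<xi> :: "'g \<Rightarrow> 'b" assume \<xi>: "\<xi> \<in> ell2"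
    have "Poly_Mapping.keys e \<subseteq> F" by (auto simp: in_keys_iff e split: if_splits)
    then show "(\<lambda>\<xi>\<in>ell2. \<lambda>t. \<Sum>s\<in>F. coeff_op \<alpha> (d s) (shift_op s \<xi>) t) \<xi> = cp_op e \<xi>"
      using \<xi> F(1) by (simp add: cp_op_superset[of F] coeff_op_shift_op e)
  qed (simp_all add: cp_op_def)
  then show "T \<in> {cp_op d | d. \<forall>s. Poly_Mapping.lookup d s \<in> D}" using F(2) assms e by auto
next
  fix T assume "T \<in> {cp_op d | d. \<forall>s. Poly_Mapping.lookup d s \<in> D}"
  then obtain d where d: "\<forall>s. Poly_Mapping.lookup d s \<in> D" "T = cp_op d" by auto
  then have "T = (\<lambda>\<xi>\<in>ell2. \<lambda>t. \<Sum>s\<in>Poly_Mapping.keys d. coeff_op \<alpha> (Poly_Mapping.lookup d s) (shift_op s \<xi>) t)"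
    by (auto simp: cp_op_def coeff_op_shift_op intro!: restrict_ext)
  then show "T \<in> algebraic_crossed_product \<alpha> D"
    unfolding algebraic_crossed_product_def using d(1)
    by (auto intro!: exI[of _ "Poly_Mapping.keys d"] exI[of _ "Poly_Mapping.lookup d"])
qed

lemma algebraic_crossed_product_adjointable: "0 \<in> D \<Longrightarrow> algebraic_crossed_product \<alpha> D \<subseteq> adjointable"
  by (auto simp: algebraic_crossed_product_eq)

lemma reduced_crossed_product_closure: "reduced_crossed_product \<alpha> D
    = op_closure (algebraic_crossed_product \<alpha> D)"
  by (simp add: reduced_crossed_product_def op_closure_def)

lemma monomial_algebraic: "0 \<in> D \<Longrightarrow> b \<in> D \<Longrightarrow> monomial s b \<in> algebraic_crossed_product \<alpha> D"
  unfolding algebraic_crossed_product_eq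
  by (auto intro!: exI[of _ "Poly_Mapping.single s b"] simp: cp_op_single lookup_single when_def)

lemma monomial_reduced: "0 \<in> D \<Longrightarrow> b \<in> D \<Longrightarrow> monomial s b \<in> reduced_crossed_product \<alpha> D"
  unfolding reduced_crossed_product_closure
  using op_closure_subset[OF algebraic_crossed_product_adjointable] monomial_algebraic by blast

lemma compose_op_add_left: "compose ell2 (op_add S T) U
    = op_add (compose ell2 S U) (compose ell2 T U)"
  if "U \<in> adjointable"
  by (rule extensionalityI[of _ ell2])
    (simp_all add: compose_eq adjointable_ell2 that, simp_all add: op_add_def compose_def)

lemma compose_op_add_right: "compose ell2 S (op_add T U)
    = op_add (compose ell2 S T) (compose ell2 S U)"
  if "S \<in> adjointable" "T \<in> adjointable" "U \<in> adjointable"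
  by (rule extensionalityI[of _ ell2])
    (simp_all add: compose_eq adjointable_ell2 adjointable_add that, simp_all add: op_add_def compose_def)

lemma compose_op_zero: "compose ell2 op_zero T = op_zero" "compose ell2 T op_zero = op_zero"
  if "T \<in> adjointable"
  by (auto simp: compose_def fun_eq_iff op_zero_def adjointable_zero[OF that] adjointable_ell2[OF that])

lemma op_scale_add: "op_scale z (op_add S T) = op_add (op_scale z S) (op_scale z T)"
  unfolding op_scale_def op_add_def by (rule restrict_ext) (simp add: scaleC_add_right)

lemma algebraic_crossed_product_add:
  assumes "0 \<in> D" "\<forall>x\<in>D. \<forall>y\<in>D. x + y \<in> D"
    and "S \<in> algebraic_crossed_product \<alpha> D" "T \<in> algebraic_crossed_product \<alpha> D"
  shows "op_add S T \<in> algebraic_crossed_product \<alpha> D"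
proof -
  obtain d e where "S = cp_op d" "T = cp_op e" "\<forall>s. Poly_Mapping.lookup d s \<in> D"
      "\<forall>s. Poly_Mapping.lookup e s \<in> D"
    using assms(3,4) unfolding algebraic_crossed_product_eq[OF assms(1)] by auto
  then have "op_add S T = cp_op (d + e)" "\<forall>s. Poly_Mapping.lookup (d + e) s \<in> D"
    by (simp_all add: cp_op_add lookup_add assms(2))
  then show ?thesis unfolding algebraic_crossed_product_eq[OF assms(1)] by blast
qed

lemma algebraic_crossed_product_induct:
  assumes D0: "0 \<in> D" and D_add: "\<forall>x\<in>D. \<forall>y\<in>D. x + y \<in> D"
    and T: "T \<in> algebraic_crossed_product \<alpha> D" and P0: "P op_zero"
    and Pm: "\<And>s b. b \<in> D \<Longrightarrow> P (monomial s b)"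
    and Pa: "\<And>S T. S \<in> algebraic_crossed_product \<alpha> D \<Longrightarrow> T \<in> algebraic_crossed_product \<alpha> D \<Longrightarrow>
      P S \<Longrightarrow> P T \<Longrightarrow> P (op_add S T)"
  shows "P T"
proof -
  obtain d where d: "\<And>s. Poly_Mapping.lookup d s \<in> D" "T = cp_op d"
    using T unfolding algebraic_crossed_product_eq[OF D0] by auto
  have "P (cp_op d) \<and> cp_op d \<in> algebraic_crossed_product \<alpha> D"
  proof (rule cp_op_induct[OF d(1)])
    show "P op_zero \<and> op_zero \<in> algebraic_crossed_product \<alpha> D"
      using monomial_algebraic[OF D0 D0, of 0] P0 by (simp add: monomial_zero)
  next
    fix s b e
    assume b: "b \<in> D" and e: "P (cp_op e) \<and> cp_op e \<in> algebraic_crossed_product \<alpha> D"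
    have m: "monomial s b \<in> algebraic_crossed_product \<alpha> D" by (rule monomial_algebraic[OF D0 b])
    show "P (op_add (monomial s b) (cp_op e)) \<and> op_add (monomial s b) (cp_op e) \<in> algebraic_crossed_product \<alpha> D"
      using Pa[OF m _ Pm[OF b]] e algebraic_crossed_product_add[OF D0 D_add m] by blast
  qed
  then show ?thesis using d(2) by simp
qed

lemma op_cstar_subalgebra_reduced:
  assumes D: "cstar_subalgebra D" and inv: "action_invariant \<alpha> D"
  shows "op_cstar_subalgebra (reduced_crossed_product \<alpha> D)"
proof -
  let ?X = "algebraic_crossed_product \<alpha> D"
  have D0: "0 \<in> D" and D_add: "\<forall>x\<in>D. \<forall>y\<in>D. x + y \<in> D"
    and D_mult: "\<And>x y. x \<in> D \<Longrightarrow> y \<in> D \<Longrightarrow> x * y \<in> D"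
    and D_scale: "\<And>z x. x \<in> D \<Longrightarrow> scaleC z x \<in> D" and D_star: "\<And>x. x \<in> D \<Longrightarrow> star x \<in> D"
    and D_act: "\<And>s x. x \<in> D \<Longrightarrow> \<alpha> s x \<in> D"
    using D inv by (auto simp: cstar_subalgebra_def action_invariant_def)
  note eq = algebraic_crossed_product_eq[OF D0]
  note mono = monomial_algebraic[OF D0]
  have X: "?X \<subseteq> adjointable" by (rule algebraic_crossed_product_adjointable[OF D0])
  have zero_in: "op_zero \<in> ?X" using mono[OF D0, of 0] by (simp add: monomial_zero)
  have X_add: "op_add S T \<in> ?X" if "S \<in> ?X" "T \<in> ?X" for S T
    by (rule algebraic_crossed_product_add[OF D0 D_add that])
  have scale: "op_scale z T \<in> ?X" if "T \<in> ?X" for z T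
    using that
  proof (induction rule: algebraic_crossed_product_induct[OF D0 D_add, consumes 1, case_names zero monomial add])
    case zero
    show ?case using mono[OF D0, of 0] monomial_scale[of 0 z 0] by (simp add: monomial_zero)
  next
    case (monomial s b)
    then show ?case by (simp add: monomial_scale[symmetric] mono D_scale)
  next
    case (add S T)
    then show ?case by (simp add: op_scale_add X_add)
  qed
  have mono_mult: "compose ell2 (monomial s b) T \<in> ?X" if "T \<in> ?X" "b \<in> D" for s b T
    using that(1)
  proof (induction rule: algebraic_crossed_product_induct[OF D0 D_add, consumes 1, case_names zero monomial add])
    case zero
    show ?case by (simp add: compose_op_zero zero_in)
  next
    case (monomial t c)
    then show ?case by (simp add: monomial_compose mono D_mult D_act that(2))
  next
    case (add S T)
    then have "S \<in> adjointable" "T \<in> adjointable" using X by auto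
    then show ?case using add by (simp add: compose_op_add_right X_add)
  qed
  have mult: "compose ell2 S T \<in> ?X" if "S \<in> ?X" "T \<in> ?X" for S T
    using that(1)
  proof (induction rule: algebraic_crossed_product_induct[OF D0 D_add, consumes 1, case_names zero monomial add])
    case zero
    have "T \<in> adjointable" using X that(2) by auto
    then show ?case by (simp add: compose_op_zero zero_in)
  next
    case (monomial s b)
    then show ?case by (simp add: mono_mult that(2))
  next
    case (add S S')
    have "T \<in> adjointable" using X that(2) by auto
    then show ?case using add by (simp add: compose_op_add_left X_add)
  qed
  have adj: "\<exists>S\<in>?X. is_adjoint T S" if "T \<in> ?X" for T
    using that
  proof (induction rule: algebraic_crossed_product_induct[OF D0 D_add, consumes 1, case_names zero monomial add])
    case zero
    have "is_adjoint op_zero (op_zero :: ('g, 'b) op)" by (simp add: is_adjoint_def)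
    then show ?case using zero_in by blast
  next
    case (monomial s b)
    then show ?case using monomial_adjoint mono[OF D_act[OF D_star]] by blast
  next
    case (add S T)
    then obtain S' T' where S': "S' \<in> ?X" "is_adjoint S S'" and T': "T' \<in> ?X" "is_adjoint T T'"
      by blast
    have "S \<in> adjointable" "T \<in> adjointable" "S' \<in> adjointable" "T' \<in> adjointable"
      using add S' T' X by auto
    then have "is_adjoint (op_add S T) (op_add S' T')"
      by (intro is_adjoint_op_add S'(2) T'(2)) (simp_all add: adjointable_ell2)
    then show ?case using X_add[OF S'(1) T'(1)] by blast
  qed
  show ?thesis unfolding reduced_crossed_product_closure
    by (rule op_cstar_subalgebra_closure[OF X zero_in X_add mult scale adj])
qed

text \<open>The matrix entry of \<open>T\<close> in row \<open>t\<close> and column \<open>- s + t\<close> is \<open>\<alpha>\<^sub>-\<^sub>t\<close> of its \<open>s\<close>-th Fourier coefficient.\<close>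

definition has_coeff :: "('g, 'b) op \<Rightarrow> 'g \<Rightarrow> 'b \<Rightarrow> bool" where
  "has_coeff T s b \<longleftrightarrow> (\<forall>t c. T (ell2_single (- s + t) c) t = \<alpha> (- t) b * c)"

section \<open>Fourier coefficients\<close>

lemma has_coeff_monomial: "has_coeff (monomial s b) r (if r = s then b else 0)"
  by (auto simp: has_coeff_def monomial_apply) (auto simp: ell2_single_def)

lemma has_coeff_add: "has_coeff S s b \<Longrightarrow> has_coeff T s c \<Longrightarrow> has_coeff (op_add S T) s (b + c)"
  by (simp add: has_coeff_def act_add distrib_right)

lemma has_coeff_diff: "has_coeff S s b \<Longrightarrow> has_coeff T s c \<Longrightarrow> has_coeff (op_diff S T) s (b - c)"
  by (simp add: has_coeff_def act_diff left_diff_distrib)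

lemma has_coeff_cp_op: "has_coeff (cp_op d) s (Poly_Mapping.lookup d s)"
proof -
  have "has_coeff (cp_op (\<Sum>r\<in>F. Poly_Mapping.single r (Poly_Mapping.lookup d r))) s
      (\<Sum>r\<in>F. if s = r then Poly_Mapping.lookup d r else 0)" if "finite F" for F
    using that
  proof (induction F)
    case empty
    then show ?case by (simp add: cp_op_zero has_coeff_def)
  next
    case (insert r F)
    then show ?case
      using has_coeff_add[OF has_coeff_monomial[of r "Poly_Mapping.lookup d r" s] insert(3)]
      by (simp only: cp_op_add cp_op_single sum.insert not_False_eq_True)
  qed
  from this[of "Poly_Mapping.keys d"] show ?thesis
    by (cases "Poly_Mapping.lookup d s = 0") (simp_all add: poly_mapping_eq_sum_single[symmetric] in_keys_iff)
qed

text \<open>Without a unit, the column at - s is fed with \<open>star b\<close>; the value at the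
  neutral element is then \<open>b * star b\<close>.\<close>

lemma has_coeff_norm_le:
  assumes T: "T \<in> adjointable" and c: "has_coeff T s b"
  shows "norm b \<le> op_norm T"
proof (cases "b = 0")
  case False
  have "norm (b * star b) \<le> op_norm T * norm b"
  proof -
    have eq: "b * star b = T (ell2_single (- s + 0) (star b)) 0"
      using c[unfolded has_coeff_def, rule_format, of 0 "star b"] by simp
    have "norm (b * star b) \<le> ell2_norm (T (ell2_single (- s + 0) (star b)))"
      unfolding eq by (rule norm_le_ell2_norm[OF adjointable_ell2[OF T]]) simp
    also have "\<dots> \<le> op_norm T * norm b"
      using op_norm_bound[OF T, of "ell2_single (- s + 0) (star b)"] by simp
    finally show ?thesis .
  qed
  then have "norm b * norm b \<le> op_norm T * norm b"
    using cstar_identity[of "star b"] by (simp add: star_star power2_eq_square)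
  then show ?thesis using False by simp
qed (simp add: op_norm_nonneg T)

lemma has_coeff_diff_norm_le:
  "S \<in> adjointable \<Longrightarrow> T \<in> adjointable \<Longrightarrow> has_coeff S s b \<Longrightarrow> has_coeff T s c \<Longrightarrow>
    norm (b - c) \<le> op_norm (op_diff S T)"
  by (intro has_coeff_norm_le op_diff_adjointable has_coeff_diff)

lemma has_coeff_unique:
  assumes "T \<in> adjointable" "has_coeff T s b" "has_coeff T s c"
  shows "b = c"
  using has_coeff_diff_norm_le[OF assms(1,1,2,3)] by (simp add: op_norm_diff_self)

lemma reduced_crossed_product_sequence:
  assumes "T \<in> reduced_crossed_product \<alpha> D" "0 \<in> D"
  obtains d where "\<And>n s. Poly_Mapping.lookup (d n) s \<in> D"
      "(\<lambda>n. op_norm (op_diff T (cp_op (d n)))) \<longlonglongrightarrow> 0"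
proof -
  have "\<exists>d. (\<forall>s. Poly_Mapping.lookup d s \<in> D) \<and> op_norm (op_diff T (cp_op d)) < inverse (real (Suc n))" for n
    using assms(1) unfolding reduced_crossed_product_def algebraic_crossed_product_eq[OF assms(2)]
    by (fastforce dest: spec[of _ "inverse (real (Suc n))"])
  then obtain d where d: "\<And>n. (\<forall>s. Poly_Mapping.lookup (d n) s \<in> D)
      \<and> op_norm (op_diff T (cp_op (d n))) < inverse (real (Suc n))" by metis
  have aT: "T \<in> adjointable" using assms(1) by (simp add: reduced_crossed_product_def)
  have "(\<lambda>n. op_norm (op_diff T (cp_op (d n)))) \<longlonglongrightarrow> 0"
  proof (rule tendsto_sandwich[OF _ _ tendsto_const LIMSEQ_inverse_real_of_nat])
    show "\<forall>\<^sub>F n in sequentially. 0 \<le> op_norm (op_diff T (cp_op (d n)))"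
      by (simp add: op_norm_nonneg op_diff_adjointable aT)
    show "\<forall>\<^sub>F n in sequentially. op_norm (op_diff T (cp_op (d n))) \<le> inverse (real (Suc n))"
      using d by (simp add: less_imp_le)
  qed
  then show ?thesis using that d by blast
qed

text \<open>Coefficients depend contractively on the operator, so those of the approximants are
  Cauchy; that their limit is the coefficient of T is checked entry by entry.\<close>

lemma has_coeff_limit:
  assumes T: "T \<in> adjointable" and S: "\<And>n. S n \<in> adjointable"
    and lim: "(\<lambda>n. op_norm (op_diff T (S n))) \<longlonglongrightarrow> 0" and c: "\<And>n. has_coeff (S n) s (b n)"
  obtains b' where "b \<longlonglongrightarrow> b'" "has_coeff T s b'"
proof -
  have close: "norm (b m - b n) \<le> op_norm (op_diff T (S m)) + op_norm (op_diff T (S n))" for m n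
  proof -
    have "norm (b m - b n) \<le> op_norm (op_diff (S m) (S n))"
      by (rule has_coeff_diff_norm_le[OF S S c c])
    also have "\<dots> \<le> op_norm (op_diff (S m) T) + op_norm (op_diff T (S n))"
      by (intro op_norm_diff_triangle S T)
    finally show ?thesis by (simp add: op_norm_diff_commute[OF S T])
  qed
  have "Cauchy b"
  proof (rule metric_CauchyI)
    fix e :: real assume "e > 0"
    then obtain N where N: "\<And>n. n \<ge> N \<Longrightarrow> op_norm (op_diff T (S n)) < e / 2"
      using order_tendstoD(2)[OF lim, of "e / 2"] unfolding eventually_sequentially by auto
    have "dist (b m) (b n) < e" if "m \<ge> N" "n \<ge> N" for m n
      using close[of m n] N[OF that(1)] N[OF that(2)] by (simp add: dist_norm)
    then show "\<exists>N. \<forall>m\<ge>N. \<forall>n\<ge>N. dist (b m) (b n) < e" by blast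
  qed
  then obtain b' where b': "b \<longlonglongrightarrow> b'" using Cauchy_convergent convergent_def by blast
  have "has_coeff T s b'" unfolding has_coeff_def
  proof (intro allI)
    fix t and x :: 'b
    let ?e = "ell2_single (- s + t) x"
    have "norm (\<alpha> (- t) (b n) * x - T ?e t) \<le> op_norm (op_diff T (S n)) * norm x" for n
    proof -
      have eq: "\<alpha> (- t) (b n) * x - T ?e t = - (op_diff T (S n) ?e t)"
        using c[of n] by (simp add: has_coeff_def)
      have "norm (\<alpha> (- t) (b n) * x - T ?e t) \<le> ell2_norm (op_diff T (S n) ?e)"
        unfolding eq norm_minus_cancel
        by (rule norm_le_ell2_norm[OF adjointable_ell2[OF op_diff_adjointable[OF T S] ell2_single]])
      also have "\<dots> \<le> op_norm (op_diff T (S n)) * norm x"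
        using op_norm_bound[OF op_diff_adjointable[OF T S], of ?e n] by simp
      finally show ?thesis .
    qed
    note bound = this
    have "(\<lambda>n. op_norm (op_diff T (S n)) * norm x) \<longlonglongrightarrow> 0"
      using tendsto_mult_right[OF lim, of "norm x"] by simp
    then have "(\<lambda>n. \<alpha> (- t) (b n) * x - T ?e t) \<longlonglongrightarrow> 0"
      by (rule Lim_null_comparison[rotated]) (rule always_eventually, rule allI, rule bound)
    then have "(\<lambda>n. \<alpha> (- t) (b n) * x) \<longlonglongrightarrow> T ?e t" by (rule LIM_zero_cancel)
    moreover have "(\<lambda>n. \<alpha> (- t) (b n) * x) \<longlonglongrightarrow> \<alpha> (- t) b' * x"
      by (intro tendsto_intros bounded_linear.tendsto[OF bounded_linear_act] b')
    ultimately show "T ?e t = \<alpha> (- t) b' * x" by (rule LIMSEQ_unique)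
  qed
  then show ?thesis using that b' by blast
qed

lemma reduced_crossed_product_coeff:
  assumes T: "T \<in> reduced_crossed_product \<alpha> D" and D: "0 \<in> D" "closed D"
  obtains b where "b \<in> D" "has_coeff T s b"
proof -
  obtain d where d: "\<And>n s. Poly_Mapping.lookup (d n) s \<in> D"
      "(\<lambda>n. op_norm (op_diff T (cp_op (d n)))) \<longlonglongrightarrow> 0"
    by (rule reduced_crossed_product_sequence[OF T D(1)]) blast
  have "T \<in> adjointable" using T by (simp add: reduced_crossed_product_def)
  then obtain b where b: "(\<lambda>n. Poly_Mapping.lookup (d n) s) \<longlonglongrightarrow> b" "has_coeff T s b"
    by (rule has_coeff_limit[OF _ cp_op_adjointable d(2) has_coeff_cp_op]) blast
  have "b \<in> D" by (rule closed_sequentially[OF D(2) _ b(1)]) (rule d(1))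
  then show ?thesis using that b(2) by blast
qed

lemma reduced_crossed_product_mono: "D \<subseteq> E \<Longrightarrow> reduced_crossed_product \<alpha> D \<subseteq> reduced_crossed_product \<alpha> E"
  unfolding reduced_crossed_product_def algebraic_crossed_product_def by blast

text \<open>Recovers D from its crossed product; injectivity of the map and reflection of inclusions
  come from the case s = 0.\<close>

lemma monomial_reduced_iff:
  assumes "0 \<in> D" "closed D"
  shows "monomial s b \<in> reduced_crossed_product \<alpha> D \<longleftrightarrow> b \<in> D"
proof
  assume m: "monomial s b \<in> reduced_crossed_product \<alpha> D"
  obtain c where c: "c \<in> D" "has_coeff (monomial s b) s c"
    by (rule reduced_crossed_product_coeff[OF m assms]) blast
  have "has_coeff (monomial s b) s b" using has_coeff_monomial[of s b s] by simp
  then show "b \<in> D" using has_coeff_unique[OF monomial_adjointable c(2)] c(1) by simp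
qed (rule monomial_reduced[OF assms(1)])

end

section \<open>Orthonormal systems with respect to a state\<close>

text \<open>Cauchy-Schwarz for the semi-inner product of \<rho>. Such r are carried along and
  treated as zero instead of being divided out.\<close>

lemma state_null:
  assumes \<rho>: "cstar_state \<rho>" and r: "\<rho> (star r * r) = 0"
  shows "\<rho> (star y * r) = 0" "\<rho> (star r * y) = 0"
proof -
  have "(cmod (\<rho> (star y * r)))\<^sup>2 \<le> 0"
    using state_Cauchy_Schwarz[OF \<rho>, of y r] r by simp
  then show 1: "\<rho> (star y * r) = 0" by simp
  then show "\<rho> (star r * y) = 0"
    using state_star[OF \<rho>, of "star y * r"] by (simp add: star_mult star_star)
qed

definition state_orthonormal :: "('b::cstar_algebra \<Rightarrow> complex) \<Rightarrow> nat \<Rightarrow> (nat \<Rightarrow> 'b) \<Rightarrow> bool" where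
  "state_orthonormal \<rho> k e \<longleftrightarrow> (\<forall>p<k. \<forall>q<k. \<rho> (star (e p) * e q) = (if p = q then 1 else 0))"

definition state_residual :: "('b::cstar_algebra \<Rightarrow> complex) \<Rightarrow> nat \<Rightarrow> (nat \<Rightarrow> 'b) \<Rightarrow> 'b \<Rightarrow> 'b" where
  "state_residual \<rho> k e v = v - (\<Sum>p<k. scaleC (\<rho> (star (e p) * v)) (e p))"

lemma state_inner_combination:
  assumes \<rho>: "cstar_state \<rho>"
  shows "\<rho> (star y * (\<Sum>p<k. scaleC (c p) (e p))) = (\<Sum>p<k. c p * \<rho> (star y * e p))"
  by (simp add: sum_distrib_left mult_scaleC_right state_sum[OF \<rho>] state_scaleC[OF \<rho>])

lemma state_residual_orthogonal:
  assumes \<rho>: "cstar_state \<rho>" and e: "state_orthonormal \<rho> k e" and p: "p < k"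
  shows "\<rho> (star (e p) * state_residual \<rho> k e v) = 0" "\<rho> (star (state_residual \<rho> k e v) * e p) = 0"
proof -
  have "(\<Sum>q<k. \<rho> (star (e q) * v) * \<rho> (star (e p) * e q)) = (\<Sum>q<k. if q
      = p then \<rho> (star (e q) * v) else 0)"
    using e p by (intro sum.cong) (auto simp: state_orthonormal_def)
  then show 1: "\<rho> (star (e p) * state_residual \<rho> k e v) = 0"
    using p by (simp add: state_residual_def right_diff_distrib state_diff[OF \<rho>] state_inner_combination[OF \<rho>])
  show "\<rho> (star (state_residual \<rho> k e v) * e p) = 0"
    using state_star[OF \<rho>, of "star (e p) * state_residual \<rho> k e v"] 1
      by (simp add: star_mult star_star)
qed

lemma state_residual_decompose:
  "v = state_residual \<rho> k e v + (\<Sum>p<k. scaleC (\<rho> (star (e p) * v)) (e p))"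
  by (simp add: state_residual_def)

lemma state_Pythagoras:
  assumes \<rho>: "cstar_state \<rho>" and e: "state_orthonormal \<rho> k e"
  shows "Re (\<rho> (star v * v)) = Re (\<rho> (star (state_residual \<rho> k e v) * state_residual \<rho> k e v))
    + (\<Sum>p<k. (cmod (\<rho> (star (e p) * v)))\<^sup>2)"
proof -
  let ?r = "state_residual \<rho> k e v"
  have "\<rho> (star v * v) = \<rho> (star v * ?r) + (\<Sum>p<k. \<rho> (star (e p) * v) * \<rho> (star v * e p))"
    by (subst (2) state_residual_decompose[of v \<rho> k e])
      (simp add: distrib_left state_add[OF \<rho>] state_inner_combination[OF \<rho>])
  moreover have "\<rho> (star v * e p) = cnj (\<rho> (star (e p) * v))" for p
    using state_star[OF \<rho>, of "star (e p) * v"] by (simp add: star_mult star_star)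
  moreover have "\<rho> (star v * ?r) = \<rho> (star ?r * ?r)"
  proof -
    have "\<rho> (star ?r * v) = \<rho> (star ?r * ?r)"
      using state_residual_orthogonal(2)[OF \<rho> e]
      by (subst (2) state_residual_decompose[of v \<rho> k e])
        (simp add: distrib_left state_add[OF \<rho>] state_inner_combination[OF \<rho>])
    then show ?thesis
      using state_star[OF \<rho>, of "star ?r * v"] state_star[OF \<rho>, of "star ?r * ?r"]
      by (simp add: star_mult star_star)
  qed
  ultimately show ?thesis by (simp add: complex_norm_square[symmetric])
qed

text \<open>Gram-Schmidt for the semi-inner product of \<rho>. The residuals of the vectors in S
  become null rather than zero, since \<rho> need not be faithful.\<close>

lemma exists_state_orthonormal:
  assumes \<rho>: "cstar_state \<rho>" and "finite S"
  obtains k e where "state_orthonormal \<rho> k e"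
    "\<And>v. v \<in> S \<Longrightarrow> \<rho> (star (state_residual \<rho> k e v) * state_residual \<rho> k e v) = 0"
  using \<open>finite S\<close>
proof (induction S arbitrary: thesis)
  case empty
  show ?case by (rule empty(1)[of 0 "\<lambda>_. 0"]) (auto simp: state_orthonormal_def)
next
  case (insert v S)
  obtain k e where e: "state_orthonormal \<rho> k e"
    and S: "\<And>u. u \<in> S \<Longrightarrow> \<rho> (star (state_residual \<rho> k e u) * state_residual \<rho> k e u) = 0"
    by (rule insert(3)) blast
  define w where "w = state_residual \<rho> k e v"
  define n where "n = sqrt (Re (\<rho> (star w * w)))"
  show ?case
  proof (cases "\<rho> (star w * w) = 0")
    case True
    then show ?thesis using insert.prems[of k e] e S w_def by auto
  next
    case False
    then have "Re (\<rho> (star w * w)) > 0"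
      using state_nonneg[OF \<rho>, of w] state_Im_zero[OF \<rho>, of w]
        by (auto simp: complex_eq_iff less_le)
    then have n: "n > 0" "\<rho> (star w * w) = of_real (n * n)"
      using state_Im_zero[OF \<rho>, of w] by (auto simp: n_def complex_eq_iff)
    \<comment> \<open>The normalized residual of the new vector is appended; a null residual was
      discarded in the other case.\<close>
    define e' where "e' = e(k := (1 / n) *\<^sub>R w)"
    have e'_k: "e' k = (1 / n) *\<^sub>R w" and e'_p: "\<And>p. p < k \<Longrightarrow> e' p = e p" by (auto simp: e'_def)
    have orth: "\<rho> (star (e p) * w) = 0" "\<rho> (star w * e p) = 0" if "p < k" for p
      using state_residual_orthogonal[OF \<rho> e that] by (auto simp: w_def)
    have sc: "\<rho> (star (e' k) * x) = \<rho> (star w * x) / n" "\<rho> (star x * e' k)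
        = \<rho> (star x * w) / n" for x
      by (simp_all add: e'_k star_scaleR state_scaleR[OF \<rho>] scaleR_conv_of_real divide_inverse mult.commute)
    have on: "state_orthonormal \<rho> (Suc k) e'" unfolding state_orthonormal_def
    proof (intro allI impI)
      fix p q assume "p < Suc k" "q < Suc k"
      then consider "p < k" "q < k" | "p = k" "q < k" | "p < k" "q = k" | "p = k" "q = k"
        by linarith
      then show "\<rho> (star (e' p) * e' q) = (if p = q then 1 else 0)"
      proof cases
        case 1
        then show ?thesis using e by (simp add: e'_p state_orthonormal_def)
      next
        case 2
        then show ?thesis using orth by (simp add: sc e'_p)
      next
        case 3
        then show ?thesis using orth by (simp add: sc e'_p)
      next
        case 4
        then show ?thesis using n by (simp only: sc) simp
      qed
    qed
    have res: "state_residual \<rho> (Suc k) e' u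
        = state_residual \<rho> k e u - scaleC (\<rho> (star w * u) / n) ((1 / n) *\<^sub>R w)" for u
      by (simp add: state_residual_def e'_p sc[of u]) (simp add: e'_k)
    have wu: "\<rho> (star w * u) = \<rho> (star w * state_residual \<rho> k e u)" for u
      by (subst state_residual_decompose[of u \<rho> k e])
        (simp add: distrib_left state_add[OF \<rho>] state_inner_combination[OF \<rho>] orth)
    show ?thesis
    proof (rule insert.prems[OF on])
      fix u assume "u \<in> insert v S"
      then consider "u = v" | "u \<in> S" by auto
      then show "\<rho> (star (state_residual \<rho> (Suc k) e' u) * state_residual \<rho> (Suc k) e' u) = 0"
      proof cases
        case 1
        have "\<rho> (star w * v) = of_real (n * n)" using wu[of v] n(2) by (simp add: w_def)
        then have "state_residual \<rho> (Suc k) e' v = 0"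
          using n(1) by (simp add: res w_def[symmetric] scaleC_of_real)
        then show ?thesis using 1 by (simp add: state_zero[OF \<rho>])
      next
        case 2
        then have "\<rho> (star w * u) = 0" unfolding wu[of u] by (intro state_null[OF \<rho> S])
        then show ?thesis using S[OF 2] by (simp add: res)
      qed
    qed
  qed
qed

text \<open>The null residual of v stays invisible after left multiplication by x, because x can be
  moved to the other argument as \<open>star x\<close>.\<close>

lemma state_expand:
  assumes \<rho>: "cstar_state \<rho>" and null: "\<rho> (star (state_residual \<rho> k e v) * state_residual \<rho> k e v) = 0"
  shows "\<rho> (star y * (x * v)) = (\<Sum>p<k. \<rho> (star (e p) * v) * \<rho> (star y * (x * e p)))"
proof -
  have "\<rho> (star (star x * y) * v) = \<rho> (star (star x * y) * state_residual \<rho> k e v)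
      + (\<Sum>p<k. \<rho> (star (e p) * v) * \<rho> (star (star x * y) * e p))"
    by (subst state_residual_decompose[of v \<rho> k e])
      (simp add: distrib_left state_add[OF \<rho>] state_inner_combination[OF \<rho>])
  then show ?thesis using state_null(1)[OF \<rho> null, of "star x * y"]
    by (simp add: star_mult star_star mult.assoc)
qed

section \<open>Schur multiplication by completely bounded multipliers\<close>

text \<open>A constant, because the simplification rules of the locale would loop for a literal identity.\<close>

definition trivial_action :: "'g \<Rightarrow> complex \<Rightarrow> complex" where
  "trivial_action = (\<lambda>_ z. z)"

lemma trivial_action_apply [simp]: "trivial_action s z = z"
  by (simp add: trivial_action_def)

interpretation scalar: cstar_dynamics "trivial_action :: 'g::group_add \<Rightarrow> complex \<Rightarrow> complex"
  by unfold_locales (simp add: cstar_action_def star_hom_def)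

lemma cstar_state_complex: "cstar_state (\<lambda>z::complex. z)"
  by (simp add: cstar_state_def scaleC_complex_def star_complex_def)

lemma complex_ell2_norm_has_sum:
  fixes \<xi> :: "'g \<Rightarrow> complex"
  assumes "\<xi> \<in> ell2"
  shows "((\<lambda>t. (cmod (\<xi> t))\<^sup>2) has_sum (ell2_norm \<xi>)\<^sup>2) UNIV"
proof -
  have eq: "ell2_inner \<xi> \<xi> = of_real (state_square (\<lambda>z. z) \<xi>)"
    by (rule state_inner_real[OF cstar_state_complex assms])
  then have "(ell2_norm \<xi>)\<^sup>2 = state_square (\<lambda>z. z) \<xi>"
    using state_square_nonneg[OF cstar_state_complex assms] by (simp add: ell2_norm_square)
  moreover have "Re (star z * z) = (cmod z)\<^sup>2" for z :: complex
    by (simp add: star_complex_def cmod_power2) (simp add: power2_eq_square)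
  ultimately show ?thesis
    using state_square_has_sum[OF cstar_state_complex assms] by simp
qed

lemma op_cstar_subalgebra_group_algebra: "op_cstar_subalgebra reduced_group_algebra"
  unfolding reduced_group_algebra_def trivial_action_def[symmetric]
  by (rule scalar.op_cstar_subalgebra_reduced) (auto simp: cstar_subalgebra_def action_invariant_def)

lemma monomial_group_algebra: "scalar.monomial s z \<in> reduced_group_algebra"
  unfolding reduced_group_algebra_def trivial_action_def[symmetric]
    by (rule scalar.monomial_reduced) auto

lemma scalar_monomial_shift: "scalar.monomial s z = op_scale z (shift_op s)"
  by (rule extensionalityI[of _ ell2])
    (auto simp: scalar.monomial_def op_scale_def shift_op_def scaleC_complex_def)

lemma shift_op_group_algebra: "shift_op s \<in> reduced_group_algebra"
proof -
  have "shift_op s = scalar.monomial s 1"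
    by (auto simp: scalar.monomial_def shift_op_def intro!: restrict_ext)
  then show ?thesis using monomial_group_algebra by metis
qed

definition matrix_bound :: "'i set \<Rightarrow> ('i \<Rightarrow> 'i \<Rightarrow> complex) \<Rightarrow> real \<Rightarrow> bool" where
  "matrix_bound I X K \<longleftrightarrow>
    (\<forall>c. (\<Sum>a\<in>I. (cmod (\<Sum>b\<in>I. X a b * c b))\<^sup>2) \<le> K\<^sup>2 * (\<Sum>b\<in>I. (cmod (c b))\<^sup>2))"

text \<open>The Hilbert-Schmidt norm. Only finiteness of the bound matters: it is used to see that
  the set whose supremum is \<open>matrix_op_norm\<close> is bounded.\<close>

lemma exists_matrix_bound: "\<exists>K\<ge>0. matrix_bound I X K"
proof -
  let ?L = "\<Sum>a\<in>I. \<Sum>b\<in>I. (cmod (X a b))\<^sup>2"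
  have "matrix_bound I X (sqrt ?L)" unfolding matrix_bound_def
  proof
    fix c
    have "(\<Sum>a\<in>I. (cmod (\<Sum>b\<in>I. X a b * c b))\<^sup>2)
        \<le> (\<Sum>a\<in>I. (\<Sum>b\<in>I. (cmod (X a b))\<^sup>2) * (\<Sum>b\<in>I. (cmod (c b))\<^sup>2))"
    proof (rule sum_mono)
      fix a
      have "cmod (\<Sum>b\<in>I. X a b * c b) \<le> (\<Sum>b\<in>I. cmod (X a b) * cmod (c b))"
        using norm_sum[of "\<lambda>b. X a b * c b" I] by (simp add: norm_mult)
      then have "(cmod (\<Sum>b\<in>I. X a b * c b))\<^sup>2 \<le> (\<Sum>b\<in>I. cmod (X a b) * cmod (c b))\<^sup>2"
        by (intro power_mono) auto
      also have "\<dots> \<le> (\<Sum>b\<in>I. (cmod (X a b))\<^sup>2) * (\<Sum>b\<in>I. (cmod (c b))\<^sup>2)"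
        by (rule Cauchy_Schwarz_ineq_sum)
      finally show "(cmod (\<Sum>b\<in>I. X a b * c b))\<^sup>2
        \<le> (\<Sum>b\<in>I. (cmod (X a b))\<^sup>2) * (\<Sum>b\<in>I. (cmod (c b))\<^sup>2)" .
    qed
    also have "\<dots> = (sqrt ?L)\<^sup>2 * (\<Sum>b\<in>I. (cmod (c b))\<^sup>2)"
      by (simp add: sum_distrib_right sum_nonneg)
    finally show "(\<Sum>a\<in>I. (cmod (\<Sum>b\<in>I. X a b * c b))\<^sup>2) \<le> (sqrt ?L)\<^sup>2 * (\<Sum>b\<in>I. (cmod (c b))\<^sup>2)" .
  qed
  then show ?thesis by (intro exI[of _ "sqrt ?L"]) (simp add: sum_nonneg)
qed

lemma has_sum_finite_sum:
  fixes f :: "'i \<Rightarrow> 'a \<Rightarrow> 'b::topological_comm_monoid_add"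
  shows "(\<And>i. i \<in> I \<Longrightarrow> (f i has_sum s i) A) \<Longrightarrow> ((\<lambda>x. \<Sum>i\<in>I. f i x) has_sum (\<Sum>i\<in>I. s i)) A"
  by (induction I rule: infinite_finite_induct) (auto intro: has_sum_add)

text \<open>The matrix with entries \<open>X\<^sub>a\<^sub>b \<lambda>(\<tau>\<^sub>a - \<tau>\<^sub>b)\<close> is unitarily equivalent to \<open>X \<otimes> 1\<close>.\<close>

lemma shift_matrix_bound:
  fixes \<tau> :: "nat \<Rightarrow> 'g::group_add" and \<xi> :: "nat \<Rightarrow> 'g \<Rightarrow> complex"
  assumes X: "matrix_bound {..<N} X K" and K: "K \<ge> 0" and \<xi>: "\<And>j. j < N \<Longrightarrow> \<xi> j \<in> ell2"
  shows "sqrt (\<Sum>i<N. (ell2_norm (\<lambda>t. \<Sum>j<N. scalar.monomial (\<tau> i - \<tau> j) (X i j) (\<xi> j) t))\<^sup>2)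
    \<le> K * sqrt (\<Sum>j<N. (ell2_norm (\<xi> j))\<^sup>2)"
proof -
  let ?\<omega> = "\<lambda>i t. \<Sum>j<N. scalar.monomial (\<tau> i - \<tau> j) (X i j) (\<xi> j) t"
  have \<omega>_ell2: "?\<omega> i \<in> ell2" for i
    by (intro ell2_sum scalar.monomial_ell2 \<xi>) simp
  \<comment> \<open>In the coordinates translated by \<open>\<tau> i\<close> the shifts disappear
    and X acts pointwise in u.\<close>
  have \<omega>: "?\<omega> i (\<tau> i + u) = (\<Sum>j<N. X i j * \<xi> j (\<tau> j + u))" for i u
    using \<xi> by (intro sum.cong) (simp_all add: scalar.monomial_apply add.assoc[symmetric])
  have "((\<lambda>u. \<Sum>i<N. (cmod (?\<omega> i (\<tau> i + u)))\<^sup>2) has_sum (\<Sum>i<N. (ell2_norm (?\<omega> i))\<^sup>2)) UNIV"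
  proof (rule has_sum_finite_sum)
    fix i
    show "((\<lambda>u. (cmod (?\<omega> i (\<tau> i + u)))\<^sup>2) has_sum (ell2_norm (?\<omega> i))\<^sup>2) UNIV"
      using complex_ell2_norm_has_sum[OF scalar.ell2_translate[OF \<omega>_ell2[of i], of "\<tau> i"]]
      by (simp add: scalar.ell2_norm_translate[of "?\<omega> i"])
  qed
  moreover have "((\<lambda>u. K\<^sup>2 * (\<Sum>j<N. (cmod (\<xi> j (\<tau> j + u)))\<^sup>2)) has_sum K\<^sup>2 * (\<Sum>j<N. (ell2_norm (\<xi> j))\<^sup>2)) UNIV"
  proof (intro has_sum_cmult_right has_sum_finite_sum)
    fix j assume "j \<in> {..<N}"
    then show "((\<lambda>u. (cmod (\<xi> j (\<tau> j + u)))\<^sup>2) has_sum (ell2_norm (\<xi> j))\<^sup>2) UNIV"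
      using complex_ell2_norm_has_sum[OF scalar.ell2_translate[OF \<xi>, of j "\<tau> j"]]
      by (simp add: scalar.ell2_norm_translate)
  qed
  ultimately have "(\<Sum>i<N. (ell2_norm (?\<omega> i))\<^sup>2) \<le> K\<^sup>2 * (\<Sum>j<N. (ell2_norm (\<xi> j))\<^sup>2)"
    by (rule has_sum_mono) (use X in \<open>simp add: \<omega> matrix_bound_def\<close>)
  then have "sqrt (\<Sum>i<N. (ell2_norm (?\<omega> i))\<^sup>2) \<le> sqrt (K\<^sup>2 * (\<Sum>j<N. (ell2_norm (\<xi> j))\<^sup>2))"
    by (rule real_sqrt_le_mono)
  then show ?thesis using K by (simp add: real_sqrt_mult)
qed

lemma matrix_op_norm_le:
  assumes "\<And>\<xi>. (\<forall>j<n. \<xi> j \<in> ell2) \<Longrightarrow> sqrt (\<Sum>j<n. (ell2_norm (\<xi> j))\<^sup>2) \<le> 1 \<Longrightarrow>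
    sqrt (\<Sum>i<n. (ell2_norm (\<lambda>t. \<Sum>j<n. T i j (\<xi> j) t))\<^sup>2) \<le> K"
  shows "matrix_op_norm n T \<le> K"
  unfolding matrix_op_norm_def
proof (rule cSup_least)
  have "sqrt (\<Sum>i<n. (ell2_norm (\<lambda>t. \<Sum>j<n. T i j (\<lambda>_. 0) t))\<^sup>2) \<in>
    {sqrt (\<Sum>i<n. (ell2_norm (\<lambda>t. \<Sum>j<n. T i j (\<xi> j) t))\<^sup>2) | \<xi>.
      (\<forall>j<n. \<xi> j \<in> ell2) \<and> sqrt (\<Sum>j<n. (ell2_norm (\<xi> j))\<^sup>2) \<le> 1}"
    by (rule CollectI, rule exI[of _ "\<lambda>_ _. 0"]) simp
  then show "{sqrt (\<Sum>i<n. (ell2_norm (\<lambda>t. \<Sum>j<n. T i j (\<xi> j) t))\<^sup>2) | \<xi>.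
      (\<forall>j<n. \<xi> j \<in> ell2) \<and> sqrt (\<Sum>j<n. (ell2_norm (\<xi> j))\<^sup>2) \<le> 1} \<noteq> {}" by blast
qed (use assms in auto)

text \<open>One direction of the identification of completely bounded multipliers with Schur
  multipliers. The scalar matrix is placed in the matrices over the reduced group algebra, with the
  shift by \<open>\<tau> a - \<tau> b\<close> attached to the entry at a, b; the multiplier acts
  there, and the scalars are read off at point masses.\<close>

lemma multiplier_matrix_bound_nat:
  fixes \<phi> :: "'g::group_add \<Rightarrow> complex" and \<tau> :: "nat \<Rightarrow> 'g"
  assumes \<phi>: "\<phi> \<in> cb_multipliers" "cb_multiplier_norm \<phi> \<le> 1"
    and X: "matrix_bound {..<N} X K" and K: "K > 0"
  shows "matrix_bound {..<N} (\<lambda>a b. \<phi> (\<tau> a - \<tau> b) * X a b) K"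
proof -
  define M where "M = (SOME M. cb_multiplier_map \<phi> M)"
  have "\<exists>M. cb_multiplier_map \<phi> M" using \<phi>(1) by (simp add: cb_multipliers_def)
  then have "cb_multiplier_map \<phi> M" unfolding M_def by (rule someI_ex)
  then have M_scale: "\<And>z T. T \<in> reduced_group_algebra \<Longrightarrow> M (op_scale z T) = op_scale z (M T)"
    and M_shift: "\<And>s. M (shift_op s) = op_scale (\<phi> s) (shift_op s)"
    and M_bdd: "bdd_above (amplification_norms M)"
    by (simp_all add: cb_multiplier_map_def)
  \<comment> \<open>Division by K normalizes the matrix, since \<open>amplification_norms\<close>
    only tests matrices of norm at most 1.\<close>
  define T where "T a b = scalar.monomial (\<tau> a - \<tau> b) (X a b / K)" for a b
  define Y where "Y a b = \<phi> (\<tau> a - \<tau> b) * (X a b / K)" for a b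
  have MT: "M (T a b) = scalar.monomial (\<tau> a - \<tau> b) (Y a b)" for a b
  proof -
    have "M (T a b) = op_scale (X a b / K) (op_scale (\<phi> (\<tau> a - \<tau> b)) (shift_op (\<tau> a - \<tau> b)))"
      by (simp only: T_def scalar_monomial_shift M_scale[OF shift_op_group_algebra] M_shift)
    also have "\<dots> = scalar.monomial (\<tau> a - \<tau> b) (Y a b)"
      unfolding scalar_monomial_shift op_scale_def
      by (rule restrict_ext) (simp add: scaleC_complex_def Y_def mult_ac)
    finally show ?thesis .
  qed
  have X1: "matrix_bound {..<N} (\<lambda>a b. X a b / K) 1"
    unfolding matrix_bound_def
  proof
    fix c
    have "(\<Sum>a<N. (cmod (\<Sum>b<N. X a b / K * c b))\<^sup>2) = (\<Sum>a<N. (cmod (\<Sum>b<N. X a b * c b))\<^sup>2) / K\<^sup>2"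
      by (simp add: sum_divide_distrib[symmetric] norm_divide power_divide)
    also have "\<dots> \<le> (K\<^sup>2 * (\<Sum>b<N. (cmod (c b))\<^sup>2)) / K\<^sup>2"
      using X by (intro divide_right_mono) (auto simp: matrix_bound_def)
    finally show "(\<Sum>a<N. (cmod (\<Sum>b<N. X a b / K * c b))\<^sup>2) \<le> 1\<^sup>2 * (\<Sum>b<N. (cmod (c b))\<^sup>2)"
      using K by simp
  qed
  have "matrix_op_norm N T \<le> 1"
  proof (rule matrix_op_norm_le)
    fix \<xi> :: "nat \<Rightarrow> 'g \<Rightarrow> complex"
    assume "\<forall>j<N. \<xi> j \<in> ell2" "sqrt (\<Sum>j<N. (ell2_norm (\<xi> j))\<^sup>2) \<le> 1"
    then show "sqrt (\<Sum>i<N. (ell2_norm (\<lambda>t. \<Sum>j<N. T i j (\<xi> j) t))\<^sup>2) \<le> 1"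
      unfolding T_def using shift_matrix_bound[OF X1, of \<xi> \<tau>] by simp
  qed
  then have "matrix_op_norm N (\<lambda>i j. M (T i j)) \<in> amplification_norms M"
    unfolding amplification_norms_def
    by (intro CollectI exI[of _ N] exI[of _ T] conjI) (simp_all add: T_def monomial_group_algebra)
  then have "matrix_op_norm N (\<lambda>i j. M (T i j)) \<le> Sup (amplification_norms M)"
    using M_bdd by (intro cSup_upper)
  also have "\<dots> \<le> 1" using \<phi>(2) by (simp add: cb_multiplier_norm_def M_def)
  finally have norm1: "matrix_op_norm N (\<lambda>i j. M (T i j)) \<le> 1" .
  \<comment> \<open>Any finite L will do: it bounds the set in \<open>matrix_op_norm\<close>, so
    that its supremum really dominates the members.\<close>
  obtain L where L: "L \<ge> 0" "matrix_bound {..<N} Y L" using exists_matrix_bound by blast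
  let ?val = "\<lambda>\<xi>. sqrt (\<Sum>i<N. (ell2_norm (\<lambda>t. \<Sum>j<N. M (T i j) (\<xi> j) t))\<^sup>2)"
  have le1: "?val \<xi> \<le> 1" if \<xi>: "\<forall>j<N. \<xi> j \<in> ell2" "sqrt (\<Sum>j<N. (ell2_norm (\<xi> j))\<^sup>2) \<le> 1" for \<xi>
  proof -
    have "?val \<zeta> \<le> L" if "\<forall>j<N. \<zeta> j \<in> ell2" "sqrt (\<Sum>j<N. (ell2_norm (\<zeta> j))\<^sup>2) \<le> 1" for \<zeta>
      using shift_matrix_bound[OF L(2,1), of \<zeta> \<tau>] that mult_left_mono[OF that(2) L(1)]
        by (simp add: MT)
    then have "bdd_above {?val \<xi> | \<xi>. (\<forall>j<N. \<xi> j \<in> ell2) \<and> sqrt (\<Sum>j<N. (ell2_norm (\<xi> j))\<^sup>2) \<le> 1}"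
      by (intro bdd_aboveI[of _ L]) blast
    then have "?val \<xi> \<le> matrix_op_norm N (\<lambda>i j. M (T i j))"
      unfolding matrix_op_norm_def using \<xi> by (intro cSup_upper) blast+
    then show ?thesis using norm1 by (rule order_trans)
  qed
  have unit: "(\<Sum>a<N. (cmod (\<Sum>b<N. Y a b * c b))\<^sup>2) \<le> 1" if c: "(\<Sum>b<N. (cmod (c b))\<^sup>2) \<le> 1" for c
  proof -
    \<comment> \<open>The shift by \<open>\<tau> a - \<tau> b\<close> carries the point mass at
      \<open>\<tau> b\<close> to the one at \<open>\<tau> a\<close>, so evaluating at
      \<open>\<tau> a\<close> returns the row sum of Y.\<close>
    let ?\<xi> = "\<lambda>b. ell2_single (\<tau> b) (c b)"
    let ?\<omega> = "\<lambda>a t. \<Sum>b<N. M (T a b) (?\<xi> b) t"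
    have "?\<omega> a (\<tau> a) = (\<Sum>b<N. Y a b * c b)" for a
      by (intro sum.cong) (simp_all add: MT scalar.monomial_apply, simp add: ell2_single_def)
    moreover have "?\<omega> a \<in> ell2" for a
      unfolding MT by (intro ell2_sum scalar.monomial_ell2 ell2_single)
    ultimately have "cmod (\<Sum>b<N. Y a b * c b) \<le> ell2_norm (?\<omega> a)" for a
      using norm_le_ell2_norm[of "?\<omega> a" "\<tau> a"] by simp
    then have "(\<Sum>a<N. (cmod (\<Sum>b<N. Y a b * c b))\<^sup>2) \<le> (\<Sum>a<N. (ell2_norm (?\<omega> a))\<^sup>2)"
      by (intro sum_mono power_mono) auto
    also have "\<dots> \<le> 1" using le1[of ?\<xi>] c by simp
    finally show ?thesis .
  qed
  show ?thesis unfolding matrix_bound_def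
  proof
    fix c
    define n where "n = sqrt (\<Sum>b<N. (cmod (c b))\<^sup>2)"
    have n2: "n\<^sup>2 = (\<Sum>b<N. (cmod (c b))\<^sup>2)" by (simp add: n_def sum_nonneg)
    show "(\<Sum>a<N. (cmod (\<Sum>b<N. \<phi> (\<tau> a - \<tau> b) * X a b * c b))\<^sup>2) \<le> K\<^sup>2 * (\<Sum>b<N. (cmod (c b))\<^sup>2)"
    proof (cases "n = 0")
      case True
      then have "\<And>b. b < N \<Longrightarrow> c b = 0" using n2 by (simp add: sum_nonneg_eq_0_iff)
      then show ?thesis by simp
    next
      case False
      have "(\<Sum>b<N. (cmod (c b / n))\<^sup>2) = n\<^sup>2 / n\<^sup>2"
        by (simp add: norm_divide power_divide sum_divide_distrib[symmetric] n2)
      then have "(\<Sum>a<N. (cmod (\<Sum>b<N. Y a b * (c b / n)))\<^sup>2) \<le> 1" using False by (intro unit) simp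
      moreover have "(\<Sum>b<N. Y a b * (c b / n)) = (\<Sum>b<N. \<phi> (\<tau> a - \<tau> b) * X a b * c b) / (K * n)" for a
        by (simp add: Y_def sum_divide_distrib)
      then have "(\<Sum>a<N. (cmod (\<Sum>b<N. Y a b * (c b / n)))\<^sup>2)
          = (\<Sum>a<N. (cmod (\<Sum>b<N. \<phi> (\<tau> a - \<tau> b) * X a b * c b))\<^sup>2) / (K\<^sup>2 * n\<^sup>2)"
        by (simp add: norm_divide norm_mult power_divide power_mult_distrib sum_divide_distrib[symmetric])
      ultimately show ?thesis using K False by (simp add: divide_le_eq n2[symmetric])
    qed
  qed
qed

text \<open>Transport along an enumeration of I. It is applied to pairs of a group element and a
  basis index.\<close>

lemma multiplier_matrix_bound:
  fixes \<phi> :: "'g::group_add \<Rightarrow> complex" and \<tau> :: "'i \<Rightarrow> 'g"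
  assumes \<phi>: "\<phi> \<in> cb_multipliers" "cb_multiplier_norm \<phi> \<le> 1"
    and X: "matrix_bound I X K" and K: "K > 0" and I: "finite I"
  shows "matrix_bound I (\<lambda>a b. \<phi> (\<tau> a - \<tau> b) * X a b) K"
proof -
  obtain h where h: "bij_betw h {0..<card I} I" using ex_bij_betw_nat_finite[OF I] by blast
  then have h: "bij_betw h {..<card I} I" by (simp add: lessThan_atLeast0)
  have re: "(\<Sum>a\<in>I. f a) = (\<Sum>a<card I. f (h a))" for f :: "'i \<Rightarrow> 'c::comm_monoid_add"
    by (rule sum.reindex_bij_betw[OF h, symmetric])

  have "matrix_bound {..<card I} (\<lambda>a b. X (h a) (h b)) K"
    unfolding matrix_bound_def
  proof
    fix c :: "nat \<Rightarrow> complex"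
    let ?c = "\<lambda>i. c (the_inv_into {..<card I} h i)"
    have c: "?c (h b) = c b" if "b < card I" for b
      using h that by (simp add: bij_betw_def the_inv_into_f_f)
    have "(\<Sum>a<card I. (cmod (\<Sum>b<card I. X (h a) (h b) * ?c (h b)))\<^sup>2)
        \<le> K\<^sup>2 * (\<Sum>b<card I. (cmod (?c (h b)))\<^sup>2)"
      using X[unfolded matrix_bound_def, rule_format, of ?c] unfolding re .
    then show "(\<Sum>a<card I. (cmod (\<Sum>b<card I. X (h a) (h b) * c b))\<^sup>2)
        \<le> K\<^sup>2 * (\<Sum>b<card I. (cmod (c b))\<^sup>2)"
      by (simp add: c cong: sum.cong_simp)
  qed
  note * = multiplier_matrix_bound_nat[OF \<phi> this K, of "\<lambda>a. \<tau> (h a)", unfolded matrix_bound_def]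
  show ?thesis unfolding matrix_bound_def re
  proof
    fix c
    show "(\<Sum>a<card I. (cmod (\<Sum>b<card I. \<phi> (\<tau> (h a) - \<tau> (h b)) * X (h a) (h b) * c (h b)))\<^sup>2)
      \<le> K\<^sup>2 * (\<Sum>b<card I. (cmod (c (h b)))\<^sup>2)"
      by (rule *[rule_format, of "\<lambda>b. c (h b)"])
  qed
qed

text \<open>The Fourier multiplier \<phi> on finite sums. A constant \<phi> gives multiplication by
  a complex scalar.\<close>

definition pm_scale :: "('g \<Rightarrow> complex) \<Rightarrow> ('g \<Rightarrow>\<^sub>0 'b::cstar_algebra) \<Rightarrow> 'g \<Rightarrow>\<^sub>0 'b" where
  "pm_scale \<phi> d = Abs_poly_mapping (\<lambda>s. scaleC (\<phi> s) (Poly_Mapping.lookup d s))"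

lemma lookup_pm_scale [simp]: "Poly_Mapping.lookup (pm_scale \<phi> d) s
    = scaleC (\<phi> s) (Poly_Mapping.lookup d s)"
proof -
  have "finite {s. scaleC (\<phi> s) (Poly_Mapping.lookup d s) \<noteq> 0}"
    by (rule finite_subset[OF _ finite_keys[of d]]) (auto simp: in_keys_iff)
  then show ?thesis unfolding pm_scale_def by (simp add: lookup_Abs_poly_mapping)
qed

section \<open>Multipliers acting contractively on finite sums in the crossed product\<close>

context cstar_dynamics
begin

text \<open>Substituting s = t - u turns the twisted convolution into an operator matrix with rows t
  and columns u, the form on which a Schur multiplier acts; H collects the columns that
  contribute.\<close>

lemma cp_op_matrix:
  assumes \<xi>: "\<xi> \<in> ell2" and H: "finite H" "\<And>u. Poly_Mapping.lookup d (t - u) \<noteq> 0 \<Longrightarrow> \<xi> u \<noteq> 0 \<Longrightarrow> u \<in> H"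
  shows "cp_op d \<xi> t = (\<Sum>u\<in>H. \<alpha> (- t) (Poly_Mapping.lookup d (t - u)) * \<xi> u)"
proof -
  let ?K = "Poly_Mapping.keys d \<union> (\<lambda>u. t - u) ` H"
  have "cp_op d \<xi> t = (\<Sum>s\<in>?K. \<alpha> (- t) (Poly_Mapping.lookup d s) * \<xi> (- s + t))"
    using \<xi> H(1) by (simp add: cp_op_superset[of ?K] monomial_apply)
  also have "\<dots> = (\<Sum>s\<in>(\<lambda>u. t - u) ` H. \<alpha> (- t) (Poly_Mapping.lookup d s) * \<xi> (- s + t))"
  proof (rule sum.mono_neutral_right)
    show "\<forall>s\<in>?K - (\<lambda>u. t - u) ` H. \<alpha> (- t) (Poly_Mapping.lookup d s) * \<xi> (- s + t) = 0"
    proof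
      fix s assume s: "s \<in> ?K - (\<lambda>u. t - u) ` H"
      have "t - (- s + t) = s" by (simp add: diff_conv_add_uminus minus_add add.assoc[symmetric])
      then have "- s + t \<notin> H" using s by (metis DiffD2 imageI)
      then have "Poly_Mapping.lookup d s = 0 \<or> \<xi> (- s + t) = 0"
        using H(2)[of "- s + t"] \<open>t - (- s + t) = s\<close> by metis
      then show "\<alpha> (- t) (Poly_Mapping.lookup d s) * \<xi> (- s + t) = 0" by auto
    qed
  qed (use H in auto)
  also have "\<dots> = (\<Sum>u\<in>H. \<alpha> (- t) (Poly_Mapping.lookup d (t - u)) * \<xi> (- (t - u) + t))"
  proof (rule sum.reindex[unfolded o_def])
    show "inj_on (\<lambda>u. t - u) H" by (rule inj_onI) (metis minus_diff_eq diff_add_cancel)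
  qed
  finally show ?thesis by simp
qed

text \<open>Finitely many rows F see finitely many columns H. In an orthonormal system for \<rho>
  adapted to the finitely many module values involved, the operator matrix becomes a scalar matrix X
  indexed by pairs, bounded by K. The factor \<phi> depends only on the group components, so
  \<open>multiplier_matrix_bound\<close> applies with \<open>fst\<close> as \<tau>.\<close>

lemma state_square_multiplier_le:
  assumes \<phi>: "\<phi> \<in> cb_multipliers" "cb_multiplier_norm \<phi> \<le> 1"
    and \<rho>: "cstar_state \<rho>" and \<xi>: "\<xi> \<in> ell2" and K: "K > 0" "op_norm (cp_op d) \<le> K"
  shows "state_square \<rho> (cp_op (pm_scale \<phi> d) \<xi>) \<le> K\<^sup>2 * state_square \<rho> \<xi>"
proof -
  let ?\<omega> = "cp_op (pm_scale \<phi> d) \<xi>"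
  have \<omega>: "?\<omega> \<in> ell2" by (rule adjointable_ell2[OF cp_op_adjointable \<xi>])
  have "(\<Sum>t\<in>F. Re (\<rho> (star (?\<omega> t) * ?\<omega> t))) \<le> K\<^sup>2 * state_square \<rho> \<xi>" if F: "finite F" for F
  proof -
    \<comment> \<open>F is included so that rows and columns run through one index set, as
      \<open>matrix_bound\<close> demands.\<close>
    define H where "H = F \<union> (\<Union>t\<in>F. (\<lambda>s. - s + t) ` Poly_Mapping.keys d)"
    have H: "finite H" "F \<subseteq> H" using F by (auto simp: H_def)
    have H_col: "u \<in> H" if "t \<in> F" "Poly_Mapping.lookup d (t - u) \<noteq> 0" for t u
    proof -
      have "u = - (t - u) + t" by simp
      then show ?thesis using that unfolding H_def in_keys_iff[symmetric] by blast
    qed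
    define x where "x t u = \<alpha> (- t) (Poly_Mapping.lookup d (t - u))" for t u
    have \<omega>_eq: "?\<omega> t = (\<Sum>u\<in>H. scaleC (\<phi> (t - u)) (x t u * \<xi> u))" if "t \<in> F" for t
    proof -
      have "?\<omega> t = (\<Sum>u\<in>H. \<alpha> (- t) (Poly_Mapping.lookup (pm_scale \<phi> d) (t - u)) * \<xi> u)"
      proof (rule cp_op_matrix[OF \<xi> H(1)])
        fix u assume "Poly_Mapping.lookup (pm_scale \<phi> d) (t - u) \<noteq> 0"
        then show "u \<in> H" by (intro H_col[OF that]) auto
      qed
      then show ?thesis by (simp add: x_def act_scaleC mult_scaleC_left)
    qed
    obtain k e where e: "state_orthonormal \<rho> k e"
      and null: "\<And>v. v \<in> \<xi> ` H \<union> ?\<omega> ` F \<Longrightarrow>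
        \<rho> (star (state_residual \<rho> k e v) * state_residual \<rho> k e v) = 0"
      by (rule exists_state_orthonormal[OF \<rho>, of "\<xi> ` H \<union> ?\<omega> ` F"]) (use H F in auto)
    define X where "X a b = \<rho> (star (e (snd a)) * (x (fst a) (fst b) * e (snd b)))" for a b
    let ?I = "H \<times> {..<k}"
    have Bessel: "(\<Sum>p<k. (cmod (\<rho> (star (e p) * v)))\<^sup>2) \<le> Re (\<rho> (star v * v))" for v
      using state_Pythagoras[OF \<rho> e, of v] state_nonneg[OF \<rho>, of "state_residual \<rho> k e v"] by simp
    have X: "matrix_bound ?I X K" unfolding matrix_bound_def
    proof
      fix c :: "'g \<times> nat \<Rightarrow> complex"
      \<comment> \<open>The scalar vector c is realized by an element of the module with the same
        norm at \<rho>; X, a compression of \<open>cp_op d\<close>, then inherits its bound by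
        Bessel's inequality.\<close>
      define \<eta> where "\<eta> u = (if u \<in> H then \<Sum>q<k. scaleC (c (u, q)) (e q) else 0)" for u
      have \<eta>: "\<eta> \<in> ell2"
        by (rule ell2_finite_support, rule finite_subset[OF _ H(1)]) (auto simp: \<eta>_def)
      have \<zeta>: "cp_op d \<eta> \<in> ell2" by (rule adjointable_ell2[OF cp_op_adjointable \<eta>])
      have \<zeta>_eq: "cp_op d \<eta> t = (\<Sum>u\<in>H. x t u * \<eta> u)" for t
        unfolding x_def by (rule cp_op_matrix[OF \<eta> H(1)]) (auto simp: \<eta>_def split: if_splits)
      have entry: "(\<Sum>b\<in>?I. X (t, p) b * c b) = \<rho> (star (e p) * cp_op d \<eta> t)" for t p
      proof -
        have "\<rho> (star (e p) * cp_op d \<eta> t) = (\<Sum>u\<in>H. \<rho> (star (star (x t u) * e p) * \<eta> u))"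
          by (simp add: \<zeta>_eq sum_distrib_left state_sum[OF \<rho>] star_mult star_star mult.assoc)
        also have "\<dots> = (\<Sum>u\<in>H. \<Sum>q<k. c (u, q) * \<rho> (star (star (x t u) * e p) * e q))"
          by (intro sum.cong) (simp_all add: \<eta>_def state_inner_combination[OF \<rho>])
        also have "\<dots> = (\<Sum>b\<in>?I. X (t, p) b * c b)"
          by (simp add: sum.cartesian_product X_def star_mult star_star mult.assoc mult.commute case_prod_beta)
        finally show ?thesis by simp
      qed
      have \<eta>_norm: "state_square \<rho> \<eta> = (\<Sum>b\<in>?I. (cmod (c b))\<^sup>2)"
      proof -
        have "\<rho> (star (\<eta> u) * \<eta> u) = (\<Sum>q<k. c (u, q) * cnj (c (u, q)))" if "u \<in> H" for u
        proof -
          have "\<rho> (star (e p) * \<eta> u) = c (u, p)" if p: "p < k" for p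
          proof -
            have "\<rho> (star (e p) * \<eta> u) = (\<Sum>q<k. c (u, q) * \<rho> (star (e p) * e q))"
              using \<open>u \<in> H\<close> by (simp add: \<eta>_def state_inner_combination[OF \<rho>])
            also have "\<dots> = (\<Sum>q<k. if q = p then c (u, q) else 0)"
              using e p by (intro sum.cong) (auto simp: state_orthonormal_def)
            finally show ?thesis using p by simp
          qed
          then have "\<rho> (star (\<eta> u) * e p) = cnj (c (u, p))" if "p < k" for p
            using state_star[OF \<rho>, of "star (e p) * \<eta> u"] that by (simp add: star_mult star_star)
          moreover have "\<rho> (star (\<eta> u) * \<eta> u) = (\<Sum>q<k. c (u, q) * \<rho> (star (\<eta> u) * e q))"
          proof -
            have "\<eta> u = (\<Sum>q<k. scaleC (c (u, q)) (e q))" using \<open>u \<in> H\<close> by (simp add: \<eta>_def)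
            then show ?thesis using state_inner_combination[OF \<rho>, of "\<eta> u" "\<lambda>q. c (u, q)" e k]
              by metis
          qed
          ultimately show ?thesis by simp
        qed
        then have sq: "Re (\<rho> (star (\<eta> u) * \<eta> u)) = (\<Sum>q<k. (cmod (c (u, q)))\<^sup>2)" if "u \<in> H" for u
          using that by (simp add: complex_norm_square[symmetric])
        have "((\<lambda>t. Re (\<rho> (star (\<eta> t) * \<eta> t))) has_sum (\<Sum>t\<in>H. Re (\<rho> (star (\<eta> t) * \<eta> t)))) UNIV"
          by (rule has_sum_finite_neutralI[OF H(1)]) (auto simp: \<eta>_def state_zero[OF \<rho>])
        then have "state_square \<rho> \<eta> = (\<Sum>t\<in>H. Re (\<rho> (star (\<eta> t) * \<eta> t)))"
          using state_square_has_sum[OF \<rho> \<eta>] has_sum_unique by blast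
        then show ?thesis by (simp add: sq sum.cartesian_product)
      qed
      have "(\<Sum>a\<in>?I. (cmod (\<Sum>b\<in>?I. X a b * c b))\<^sup>2)
          = (\<Sum>t\<in>H. \<Sum>p<k. (cmod (\<rho> (star (e p) * cp_op d \<eta> t)))\<^sup>2)"
        by (simp add: sum.cartesian_product entry[symmetric] case_prod_beta)
      also have "\<dots> \<le> (\<Sum>t\<in>H. Re (\<rho> (star (cp_op d \<eta> t) * cp_op d \<eta> t)))"
        by (intro sum_mono Bessel)
      also have "\<dots> \<le> state_square \<rho> (cp_op d \<eta>)" by (rule state_square_sum_le[OF \<rho> \<zeta> H(1)])
      also have "\<dots> \<le> (op_norm (cp_op d))\<^sup>2 * state_square \<rho> \<eta>"
        by (rule state_square_adjointable_le[OF cp_op_adjointable \<rho> \<eta>])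
      also have "\<dots> \<le> K\<^sup>2 * state_square \<rho> \<eta>"
        by (intro mult_right_mono power_mono K op_norm_nonneg cp_op_adjointable state_square_nonneg \<rho> \<eta>)
      finally show "(\<Sum>a\<in>?I. (cmod (\<Sum>b\<in>?I. X a b * c b))\<^sup>2) \<le> K\<^sup>2 * (\<Sum>b\<in>?I. (cmod (c b))\<^sup>2)"
        unfolding \<eta>_norm .
    qed
    define c where "c b = \<rho> (star (e (snd b)) * \<xi> (fst b))" for b
    have Y: "(\<Sum>b\<in>?I. \<phi> (t - fst b) * X (t, p) b * c b) = \<rho> (star (e p) * ?\<omega> t)" if t:
        "t \<in> F" for t p
    proof -
      have "\<rho> (star (e p) * ?\<omega> t) = (\<Sum>u\<in>H. \<phi> (t - u) * \<rho> (star (e p) * (x t u * \<xi> u)))"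
        by (simp add: \<omega>_eq[OF t] sum_distrib_left mult_scaleC_right state_sum[OF \<rho>] state_scaleC[OF \<rho>])
      also have "\<dots> = (\<Sum>u\<in>H. \<Sum>q<k. \<phi> (t - u) * X (t, p) (u, q) * c (u, q))"
      proof (rule sum.cong[OF refl])
        fix u assume "u \<in> H"
        then have "\<rho> (star (e p) * (x t u * \<xi> u)) = (\<Sum>q<k. \<rho> (star (e q) * \<xi> u) * \<rho> (star (e p) * (x t u * e q)))"
          by (intro state_expand[OF \<rho> null]) auto
        then show "\<phi> (t - u) * \<rho> (star (e p) * (x t u * \<xi> u))
            = (\<Sum>q<k. \<phi> (t - u) * X (t, p) (u, q) * c (u, q))"
          by (simp add: sum_distrib_left X_def c_def mult_ac)
      qed
      also have "\<dots> = (\<Sum>b\<in>?I. \<phi> (t - fst b) * X (t, p) b * c b)"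
        by (simp add: sum.cartesian_product case_prod_beta)
      finally show ?thesis by simp
    qed
    \<comment> \<open>Bessel's inequality is an equality here, as the values of
      \<open>?\<omega>\<close> on F have null residuals.\<close>
    have "(\<Sum>t\<in>F. Re (\<rho> (star (?\<omega> t) * ?\<omega> t))) = (\<Sum>t\<in>F. \<Sum>p<k. (cmod (\<rho> (star (e p) * ?\<omega> t)))\<^sup>2)"
      using null by (intro sum.cong refl) (simp add: state_Pythagoras[OF \<rho> e])
    also have "\<dots> = (\<Sum>a\<in>F \<times> {..<k}. (cmod (\<Sum>b\<in>?I. \<phi> (fst a - fst b) * X a b * c b))\<^sup>2)"
      by (simp add: sum.cartesian_product Y[symmetric] case_prod_beta)
    also have "\<dots> \<le> (\<Sum>a\<in>?I. (cmod (\<Sum>b\<in>?I. \<phi> (fst a - fst b) * X a b * c b))\<^sup>2)"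
      using H by (intro sum_mono2) auto
    also have "\<dots> \<le> K\<^sup>2 * (\<Sum>b\<in>?I. (cmod (c b))\<^sup>2)"
      using multiplier_matrix_bound[OF \<phi> X K(1), of fst] H(1) by (simp add: matrix_bound_def)
    also have "(\<Sum>b\<in>?I. (cmod (c b))\<^sup>2) = (\<Sum>u\<in>H. \<Sum>q<k. (cmod (\<rho> (star (e q) * \<xi> u)))\<^sup>2)"
      by (simp add: sum.cartesian_product c_def case_prod_beta)
    also have "K\<^sup>2 * \<dots> \<le> K\<^sup>2 * state_square \<rho> \<xi>"
      by (intro mult_left_mono order_trans[OF sum_mono[OF Bessel] state_square_sum_le[OF \<rho> \<xi> H(1)]]) simp
    finally show ?thesis .
  qed
  then show ?thesis
    by (intro has_sum_le_finite_sums[OF state_square_has_sum[OF \<rho> \<omega>]]) auto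
qed

theorem op_norm_multiplier_le:
  assumes \<phi>: "\<phi> \<in> cb_multipliers" "cb_multiplier_norm \<phi> \<le> 1"
  shows "op_norm (cp_op (pm_scale \<phi> d)) \<le> op_norm (cp_op d)"
proof (rule field_le_epsilon)
  fix \<epsilon> :: real assume "\<epsilon> > 0"
  \<comment> \<open>The excess \<epsilon> makes K positive even if the operator is zero.\<close>
  define K where "K = op_norm (cp_op d) + \<epsilon>"
  have K: "K > 0" "op_norm (cp_op d) \<le> K"
    using op_norm_nonneg[OF cp_op_adjointable, of d] \<open>\<epsilon> > 0\<close> by (auto simp: K_def)
  show "op_norm (cp_op (pm_scale \<phi> d)) \<le> K"
  proof (rule op_norm_le)
    fix \<xi> :: "'g \<Rightarrow> 'b" assume \<xi>: "\<xi> \<in> ell2"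
    show "ell2_norm (cp_op (pm_scale \<phi> d) \<xi>) \<le> K * ell2_norm \<xi>"
    proof (rule ell2_norm_le_states)
      fix \<rho> :: "'b \<Rightarrow> complex" assume \<rho>: "cstar_state \<rho>"
      have "state_square \<rho> (cp_op (pm_scale \<phi> d) \<xi>) \<le> K\<^sup>2 * state_square \<rho> \<xi>"
        by (rule state_square_multiplier_le[OF \<phi> \<rho> \<xi> K])
      also have "\<dots> \<le> K\<^sup>2 * (ell2_norm \<xi>)\<^sup>2" by (intro mult_left_mono state_square_le_norm \<rho>) simp
      finally show "state_square \<rho> (cp_op (pm_scale \<phi> d) \<xi>) \<le> (K * ell2_norm \<xi>)\<^sup>2"
        by (simp add: power_mult_distrib)
    qed (use K in \<open>simp_all add: adjointable_ell2[OF cp_op_adjointable \<xi>]\<close>)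
  qed (use K in simp)
qed

end

section \<open>The approximation property\<close>

lemma op_zero_eq_iff:
  assumes "T \<in> adjointable" shows "op_norm T = 0 \<longleftrightarrow> T = op_zero"
proof
  assume 0: "op_norm T = 0"
  show "T = op_zero"
  proof (rule extensionalityI[of _ ell2])
    show "T \<in> extensional ell2" using assms by (auto simp: adjointable_def PiE_def)
    show "op_zero \<in> extensional ell2" by (simp add: op_zero_def)
    fix \<xi> :: "'a \<Rightarrow> 'b" assume \<xi>: "\<xi> \<in> ell2"
    have "ell2_norm (T \<xi>) = 0" using op_norm_bound[OF assms \<xi>] 0 ell2_norm_nonneg[of "T \<xi>"] by simp
    then show "T \<xi> = op_zero \<xi>" using ell2_norm_eq_zero[OF adjointable_ell2[OF assms \<xi>]] \<xi> by auto
  qed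
next
  assume "T = op_zero"
  then show "op_norm T = 0" using op_norm_diff_self[of op_zero]
    by (simp add: op_diff_def op_zero_def cong: restrict_cong)
qed

lemma matrix_op_norm_one: "matrix_op_norm 1 (\<lambda>i j. T) = op_norm T"
proof -
  have "{sqrt (\<Sum>i<1::nat. (ell2_norm (\<lambda>t. \<Sum>j<1::nat. T (\<xi> j) t))\<^sup>2) | \<xi>.
      (\<forall>j<1. \<xi> j \<in> ell2) \<and> sqrt (\<Sum>j<1. (ell2_norm (\<xi> j))\<^sup>2) \<le> 1}
    = {ell2_norm (T \<xi>) | \<xi>. \<xi> \<in> ell2 \<and> ell2_norm \<xi> \<le> 1}" (is "?L = ?R")
  proof
    show "?L \<subseteq> ?R" by auto
    show "?R \<subseteq> ?L"
    proof
      fix x assume "x \<in> ?R"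
      then obtain \<zeta> where "\<zeta> \<in> ell2" "ell2_norm \<zeta> \<le> 1" "x = ell2_norm (T \<zeta>)" by auto
      then show "x \<in> ?L" by (intro CollectI exI[of _ "\<lambda>_. \<zeta>"]) simp
    qed
  qed
  then show ?thesis by (simp only: matrix_op_norm_def op_norm_def)
qed

lemma group_algebra_adjointable: "T \<in> reduced_group_algebra \<Longrightarrow> T \<in> adjointable"
  by (simp add: reduced_group_algebra_def reduced_crossed_product_def)

text \<open>The norm of a multiplier is defined through a chosen map, so for the multiplier 0 every
  admissible map must be identified. It vanishes on finite sums, and the bound given by
  amplifications of size 1 extends this by density.\<close>

lemma multiplier_map_zero:
  assumes M: "cb_multiplier_map (\<lambda>_::'g::group_add. 0) M" and T: "T \<in> reduced_group_algebra"
  shows "M T = op_zero"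
proof -
  have M_in: "\<And>T. T \<in> reduced_group_algebra \<Longrightarrow> M T \<in> reduced_group_algebra"
    and M_add: "\<And>S T. S \<in> reduced_group_algebra \<Longrightarrow> T \<in> reduced_group_algebra \<Longrightarrow>
      M (op_add S T) = op_add (M S) (M T)"
    and M_scale: "\<And>z T. T \<in> reduced_group_algebra \<Longrightarrow> M (op_scale z T) = op_scale z (M T)"
    and M_shift: "\<And>s. M (shift_op s) = op_scale 0 (shift_op s)"
    and M_bdd: "bdd_above (amplification_norms M)"
    using M by (auto simp: cb_multiplier_map_def)
  have alg: "op_zero \<in> (reduced_group_algebra :: ('g, complex) op set)"
    "\<And>S T. S \<in> reduced_group_algebra \<Longrightarrow> T \<in> reduced_group_algebra \<Longrightarrow>
      op_add S T \<in> (reduced_group_algebra :: ('g, complex) op set)"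
    "\<And>z T. T \<in> reduced_group_algebra \<Longrightarrow> op_scale z T \<in> (reduced_group_algebra :: ('g, complex) op set)"
    using op_cstar_subalgebra_group_algebra by (auto simp: op_cstar_subalgebra_def)
  have scale0: "op_scale 0 T = op_zero" for T :: "('g, complex) op"
    by (simp add: op_scale_def op_zero_def)
  have scale_zero: "op_scale z op_zero = (op_zero :: ('g, complex) op)" for z
    unfolding op_scale_def op_zero_def by (rule restrict_ext) simp
  have add_zero: "op_add op_zero T = T" if "T \<in> adjointable" for T :: "('g, complex) op"
  proof (rule extensionalityI[of _ ell2])
    show "T \<in> extensional ell2" using that by (auto simp: adjointable_def PiE_def)
  qed (simp_all, simp add: op_add_def)
  have M0: "M op_zero = op_zero"
    using M_scale[OF alg(1), of 0] by (simp only: scale0)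
  have Mm: "M (scalar.monomial s z) = op_zero" for s z
    by (simp only: scalar_monomial_shift M_scale[OF shift_op_group_algebra] M_shift scale0 scale_zero)
  have cp: "scalar.cp_op d \<in> (reduced_group_algebra :: ('g, complex) op set)" for d
    by (rule scalar.cp_op_induct[of d UNIV]) (auto intro: alg monomial_group_algebra)
  have Mcp: "M (scalar.cp_op d) = op_zero" for d
  proof (rule scalar.cp_op_induct[of d UNIV])
    fix s b e assume "M (scalar.cp_op e) = op_zero"
    then show "M (op_add (scalar.monomial s b) (scalar.cp_op e)) = op_zero"
      by (simp add: M_add[OF monomial_group_algebra cp] Mm add_zero op_zero_adjointable)
  qed (auto simp: M0)
  obtain C where C: "\<And>x. x \<in> amplification_norms M \<Longrightarrow> x \<le> C" using M_bdd
    by (auto simp: bdd_above_def)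
  have bound: "op_norm (M U) \<le> C" if U: "U \<in> reduced_group_algebra" "op_norm U \<le> 1" for U
  proof -
    have "matrix_op_norm 1 (\<lambda>i j. M U) \<in> amplification_norms M"
      unfolding amplification_norms_def
      by (intro CollectI exI[of _ 1] exI[of _ "\<lambda>i j. U"] conjI) (use U in \<open>auto simp only: matrix_op_norm_one\<close>)
    then show ?thesis using C by (simp only: matrix_op_norm_one)
  qed
  have aT: "T \<in> adjointable" and aMT: "M T \<in> adjointable"
    using T M_in group_algebra_adjointable by auto
  have small: "op_norm (M T) \<le> C * \<epsilon>" if \<epsilon>: "\<epsilon> > 0" for \<epsilon>
  proof -
    obtain d where d: "op_norm (op_diff T (scalar.cp_op d)) < \<epsilon>"
      using T \<epsilon> unfolding reduced_group_algebra_def trivial_action_def[symmetric] reduced_crossed_product_def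
        scalar.algebraic_crossed_product_eq[OF UNIV_I] by auto
    let ?D = "op_diff T (scalar.cp_op d)"
    have D: "?D \<in> reduced_group_algebra" using T cp by (simp add: op_diff_eq aT alg)
    have aD: "?D \<in> adjointable" using D by (rule group_algebra_adjointable)
    have eqT: "T = op_add (scalar.cp_op d) ?D"
    proof (rule extensionalityI[of _ ell2])
      show "T \<in> extensional ell2" using aT by (auto simp: adjointable_def PiE_def)
    qed (simp_all, simp add: op_add_def)
    have "M T = op_add (M (scalar.cp_op d)) (M ?D)" by (subst eqT) (rule M_add[OF cp D])
    then have MT: "M T = M ?D" using add_zero[OF group_algebra_adjointable[OF M_in[OF D]]]
      by (simp only: Mcp)
    \<comment> \<open>Scaling the error term to norm at most 1 makes the bound C applicable; undoing
      the scaling leaves a factor \<epsilon>.\<close>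
    let ?z = "complex_of_real (1 / \<epsilon>)"
    have "op_norm (op_scale ?z ?D) \<le> 1"
    proof -
      have "op_norm (op_scale ?z ?D) \<le> cmod ?z * op_norm ?D" by (rule op_norm_scale[OF aD])
      also have "\<dots> = op_norm ?D / \<epsilon>" using \<epsilon> by (simp add: norm_divide)
      also have "\<dots> \<le> 1" using d \<epsilon> by (simp add: divide_le_eq)
      finally show ?thesis .
    qed
    then have 1: "op_norm (op_scale ?z (M T)) \<le> C"
      using bound[OF alg(3)[OF D]] M_scale[OF D] by (simp only: MT)
    have eqMT: "M T = op_scale (complex_of_real \<epsilon>) (op_scale ?z (M T))"
    proof (rule extensionalityI[of _ ell2])
      show "M T \<in> extensional ell2" using aMT by (auto simp: adjointable_def PiE_def)
    qed (use \<epsilon> in \<open>simp_all add: scaleC_complex_def\<close>, simp add: op_scale_def)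
    have "op_norm (M T) \<le> cmod (complex_of_real \<epsilon>) * op_norm (op_scale ?z (M T))"
      by (subst eqMT) (rule op_norm_scale[OF op_scale_adjointable[OF aMT]])
    also have "\<dots> \<le> \<epsilon> * C" using 1 \<epsilon> by simp
    finally show ?thesis by (simp add: mult.commute)
  qed
  have "op_norm (M T) \<le> 0"
  proof (rule field_le_epsilon)
    fix e :: real assume e: "e > 0"
    have "op_norm (M T) \<le> C * (e / (\<bar>C\<bar> + 1))" using e by (intro small) (simp add: add_nonneg_pos)
    also have "\<dots> \<le> e"
    proof -
      have "C * e \<le> (\<bar>C\<bar> + 1) * e" using e by (intro mult_right_mono) auto
      then show ?thesis by (simp add: divide_le_eq add_nonneg_pos mult.commute)
    qed
    finally show "op_norm (M T) \<le> 0 + e" by simp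
  qed
  then show ?thesis using op_norm_nonneg[OF aMT] op_zero_eq_iff[OF aMT] by simp
qed

lemma matrix_op_norm_zero:
  assumes "\<And>i j. i < n \<Longrightarrow> j < n \<Longrightarrow> T i j = op_zero"
  shows "matrix_op_norm n T \<le> 0"
proof (rule matrix_op_norm_le)
  fix \<xi> :: "nat \<Rightarrow> 'a \<Rightarrow> complex" assume "\<forall>j<n. \<xi> j \<in> ell2"
  then have "(\<lambda>t. \<Sum>j<n. T i j (\<xi> j) t) = (\<lambda>t. 0)" if "i < n" for i
    using assms that by (intro ext sum.neutral) auto
  then show "sqrt (\<Sum>i<n. (ell2_norm (\<lambda>t. \<Sum>j<n. T i j (\<xi> j) t))\<^sup>2) \<le> 0" by simp
qed

text \<open>Makes the set whose supremum is \<open>Q_norm\<close> nonempty; only then does a bound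
  for its members bound the supremum.\<close>

lemma zero_multiplier:
  "(\<lambda>_::'g::group_add. 0) \<in> cb_multipliers" "cb_multiplier_norm (\<lambda>_::'g. 0) \<le> 1"
proof -
  define M :: "('g, complex) op \<Rightarrow> ('g, complex) op" where "M = (\<lambda>T\<in>reduced_group_algebra. op_zero)"
  have alg: "op_zero \<in> (reduced_group_algebra :: ('g, complex) op set)"
    "\<And>S T. S \<in> reduced_group_algebra \<Longrightarrow> T \<in> reduced_group_algebra \<Longrightarrow>
      op_add S T \<in> (reduced_group_algebra :: ('g, complex) op set)"
    "\<And>z T. T \<in> reduced_group_algebra \<Longrightarrow> op_scale z T \<in> (reduced_group_algebra :: ('g, complex) op set)"
    using op_cstar_subalgebra_group_algebra by (auto simp: op_cstar_subalgebra_def)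
  have "cb_multiplier_map (\<lambda>_. 0) M" unfolding cb_multiplier_map_def
  proof (intro conjI ballI allI)
    show "M \<in> reduced_group_algebra \<rightarrow>\<^sub>E reduced_group_algebra" by (auto simp: M_def alg(1))
    show "M (op_add S T) = op_add (M S) (M T)"
      if "S \<in> reduced_group_algebra" "T \<in> reduced_group_algebra" for S T
    proof -
      have "op_add op_zero op_zero = (op_zero :: ('g, complex) op)"
        unfolding op_add_def op_zero_def by (rule restrict_ext) simp
      then show ?thesis using that alg(2) by (simp add: M_def)
    qed
    show "M (op_scale z T) = op_scale z (M T)" if "T \<in> reduced_group_algebra" for z T
    proof -
      have "op_scale z op_zero = (op_zero :: ('g, complex) op)"
        unfolding op_scale_def op_zero_def by (rule restrict_ext) simp
      then show ?thesis using that alg(3) by (simp add: M_def)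
    qed
    show "M (shift_op s) = op_scale 0 (shift_op s)" for s
      using shift_op_group_algebra[of s] by (simp add: M_def) (simp add: op_scale_def op_zero_def)
    show "bdd_above (amplification_norms M)"
    proof (rule bdd_aboveI)
      fix x assume "x \<in> amplification_norms M"
      then show "x \<le> 0" unfolding amplification_norms_def
        by (auto intro!: matrix_op_norm_zero simp: M_def)
    qed
  qed
  then have ex: "\<exists>M. cb_multiplier_map (\<lambda>_::'g. 0) M" by blast
  then show "(\<lambda>_::'g. 0) \<in> cb_multipliers" by (simp add: cb_multipliers_def)
  define M' where "M' = (SOME M. cb_multiplier_map (\<lambda>_::'g. 0) M)"
  have M': "cb_multiplier_map (\<lambda>_. 0) M'" unfolding M'_def using ex by (rule someI_ex)
  have "Sup (amplification_norms M') \<le> 0"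
  proof (rule cSup_least)
    \<comment> \<open>The empty matrix shows that the set of amplification norms is
      nonempty.\<close>
    have "matrix_op_norm 0 (\<lambda>i j. M' op_zero) \<in> amplification_norms M'"
      unfolding amplification_norms_def
      by (intro CollectI exI[of _ 0] exI[of _ "\<lambda>i j. op_zero"] conjI)
        (auto intro: order_trans[OF matrix_op_norm_zero])
    then show "amplification_norms M' \<noteq> {}" by blast
    fix x assume "x \<in> amplification_norms M'"
    then show "x \<le> 0" unfolding amplification_norms_def
      by (auto intro!: matrix_op_norm_zero multiplier_map_zero[OF M'])
  qed
  then show "cb_multiplier_norm (\<lambda>_::'g. 0) \<le> 1" by (simp add: cb_multiplier_norm_def M'_def)
qed

text \<open>The distance from x to V in the seminorm \<nu>. A linear functional below it vanishes on
  V, which turns the Hahn-Banach theorem into a separation theorem.\<close>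

definition quotient_seminorm :: "('v::real_vector \<Rightarrow> real) \<Rightarrow> 'v set \<Rightarrow> 'v \<Rightarrow> real" where
  "quotient_seminorm \<nu> V x = (INF v\<in>V. \<nu> (x - v))"

lemma
  assumes \<nu>: "sublinear \<nu>" "\<And>x. 0 \<le> \<nu> x" and V: "subspace V"
  shows sublinear_quotient_seminorm: "sublinear (quotient_seminorm \<nu> V)"
    and quotient_seminorm_le: "\<And>x v. v \<in> V \<Longrightarrow> quotient_seminorm \<nu> V x \<le> \<nu> (x - v)"
    and quotient_seminorm_ge: "\<And>x c. (\<And>v. v \<in> V \<Longrightarrow> c \<le> \<nu> (x - v)) \<Longrightarrow> c \<le> quotient_seminorm \<nu> V x"
proof -
  let ?p = "quotient_seminorm \<nu> V"
  show le: "?p x \<le> \<nu> (x - v)" if "v \<in> V" for x v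
    unfolding quotient_seminorm_def
      by (rule cINF_lower[OF _ that]) (use \<nu>(2) in \<open>auto intro!: bdd_belowI2[where m = 0]\<close>)
  show ge: "c \<le> ?p x" if "\<And>v. v \<in> V \<Longrightarrow> c \<le> \<nu> (x - v)" for x c
    unfolding quotient_seminorm_def by (rule cINF_greatest) (use that subspace_0[OF V] in auto)
  show "sublinear ?p" unfolding sublinear_def
  proof (intro conjI allI impI)
    fix x y
    have "?p (x + y) - \<nu> (y - w) \<le> ?p x" if w: "w \<in> V" for w
    proof (rule ge)
      fix v assume v: "v \<in> V"
      have "?p (x + y) \<le> \<nu> ((x + y) - (v + w))" by (rule le[OF subspace_add[OF V v w]])
      also have "(x + y) - (v + w) = (x - v) + (y - w)" by simp
      also have "\<nu> ((x - v) + (y - w)) \<le> \<nu> (x - v) + \<nu> (y - w)" using \<nu>(1)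
        by (simp only: sublinear_def)
      finally show "?p (x + y) - \<nu> (y - w) \<le> \<nu> (x - v)" by simp
    qed
    then have "?p (x + y) - ?p x \<le> ?p y" by (intro ge) (smt (verit, best))
    then show "?p (x + y) \<le> ?p x + ?p y" by simp
  next
    fix c :: real and x :: 'a assume c: "c > 0"
    have "?p (c *\<^sub>R x) / c \<le> ?p x"
    proof (rule ge)
      fix v assume v: "v \<in> V"
      have "?p (c *\<^sub>R x) \<le> \<nu> (c *\<^sub>R x - c *\<^sub>R v)" by (rule le[OF subspace_scale[OF V v]])
      also have "c *\<^sub>R x - c *\<^sub>R v = c *\<^sub>R (x - v)" by (simp add: scaleR_diff_right)
      also have "\<nu> (c *\<^sub>R (x - v)) = c * \<nu> (x - v)" by (rule sublinear_scaleR[OF \<nu>(1) c])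
      finally show "?p (c *\<^sub>R x) / c \<le> \<nu> (x - v)" using c by (simp add: field_simps)
    qed
    then show "?p (c *\<^sub>R x) \<le> c * ?p x" using c by (simp add: field_simps)
  qed
qed

lemma lookup_scaleR_pm: "Poly_Mapping.lookup (r *\<^sub>R d) s = r *\<^sub>R Poly_Mapping.lookup d (s::'s)"
  for d :: "'s \<Rightarrow>\<^sub>0 'b::real_vector"
proof -
  have "finite {s. r *\<^sub>R Poly_Mapping.lookup d s \<noteq> 0}"
    by (rule finite_subset[OF _ finite_keys[of d]]) (auto simp: in_keys_iff)
  then show ?thesis by (simp add: scaleR_poly_mapping_def)
qed

lemma ell1_pairing_finite:
  assumes "finite F" "\<And>s. s \<notin> F \<Longrightarrow> f s = 0"
  shows "ell1_pairing f \<phi> = (\<Sum>s\<in>F. f s * \<phi> s)" "f \<in> ell1"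
proof -
  have "((\<lambda>s. f s * \<phi> s) has_sum (\<Sum>s\<in>F. f s * \<phi> s)) UNIV"
    by (rule has_sum_finite_neutralI[OF assms(1)]) (auto simp: assms(2))
  then show "ell1_pairing f \<phi> = (\<Sum>s\<in>F. f s * \<phi> s)" by (simp add: ell1_pairing_def infsumI)
  have "finite {s. cmod (f s) \<noteq> 0}" by (rule finite_subset[OF _ assms(1)]) (use assms(2) in auto)
  then show "f \<in> ell1" unfolding ell1_def by (auto intro!: finite_nonzero_values_imp_summable_on)
qed

section \<open>Separation by functionals and the use of the approximation property\<close>

context cstar_dynamics
begin

lemma cp_op_pm_scale_const: "cp_op (pm_scale (\<lambda>_. z) d) = op_scale z (cp_op d)"
proof (rule extensionalityI[of _ ell2])
  fix \<xi> :: "'g \<Rightarrow> 'b" assume \<xi>: "\<xi> \<in> ell2"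
  have "Poly_Mapping.keys (pm_scale (\<lambda>_. z) d) \<subseteq> Poly_Mapping.keys d" by (auto simp: in_keys_iff)
  then show "cp_op (pm_scale (\<lambda>_. z) d) \<xi> = op_scale z (cp_op d) \<xi>"
    using \<xi> by (simp add: cp_op_superset[of "Poly_Mapping.keys d"] monomial_scale scaleC_sum_right)
qed (simp_all add: cp_op_def op_scale_def)

lemma scaleR_eq_pm_scale: "r *\<^sub>R d = pm_scale (\<lambda>_. of_real r) (d :: 'g \<Rightarrow>\<^sub>0 'b)"
  by (rule poly_mapping_eqI) (simp add: lookup_scaleR_pm scaleC_of_real)

lemma cp_op_diff: "cp_op (d - e) = op_diff (cp_op d) (cp_op e)"
proof -
  have "cp_op ((d - e) + e) = op_add (cp_op (d - e)) (cp_op e)" by (rule cp_op_add)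
  then have eq: "cp_op d = op_add (cp_op (d - e)) (cp_op e)" by simp
  show ?thesis
    by (rule extensionalityI[of _ ell2]) (simp_all add: eq, simp_all add: cp_op_def op_diff_def)
qed

lemma sublinear_cp_norm: "sublinear (\<lambda>d. op_norm (cp_op d))"
  unfolding sublinear_def
proof (intro conjI allI impI)
  show "op_norm (cp_op (d + e)) \<le> op_norm (cp_op d) + op_norm (cp_op e)" for d e
    by (simp add: cp_op_add op_norm_triangle)
  show "op_norm (cp_op (c *\<^sub>R d)) \<le> c * op_norm (cp_op d)" if "c > 0" for c d
    using op_norm_scale[OF cp_op_adjointable, of "of_real c" d] that
    by (simp add: scaleR_eq_pm_scale cp_op_pm_scale_const)
qed

lemma pm_scale_sum_single:
  "pm_scale \<phi> d = (\<Sum>s\<in>Poly_Mapping.keys d. pm_scale (\<lambda>_. \<phi> s) (Poly_Mapping.single s (Poly_Mapping.lookup d s)))"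
  by (rule poly_mapping_eqI) (auto simp: lookup_sum lookup_single when_def in_keys_iff if_distrib cong: if_cong)

text \<open>The functional is built on finite sums and evaluated along a sequence \<open>d\<close>
  approximating T. The functions \<open>q (d n)\<close> represent an element of the completion Q,
  whose pairing with \<phi> is the limit of the values at the Fourier multiples of
  \<open>d n\<close> by \<phi>.\<close>

theorem reduced_crossed_product_synthesis:
  assumes AP: "has_AP TYPE('g)" and D: "cstar_subalgebra D"
    and T: "T \<in> reduced_crossed_product \<alpha> UNIV" and coeffs: "\<And>s b. has_coeff T s b \<Longrightarrow> b \<in> D"
  shows "T \<in> reduced_crossed_product \<alpha> D"
proof (rule ccontr)
  assume "T \<notin> reduced_crossed_product \<alpha> D"
  have D0: "0 \<in> D" and D_add: "\<And>x y. x \<in> D \<Longrightarrow> y \<in> D \<Longrightarrow> x + y \<in> D"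
    and D_scale: "\<And>z x. x \<in> D \<Longrightarrow> scaleC z x \<in> D"
    using D by (auto simp: cstar_subalgebra_def)
  have aT: "T \<in> adjointable" using T by (simp add: reduced_crossed_product_def)
  define V where "V = {e :: 'g \<Rightarrow>\<^sub>0 'b. \<forall>s. Poly_Mapping.lookup e s \<in> D}"
  define \<nu> where "\<nu> e = op_norm (cp_op e)" for e
  have \<nu>_nonneg: "0 \<le> \<nu> e" for e by (simp add: \<nu>_def op_norm_nonneg)
  have \<nu>: "sublinear \<nu>" unfolding \<nu>_def by (rule sublinear_cp_norm)
  have V: "subspace V"
    by (rule subspaceI) (auto simp: V_def D0 D_add lookup_add scaleR_eq_pm_scale D_scale)
  have "\<exists>\<delta>>0. \<forall>S\<in>algebraic_crossed_product \<alpha> D. \<not> op_norm (op_diff T S) < \<delta>"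
    using \<open>T \<notin> _\<close> aT unfolding reduced_crossed_product_def by blast
  then have "\<exists>\<delta>>0. \<forall>e\<in>V. \<delta> \<le> op_norm (op_diff T (cp_op e))"
    unfolding algebraic_crossed_product_eq[OF D0] V_def not_less by blast
  then obtain \<delta> where \<delta>: "\<delta> > 0" "\<And>e. e \<in> V \<Longrightarrow> \<delta> \<le> op_norm (op_diff T (cp_op e))" by blast
  obtain d where lim: "(\<lambda>n. op_norm (op_diff T (cp_op (d n)))) \<longlonglongrightarrow> 0"
    by (rule reduced_crossed_product_sequence[OF T]) auto
  have close: "\<exists>N. \<forall>n\<ge>N. op_norm (op_diff T (cp_op (d n))) < e" if "e > 0" for e
    using order_tendstoD(2)[OF lim that] unfolding eventually_sequentially .
  have diff: "\<nu> (d m - d n) \<le> op_norm (op_diff T (cp_op (d m))) + op_norm (op_diff T (cp_op (d n)))" for m n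
    using op_norm_diff_triangle[OF cp_op_adjointable aT cp_op_adjointable, of "d m" "d n"]
      op_norm_diff_commute[OF cp_op_adjointable aT, of "d m"]
    by (simp add: \<nu>_def cp_op_diff)
  \<comment> \<open>With \<delta>/4 here, \<open>d N\<close> keeps distance at least 3\<delta>/4
    from \<open>V\<close>, and f changes by less than \<delta>/2 between \<open>d N\<close> and any
    later \<open>d n\<close>, which leaves \<delta>/4.\<close>
  obtain N where N: "\<And>n. n \<ge> N \<Longrightarrow> op_norm (op_diff T (cp_op (d n))) < \<delta> / 4"
    using close[of "\<delta> / 4"] \<delta>(1) by auto
  let ?p = "quotient_seminorm \<nu> V"
  note p_le = quotient_seminorm_le[OF \<nu> \<nu>_nonneg V]
  obtain f where f: "linear f" "\<And>x. f x \<le> ?p x" "f (d N) = ?p (d N)"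
    using Hahn_Banach[OF sublinear_quotient_seminorm[OF \<nu> \<nu>_nonneg V]] by blast
  interpret f: linear f by (rule f(1))
  have f_le: "f x \<le> \<nu> x" for x using f(2)[of x] p_le[OF subspace_0[OF V], of x] by simp
  have f_V: "f v = 0" if "v \<in> V" for v
  proof -
    have 0: "\<nu> 0 = 0" by (rule sublinear_zero[OF \<nu>])
    have "f v \<le> 0" using f(2)[of v] p_le[OF that, of v] 0 by simp
    moreover have "f (- v) \<le> 0" using f(2)[of "- v"] p_le[OF subspace_neg[OF V that], of "- v"] 0
      by simp
    ultimately show ?thesis by (simp add: f.neg)
  qed
  have "3 * \<delta> / 4 \<le> ?p (d N)"
  proof (rule quotient_seminorm_ge[OF \<nu> \<nu>_nonneg V])
    fix v assume v: "v \<in> V"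
    have "\<delta> \<le> op_norm (op_diff T (cp_op v))" by (rule \<delta>(2)[OF v])
    also have "\<dots> \<le> op_norm (op_diff T (cp_op (d N))) + op_norm (op_diff (cp_op (d N)) (cp_op v))"
      by (intro op_norm_diff_triangle aT cp_op_adjointable)
    also have "op_norm (op_diff (cp_op (d N)) (cp_op v)) = \<nu> (d N - v)"
      by (simp add: \<nu>_def cp_op_diff)
    finally show "3 * \<delta> / 4 \<le> \<nu> (d N - v)" using N[of N] by simp
  qed
  then have f_lower: "\<delta> / 4 \<le> f (d n)" if "n \<ge> N" for n
    using f_le[of "d N - d n"] diff[of N n] N[OF that] N[of N] f(3) by (simp add: f.diff)
  let ?i = "\<lambda>e. pm_scale (\<lambda>_. \<i>) (e :: 'g \<Rightarrow>\<^sub>0 'b)"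
  \<comment> \<open>Complexification of f, because multipliers take complex values.\<close>
  define \<omega> where "\<omega> e = Complex (f e) (- f (?i e))" for e
  have \<omega>_add: "\<omega> (x + y) = \<omega> x + \<omega> y" for x y
  proof -
    have "?i (x + y) = ?i x + ?i y"
      by (rule poly_mapping_eqI) (simp add: lookup_add scaleC_add_right)
    then show ?thesis by (simp add: \<omega>_def f.add complex_eq_iff)
  qed
  have \<omega>_scale: "\<omega> (pm_scale (\<lambda>_. z) e) = z * \<omega> e" for z e
  proof -
    have 1: "pm_scale (\<lambda>_. z) e = Re z *\<^sub>R e + Im z *\<^sub>R ?i e"
      by (rule poly_mapping_eqI)
        (simp add: lookup_add lookup_scaleR_pm scaleC_of_real[symmetric] scaleC_scaleC scaleC_add_left[symmetric]
          complex_eq[symmetric] mult.commute)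
    have 2: "?i (pm_scale (\<lambda>_. z) e) = Re z *\<^sub>R ?i e - Im z *\<^sub>R e"
    proof (rule poly_mapping_eqI)
      fix s
      have "\<i> * z = of_real (Re z) * \<i> + of_real (- Im z)" by (simp add: complex_eq_iff)
      then have "scaleC (\<i> * z) x = Re z *\<^sub>R scaleC \<i> x - Im z *\<^sub>R x" for x :: 'b
        by (simp only: scaleC_add_left scaleC_scaleC[symmetric] scaleC_of_real) simp
      then show "Poly_Mapping.lookup (?i (pm_scale (\<lambda>_. z) e)) s
          = Poly_Mapping.lookup (Re z *\<^sub>R ?i e - Im z *\<^sub>R e) s"
        by (simp add: lookup_minus lookup_scaleR_pm scaleC_scaleC)
    qed
    have "f (pm_scale (\<lambda>_. z) e) = Re z * f e + Im z * f (?i e)" unfolding 1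
      by (simp add: f.add f.scale)
    moreover have "f (?i (pm_scale (\<lambda>_. z) e)) = Re z * f (?i e) - Im z * f e"
      unfolding 2 by (simp add: f.diff f.scale)
    ultimately show ?thesis by (simp add: \<omega>_def complex_eq_iff algebra_simps)
  qed
  have \<omega>_V: "\<omega> v = 0" if "v \<in> V" for v
  proof -
    have "?i v \<in> V" using that by (simp add: V_def D_scale)
    then show ?thesis using f_V[OF that] f_V[of "?i v"] by (simp add: \<omega>_def complex_eq_iff)
  qed
  \<comment> \<open>The factor 2 comes from adding the bounds for the real and imaginary parts; only
    continuity matters.\<close>
  have \<omega>_le: "cmod (\<omega> e) \<le> 2 * \<nu> e" for e
  proof -
    have f_abs: "\<bar>f x\<bar> \<le> \<nu> x" for x
    proof -
      have "\<nu> (- x) \<le> \<nu> x"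
        using op_norm_scale[OF cp_op_adjointable, of "-1" x]
        by (simp add: \<nu>_def cp_op_pm_scale_const[symmetric] scaleR_eq_pm_scale[of "-1", simplified])
      then show ?thesis using f_le[of x] f_le[of "- x"] by (simp add: f.neg abs_le_iff)
    qed
    have "\<nu> (?i e) \<le> \<nu> e"
      using op_norm_scale[OF cp_op_adjointable, of \<i> e] by (simp add: \<nu>_def cp_op_pm_scale_const)
    then show ?thesis using cmod_le[of "\<omega> e"] f_abs[of e] f_abs[of "?i e"] by (simp add: \<omega>_def)
  qed
  have \<omega>_sum: "\<omega> (sum g F) = (\<Sum>i\<in>F. \<omega> (g i))" for g :: "'g \<Rightarrow> 'g \<Rightarrow>\<^sub>0 'b" and F
    using \<omega>_V[OF subspace_0[OF V]] by (induction F rule: infinite_finite_induct) (auto simp: \<omega>_add)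
  \<comment> \<open>The value of \<omega> at the term of e over s. Pairing \<open>q e\<close> with
    \<phi> therefore evaluates \<omega> at the Fourier multiple of e by \<phi>.\<close>
  define q where "q e s = \<omega> (Poly_Mapping.single s (Poly_Mapping.lookup e s))" for e s
  have q_support: "q e s = 0" if "s \<notin> Poly_Mapping.keys e" for e s
    using that \<omega>_V[OF subspace_0[OF V]] by (simp add: q_def in_keys_iff)
  have q_diff: "q x s - q y s = q (x - y) s" for x y s
  proof -
    have "q x s = q (x - y) s + q y s"
      unfolding q_def \<omega>_add[symmetric] single_add[symmetric] lookup_minus by simp
    then show ?thesis by simp
  qed
  have pairing: "ell1_pairing (q e) \<phi> = \<omega> (pm_scale \<phi> e)" for e \<phi>
  proof -
    have "ell1_pairing (q e) \<phi> = (\<Sum>s\<in>Poly_Mapping.keys e. q e s * \<phi> s)"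
      by (rule ell1_pairing_finite) (auto simp: q_support)
    then show ?thesis
      by (subst pm_scale_sum_single) (simp add: \<omega>_sum \<omega>_scale q_def mult.commute)
  qed
  \<comment> \<open>Multipliers in the unit ball do not increase \<nu>, by
    \<open>op_norm_multiplier_le\<close>; this is what lets \<omega> define an element of Q.\<close>
  have Q_norm_le: "Q_norm (q e) \<le> 2 * \<nu> e" for e
    unfolding Q_norm_def
  proof (rule cSup_least)
    show "{cmod (ell1_pairing (q e) \<phi>) | \<phi>. \<phi> \<in> cb_multipliers \<and> cb_multiplier_norm \<phi> \<le> 1} \<noteq> {}"
      using zero_multiplier by blast
    fix x assume "x \<in> {cmod (ell1_pairing (q e) \<phi>) | \<phi>. \<phi> \<in> cb_multipliers \<and> cb_multiplier_norm \<phi> \<le> 1}"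
    then obtain \<phi> where \<phi>: "x = cmod (\<omega> (pm_scale \<phi> e))" "\<phi> \<in> cb_multipliers"
        "cb_multiplier_norm \<phi> \<le> 1"
      by (auto simp: pairing)
    show "x \<le> 2 * \<nu> e"
      using \<omega>_le[of "pm_scale \<phi> e"] op_norm_multiplier_le[OF \<phi>(2,3), of e] \<phi>(1) by (simp add: \<nu>_def)
  qed
  have Q: "(\<lambda>n. q (d n)) \<in> Q_Cauchy" unfolding Q_Cauchy_def
  proof (intro CollectI conjI allI impI)
    show "q (d n) \<in> ell1" for n by (rule ell1_pairing_finite(2)[OF finite_keys]) (rule q_support)
    fix e :: real assume "e > 0"
    then obtain M where M: "\<And>n. n \<ge> M \<Longrightarrow> op_norm (op_diff T (cp_op (d n))) < e / 4"
      using close[of "e / 4"] by auto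
    have "Q_norm (\<lambda>s. q (d m) s - q (d n) s) < e" if "m \<ge> M" "n \<ge> M" for m n
      using Q_norm_le[of "d m - d n"] diff[of m n] M[OF that(1)] M[OF that(2)] by (simp add: q_diff)
    then show "\<exists>N. \<forall>m\<ge>N. \<forall>n\<ge>N. Q_norm (\<lambda>s. q (d m) s - q (d n) s) < e" by blast
  qed
  \<comment> \<open>Only finitely many coefficients enter; each converges to a coefficient of T,
    which lies in D and is therefore annihilated by \<omega>.\<close>
  have fin: "Q_pairing (\<lambda>n. q (d n)) \<phi> = 0" if \<phi>: "finite {s. \<phi> s \<noteq> 0}" for \<phi>
  proof -
    let ?F = "{s. \<phi> s \<noteq> 0}"
    have eq: "ell1_pairing (q (d n)) \<phi> = (\<Sum>s\<in>?F. q (d n) s * \<phi> s)" for n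
    proof -
      have "((\<lambda>s. q (d n) s * \<phi> s) has_sum (\<Sum>s\<in>?F. q (d n) s * \<phi> s)) UNIV"
        by (rule has_sum_finite_neutralI[OF \<phi>]) auto
      then show ?thesis by (simp add: ell1_pairing_def infsumI)
    qed
    have "(\<lambda>n. q (d n) s) \<longlonglongrightarrow> 0" for s
    proof -
      obtain b where b: "(\<lambda>n. Poly_Mapping.lookup (d n) s) \<longlonglongrightarrow> b" "has_coeff T s b"
        by (rule has_coeff_limit[OF aT cp_op_adjointable lim has_coeff_cp_op]) blast
      have "Poly_Mapping.single s b \<in> V" using coeffs[OF b(2)] D0
        by (simp add: V_def lookup_single when_def)
      then have \<omega>b: "\<omega> (Poly_Mapping.single s b) = 0" by (rule \<omega>_V)
      have "cmod (q (d n) s) \<le> 2 * norm (Poly_Mapping.lookup (d n) s - b)" for n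
      proof -
        have "q (d n) s = \<omega> (Poly_Mapping.single s (Poly_Mapping.lookup (d n) s - b)) + \<omega> (Poly_Mapping.single s b)"
          unfolding q_def \<omega>_add[symmetric] single_add[symmetric] by simp
        then show ?thesis
          using \<omega>b \<omega>_le[of "Poly_Mapping.single s (Poly_Mapping.lookup (d n) s - b)"]
            op_norm_monomial[of s "Poly_Mapping.lookup (d n) s - b"]
              by (simp add: \<nu>_def cp_op_single)
      qed
      note bound = this
      have "(\<lambda>n. 2 * norm (Poly_Mapping.lookup (d n) s - b)) \<longlonglongrightarrow> 2 * norm (b - b)"
        by (intro tendsto_intros b(1))
      then have "(\<lambda>n. 2 * norm (Poly_Mapping.lookup (d n) s - b)) \<longlonglongrightarrow> 0" by simp
      then show ?thesis
        by (rule Lim_null_comparison[rotated]) (rule always_eventually, rule allI, rule bound)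
    qed
    then have "(\<lambda>n. \<Sum>s\<in>?F. q (d n) s * \<phi> s) \<longlonglongrightarrow> (\<Sum>s\<in>?F. 0 * \<phi> s)"
      by (intro tendsto_intros)
    then show ?thesis by (simp add: Q_pairing_def eq limI)
  qed
  have one: "Q_pairing (\<lambda>n. q (d n)) (\<lambda>_. 1) \<noteq> 0"
  proof -
    have eq: "ell1_pairing (q (d n)) (\<lambda>_. 1) = \<omega> (d n)" for n
    proof -
      have "pm_scale (\<lambda>_. 1) (d n) = d n" by (rule poly_mapping_eqI) simp
      then show ?thesis by (simp add: pairing)
    qed
    have \<omega>_diff: "\<omega> (x - y) = \<omega> x - \<omega> y" for x y using \<omega>_add[of "x - y" y] by simp
    have "Cauchy (\<lambda>n. \<omega> (d n))"
    proof (rule metric_CauchyI)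
      fix e :: real assume "e > 0"
      then obtain M where M: "\<And>n. n \<ge> M \<Longrightarrow> op_norm (op_diff T (cp_op (d n))) < e / 4"
        using close[of "e / 4"] by auto
      have "dist (\<omega> (d m)) (\<omega> (d n)) < e" if "m \<ge> M" "n \<ge> M" for m n
        using \<omega>_le[of "d m - d n"] diff[of m n] M[OF that(1)] M[OF that(2)]
          by (simp add: dist_norm \<omega>_diff)
      then show "\<exists>M. \<forall>m\<ge>M. \<forall>n\<ge>M. dist (\<omega> (d m)) (\<omega> (d n)) < e" by blast
    qed
    then obtain l where l: "(\<lambda>n. \<omega> (d n)) \<longlonglongrightarrow> l" using Cauchy_convergent convergent_def by blast
    have "(\<lambda>n. f (d n)) \<longlonglongrightarrow> Re l" using tendsto_Re[OF l] by (simp add: \<omega>_def)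
    then have "\<delta> / 4 \<le> Re l" by (rule LIMSEQ_le_const) (use f_lower in blast)
    then show ?thesis using \<delta>(1) limI[OF l] by (auto simp: Q_pairing_def eq)
  qed
  \<comment> \<open>A neighbourhood of the constant 1 that excludes every finitely supported
    function.\<close>
  let ?O = "{\<phi> \<in> cb_multipliers. Q_pairing (\<lambda>n. q (d n)) \<phi> \<in> - {0}}"
  have "openin multiplier_topology ?O"
    unfolding multiplier_topology_def
    by (rule topology_generated_by_Basis) (use Q in \<open>auto intro!: exI[of _
        "\<lambda>n. q (d n)"] exI[of _ "- {0}"]\<close>)
  moreover have "(\<lambda>_::'g. 1) \<in> ?O"
  proof -
    \<comment> \<open>That 1 is a completely bounded multiplier is read off from the approximation
      property: a closure lies in the underlying space of the topology.\<close>
    have "(\<lambda>_::'g. 1) \<in> topspace multiplier_topology"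
      using AP unfolding has_AP_def in_closure_of by blast
    then have "(\<lambda>_::'g. 1) \<in> cb_multipliers"
      unfolding multiplier_topology_def topology_generated_by_topspace by auto
    then show ?thesis using one by simp
  qed
  moreover have "\<forall>U. (\<lambda>_::'g. 1) \<in> U \<and> openin multiplier_topology U \<longrightarrow>
      (\<exists>\<phi>. \<phi> \<in> {\<phi>. finite {s. \<phi> s \<noteq> 0}} \<and> \<phi> \<in> U)"
    using AP unfolding has_AP_def in_closure_of by (rule conjunct2)
  ultimately have "\<exists>\<phi>. \<phi> \<in> {\<phi>. finite {s. \<phi> s \<noteq> 0}} \<and> \<phi> \<in> ?O" by (metis (no_types, lifting))
  then show False using fin by auto
qed

end

section \<open>Compressing by centrally free sequences\<close>

text \<open>A finite set beyond N is dominated, at every state, by an interval containing it, since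
  the terms are positive. Convergence in the given order thus becomes unconditional.\<close>

lemma positive_summable_ell2:
  fixes a :: "nat \<Rightarrow> 'b::cstar_algebra"
  assumes "summable (\<lambda>i. star (a i) * a i)"
  shows "a \<in> ell2"
  unfolding ell2_def mem_Collect_eq summable_on_iff_tails
proof (intro allI impI)
  let ?f = "\<lambda>i. star (a i) * a i"
  fix e :: real assume "e > 0"
  then obtain N where N: "\<And>m n. m \<ge> N \<Longrightarrow> norm (sum ?f {m..<n}) < e"
    using assms unfolding summable_Cauchy by blast
  have "norm (sum ?f F) < e" if F: "finite F" "F \<inter> {..<N} = {}" for F
  proof -
    have sub: "F \<subseteq> {N..<Suc (Max (insert 0 F))}"
    proof
      fix i assume i: "i \<in> F"
      then have "i \<notin> {..<N}" using F(2) by blast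
      then show "i \<in> {N..<Suc (Max (insert 0 F))}" using i F(1) by (auto simp: less_Suc_eq_le)
    qed
    have "norm (sum ?f F) \<le> norm (sum ?f {N..<Suc (Max (insert 0 F))})"
    proof (rule positive_norm_le)
      fix \<rho> :: "'b \<Rightarrow> complex" assume \<rho>: "cstar_state \<rho>"
      have "Re (\<rho> (sum ?f F)) \<le> Re (\<rho> (sum ?f {N..<Suc (Max (insert 0 F))}))"
        using sub by (simp only: state_sum[OF \<rho>] Re_sum) (intro sum_mono2; simp add: state_nonneg[OF \<rho>])
      also have "\<dots> \<le> norm (sum ?f {N..<Suc (Max (insert 0 F))})" by (rule state_Re_le_norm[OF \<rho>])
      finally show "Re (\<rho> (sum ?f F)) \<le> norm (sum ?f {N..<Suc (Max (insert 0 F))})" .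
    qed (simp add: positive_sum)
    then show ?thesis using N[of N "Suc (Max (insert 0 F))"] by simp
  qed
  then show "\<exists>F0. finite F0 \<and> (\<forall>F. finite F \<and> F \<inter> F0 = {} \<longrightarrow> norm (sum ?f F) < e)"
    by (intro exI[of _ "{..<N}"]) auto
qed

lemma star_prod_partial_sums:
  assumes "a \<in> ell2" "b \<in> ell2"
  shows "(\<lambda>n. \<Sum>i<n. star (a i) * b i) \<longlonglongrightarrow> star_prod a b"
  unfolding star_prod_def
  by (rule summable_LIMSEQ[OF summable_on_imp_summable[OF ell2_inner_summable[OF assms]]])

lemma positive_partial_sum_norm_le:
  fixes a :: "nat \<Rightarrow> 'b::cstar_algebra"
  assumes "summable (\<lambda>i. star (a i) * a i)"
  shows "norm (\<Sum>i<n. star (a i) * a i) \<le> norm (suminf (\<lambda>i. star (a i) * a i))"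
proof (rule positive_norm_le)
  fix \<rho> :: "'b \<Rightarrow> complex" assume \<rho>: "cstar_state \<rho>"
  have "(\<lambda>i. Re (\<rho> (star (a i) * a i))) sums Re (\<rho> (suminf (\<lambda>i. star (a i) * a i)))"
    by (intro sums_Re bounded_linear.sums[OF bounded_linear_state[OF \<rho>]] summable_sums assms)
  then have "(\<Sum>i<n. Re (\<rho> (star (a i) * a i))) \<le> Re (\<rho> (suminf (\<lambda>i. star (a i) * a i)))"
    using sum_le_suminf[of "\<lambda>i. Re (\<rho> (star (a i) * a i))" "{..<n}"] state_nonneg[OF \<rho>]
    by (simp add: sums_iff)
  also have "\<dots> \<le> norm (suminf (\<lambda>i. star (a i) * a i))" by (rule state_Re_le_norm[OF \<rho>])
  finally show "Re (\<rho> (\<Sum>i<n. star (a i) * a i)) \<le> norm (suminf (\<lambda>i. star (a i) * a i))"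
    by (simp add: state_sum[OF \<rho>])
qed (simp add: positive_sum)

context cstar_dynamics
begin

text \<open>The partial sums of both series converge, so one truncation N serves both strict
  inequalities, while positivity keeps the truncated norm at most 1. Finite sums are needed for the
  compressions to stay in an operator algebra.\<close>

lemma centrally_free_finite:
  assumes free: "centrally_free \<alpha> A" and "\<epsilon> > 0" "s \<noteq> 0"
  obtains N a where "\<And>i. a i \<in> A" "norm (\<Sum>i<(N::nat). star (a i) * a i) \<le> 1"
    "norm ((\<Sum>i<N. star (a i) * (b * a i)) - b) < \<epsilon>"
    "norm (\<Sum>i<N. star (a i) * (c * \<alpha> s (a i))) < \<epsilon>"
proof -
  obtain a where a: "a \<in> ell2_seq A" "ell2_seq_norm a \<le> 1"
    and b: "norm (star_prod a (\<lambda>i. b * a i) - b) < \<epsilon>"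
    and c: "norm (star_prod a (\<lambda>i. c * \<alpha> s (a i))) < \<epsilon>"
    using assms unfolding centrally_free_def by blast
  have aA: "\<And>i. a i \<in> A" and sm: "summable (\<lambda>i. star (a i) * a i)"
    using a(1) by (auto simp: ell2_seq_def)
  have a2: "a \<in> ell2" by (rule positive_summable_ell2[OF sm])
  have ba: "(\<lambda>i. b * a i) \<in> ell2" by (rule ell2_mult_left[OF a2 order_refl])
  have "(\<lambda>i. \<alpha> s (star (a i) * a i)) summable_on UNIV"
    by (rule summable_on_bounded_linear[OF bounded_linear_act ell2_summable[OF a2], unfolded o_def])
  then have "(\<lambda>i. \<alpha> s (a i)) \<in> ell2" by (simp add: ell2_def act_mult act_star)
  then have ca: "(\<lambda>i. c * \<alpha> s (a i)) \<in> ell2" by (rule ell2_mult_left[OF _ order_refl])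
  have "(\<lambda>n. norm ((\<Sum>i<n. star (a i) * (b * a i)) - b)) \<longlonglongrightarrow> norm (star_prod a (\<lambda>i. b * a i) - b)"
    by (intro tendsto_intros star_prod_partial_sums a2 ba)
  then have ev1: "\<forall>\<^sub>F n in sequentially. norm ((\<Sum>i<n. star (a i) * (b * a i)) - b) < \<epsilon>"
    using b by (rule order_tendstoD(2))
  have "(\<lambda>n. norm (\<Sum>i<n. star (a i) * (c * \<alpha> s (a i)))) \<longlonglongrightarrow> norm (star_prod a (\<lambda>i. c * \<alpha> s (a i)))"
    by (intro tendsto_intros star_prod_partial_sums a2 ca)
  then have ev2: "\<forall>\<^sub>F n in sequentially. norm (\<Sum>i<n. star (a i) * (c * \<alpha> s (a i))) < \<epsilon>"
    using c by (rule order_tendstoD(2))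
  obtain N where "norm ((\<Sum>i<N. star (a i) * (b * a i)) - b) < \<epsilon>"
    "norm (\<Sum>i<N. star (a i) * (c * \<alpha> s (a i))) < \<epsilon>"
    using eventually_happens[OF eventually_conj[OF ev1 ev2]] by auto
  moreover have "norm (\<Sum>i<N. star (a i) * a i) \<le> 1"
    using positive_partial_sum_norm_le[OF sm, of N] a(2) by (simp add: ell2_seq_norm_def)
  ultimately show ?thesis using that aA by blast
qed

definition sandwich :: "nat \<Rightarrow> (nat \<Rightarrow> 'b) \<Rightarrow> ('g, 'b) op \<Rightarrow> ('g, 'b) op" where
  "sandwich N a T = (\<lambda>\<xi>\<in>ell2. \<lambda>t. \<Sum>i<N. monomial 0 (star (a i)) (T (monomial 0 (a i) \<xi>)) t)"

lemma sandwich_apply: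
  "\<xi> \<in> ell2 \<Longrightarrow> sandwich N a T \<xi> = (\<lambda>t. \<Sum>i<N. monomial 0 (star (a i)) (T (monomial 0 (a i) \<xi>)) t)"
  by (simp add: sandwich_def)

lemma sandwich_in:
  assumes C: "op_cstar_subalgebra C" and T: "T \<in> C"
    and m: "\<And>i. monomial 0 (a i) \<in> C" "\<And>i. monomial 0 (star (a i)) \<in> C"
  shows "sandwich N a T \<in> C"
proof (induction N)
  case 0
  have "sandwich 0 a T = op_zero" by (simp add: sandwich_def op_zero_def)
  then show ?case using C by (simp add: op_cstar_subalgebra_def)
next
  case (Suc N)
  let ?M = "compose ell2 (compose ell2 (monomial 0 (star (a N))) T) (monomial 0 (a N))"
  have "sandwich (Suc N) a T = op_add (sandwich N a T) ?M"
  proof (rule extensionalityI[of _ ell2])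
    fix \<xi> :: "'g \<Rightarrow> 'b" assume \<xi>: "\<xi> \<in> ell2"
    then show "sandwich (Suc N) a T \<xi> = op_add (sandwich N a T) ?M \<xi>"
      by (simp add: sandwich_apply compose_eq monomial_ell2)
  qed (simp_all add: sandwich_def op_add_def)
  moreover have "?M \<in> C" using C T m unfolding op_cstar_subalgebra_def by blast
  ultimately show ?case using C Suc unfolding op_cstar_subalgebra_def by metis
qed

text \<open>Lets \<open>sandwich_in\<close> also yield that compressions are adjointable.\<close>

lemma op_cstar_subalgebra_adjointable: "op_cstar_subalgebra (adjointable :: ('g, 'b) op set)"
  unfolding op_cstar_subalgebra_def
proof (intro conjI ballI allI impI)
  fix T :: "('g, 'b) op" assume T: "T \<in> adjointable"
  obtain S where S: "S \<in> ell2 \<rightarrow>\<^sub>E ell2" "is_adjoint T S" by (rule adjointable_adjoint[OF T])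
  show "\<exists>S\<in>adjointable. is_adjoint T S" using S adjoint_adjointable(1)[OF T S] by blast
qed (auto simp: op_zero_adjointable op_add_adjointable compose_adjointable op_scale_adjointable)

lemma sandwich_adjointable: "T \<in> adjointable \<Longrightarrow> sandwich N a T \<in> adjointable"
  by (rule sandwich_in[OF op_cstar_subalgebra_adjointable]) auto

lemma sandwich_diff:
  assumes "S \<in> adjointable" "T \<in> adjointable"
  shows "sandwich N a (op_diff S T) = op_diff (sandwich N a S) (sandwich N a T)"
proof (rule extensionalityI[of _ ell2])
  fix \<xi> :: "'g \<Rightarrow> 'b" assume \<xi>: "\<xi> \<in> ell2"
  then show "sandwich N a (op_diff S T) \<xi> = op_diff (sandwich N a S) (sandwich N a T) \<xi>"
    by (simp add: sandwich_apply monomial_ell2 adjointable_diff[OF monomial_adjointable]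
        adjointable_ell2[OF assms(1)] adjointable_ell2[OF assms(2)] sum_subtractf)
qed (simp_all add: sandwich_def op_diff_def)

section \<open>Contractivity of the compressions and their effect on coefficients\<close>

lemma monomial_zero_adjoint: "is_adjoint (monomial 0 b) (monomial 0 (star b))"
  using monomial_adjoint[of 0 b] by simp

text \<open>The left side is the value under \<rho> of the inner product of \<zeta> with h \<zeta>,
  where h is the sum of the \<open>star (a i) * a i\<close>, a contraction. So the column of the a i
  acts contractively at every state.\<close>

lemma column_bound:
  assumes h: "norm (\<Sum>i<N. star (a i) * a i) \<le> 1" and \<rho>: "cstar_state \<rho>" and \<zeta>: "\<zeta> \<in> ell2"
  shows "(\<Sum>i<N. state_square \<rho> (monomial 0 (a i) \<zeta>)) \<le> state_square \<rho> \<zeta>"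
proof -
  define h where "h = (\<Sum>i<N. star (a i) * a i)"
  have m: "monomial 0 b \<zeta> \<in> ell2" for b by (rule monomial_ell2[OF \<zeta>])
  have hz: "monomial 0 h \<zeta> = (\<lambda>t. \<Sum>i<N. monomial 0 (star (a i)) (monomial 0 (a i) \<zeta>) t)"
    by (simp only: monomial_apply[OF m])
      (simp add: monomial_apply[OF \<zeta>] h_def act_sum act_mult sum_distrib_right mult.assoc)
  have one: "ell2_inner (monomial 0 (a i) \<zeta>) (monomial 0 (a i) \<zeta>)
      = ell2_inner \<zeta> (monomial 0 (star (a i)) (monomial 0 (a i) \<zeta>))" for i
    by (rule is_adjointD[OF monomial_zero_adjoint \<zeta> m])
  have "(\<Sum>i<N. state_square \<rho> (monomial 0 (a i) \<zeta>)) = Re (\<rho> (ell2_inner \<zeta> (monomial 0 h \<zeta>)))"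
    unfolding hz state_square_def one
    by (simp add: ell2_inner_sum_right[OF \<zeta>] monomial_ell2 m state_sum[OF \<rho>])
  also have "\<dots> \<le> sqrt (state_square \<rho> \<zeta>) * sqrt (state_square \<rho> (monomial 0 h \<zeta>))"
    using state_inner_le[OF \<rho> \<zeta> m, of h] complex_Re_le_cmod order_trans by blast
  also have "\<dots> \<le> sqrt (state_square \<rho> \<zeta>) * sqrt (state_square \<rho> \<zeta>)"
  proof (intro mult_left_mono real_sqrt_le_mono)
    have "state_square \<rho> (monomial 0 h \<zeta>) \<le> (op_norm (monomial 0 h))\<^sup>2 * state_square \<rho> \<zeta>"
      by (rule state_square_adjointable_le[OF monomial_adjointable \<rho> \<zeta>])
    also have "\<dots> \<le> 1 * state_square \<rho> \<zeta>"
    proof (rule mult_right_mono)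
      have "op_norm (monomial 0 h) \<le> 1" using op_norm_monomial[of 0 h] assms(1) by (simp add: h_def)
      then show "(op_norm (monomial 0 h))\<^sup>2 \<le> 1"
        by (intro power_le_one op_norm_nonneg monomial_adjointable)
    qed (rule state_square_nonneg[OF \<rho> \<zeta>])
    finally show "state_square \<rho> (monomial 0 h \<zeta>) \<le> state_square \<rho> \<zeta>" by simp
  qed (simp add: state_square_nonneg[OF \<rho> \<zeta>])
  also have "\<dots> = state_square \<rho> \<zeta>" using state_square_nonneg[OF \<rho> \<zeta>] by simp
  finally show ?thesis .
qed

text \<open>The compression has the form V* diag(T, ..., T) V with the contractive column V of the a
  i. Written out, Cauchy-Schwarz over i combines two column bounds, for \<xi> and for its image, and
  one factor cancels.\<close>

lemma op_norm_sandwich: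
  assumes h: "norm (\<Sum>i<N. star (a i) * a i) \<le> 1" and T: "T \<in> adjointable"
  shows "op_norm (sandwich N a T) \<le> op_norm T"
proof (rule op_norm_le[OF op_norm_nonneg[OF T]])
  fix \<xi> :: "'g \<Rightarrow> 'b" assume \<xi>: "\<xi> \<in> ell2"
  let ?\<omega> = "sandwich N a T \<xi>"
  have \<omega>: "?\<omega> \<in> ell2" by (rule adjointable_ell2[OF sandwich_adjointable[OF T] \<xi>])
  have m\<omega>: "monomial 0 b ?\<omega> \<in> ell2" and m\<xi>: "monomial 0 b \<xi> \<in> ell2" for b
    by (rule monomial_ell2[OF \<omega>], rule monomial_ell2[OF \<xi>])
  have Tm: "T (monomial 0 b \<xi>) \<in> ell2" for b by (rule adjointable_ell2[OF T m\<xi>])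
  show "ell2_norm ?\<omega> \<le> op_norm T * ell2_norm \<xi>"
  proof (rule ell2_norm_le_states[OF \<omega>])
    fix \<rho> :: "'b \<Rightarrow> complex" assume \<rho>: "cstar_state \<rho>"
    let ?u = "\<lambda>i. sqrt (state_square \<rho> (monomial 0 (a i) ?\<omega>))"
    let ?v = "\<lambda>i. sqrt (state_square \<rho> (monomial 0 (a i) \<xi>))"
    let ?s = "state_square \<rho> ?\<omega>"
    have s: "?s \<ge> 0" by (rule state_square_nonneg[OF \<rho> \<omega>])
    have each: "Re (\<rho> (ell2_inner ?\<omega> (monomial 0 (star (a i)) (T (monomial 0 (a i) \<xi>)))))
        \<le> op_norm T * (?u i * ?v i)" for i
    proof -
      have "ell2_inner ?\<omega> (monomial 0 (star (a i)) (T (monomial 0 (a i) \<xi>)))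
          = ell2_inner (monomial 0 (a i) ?\<omega>) (T (monomial 0 (a i) \<xi>))"
        by (rule is_adjointD[OF monomial_zero_adjoint \<omega> Tm, symmetric])
      then have "Re (\<rho> (ell2_inner ?\<omega> (monomial 0 (star (a i)) (T (monomial 0 (a i) \<xi>)))))
          \<le> ?u i * sqrt (state_square \<rho> (T (monomial 0 (a i) \<xi>)))"
        using state_inner_le[OF \<rho> m\<omega> Tm, of "a i" "a i"] complex_Re_le_cmod order_trans by metis
      also have "\<dots> \<le> ?u i * sqrt ((op_norm T)\<^sup>2 * state_square \<rho> (monomial 0 (a i) \<xi>))"
        by (intro mult_left_mono real_sqrt_le_mono state_square_adjointable_le[OF T \<rho> m\<xi>])
          (simp add: state_square_nonneg[OF \<rho> m\<omega>])
      also have "\<dots> = op_norm T * (?u i * ?v i)"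
        by (simp add: real_sqrt_mult op_norm_nonneg[OF T])
      finally show ?thesis .
    qed
    have "?s = (\<Sum>i<N. Re (\<rho> (ell2_inner ?\<omega> (monomial 0 (star (a i)) (T (monomial 0 (a i) \<xi>))))))"
    proof -
      have "ell2_inner ?\<omega> ?\<omega> = (\<Sum>i<N. ell2_inner ?\<omega> (monomial 0 (star (a i)) (T (monomial 0 (a i) \<xi>))))"
        by (subst (2) sandwich_apply[OF \<xi>]) (rule ell2_inner_sum_right[OF \<omega> monomial_ell2[OF Tm]])
      then show ?thesis by (simp add: state_square_def state_sum[OF \<rho>])
    qed
    also have "\<dots> \<le> (\<Sum>i<N. op_norm T * (?u i * ?v i))" by (rule sum_mono[OF each])
    also have "\<dots> = op_norm T * (\<Sum>i<N. ?u i * ?v i)" by (simp add: sum_distrib_left)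
    also have "\<dots> \<le> op_norm T * (sqrt ?s * sqrt (state_square \<rho> \<xi>))"
    proof (rule mult_left_mono[OF _ op_norm_nonneg[OF T]])
      have "(\<Sum>i<N. ?u i * ?v i)\<^sup>2 \<le> (\<Sum>i<N. (?u i)\<^sup>2) * (\<Sum>i<N. (?v i)\<^sup>2)"
        by (rule Cauchy_Schwarz_ineq_sum)
      also have "\<dots> \<le> ?s * state_square \<rho> \<xi>"
        using column_bound[OF h \<rho> \<omega>] column_bound[OF h \<rho> \<xi>]
        by (intro mult_mono) (simp_all add: state_square_nonneg[OF \<rho>] m\<omega> m\<xi> \<omega> sum_nonneg)
      finally show "(\<Sum>i<N. ?u i * ?v i) \<le> sqrt ?s * sqrt (state_square \<rho> \<xi>)"
        by (simp add: real_le_rsqrt flip: real_sqrt_mult)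
    qed
    finally have main: "sqrt ?s * sqrt ?s \<le> (op_norm T * sqrt (state_square \<rho> \<xi>)) * sqrt ?s"
      using s by (simp add: algebra_simps)
    have "sqrt ?s \<le> op_norm T * sqrt (state_square \<rho> \<xi>)"
    proof (cases "?s = 0")
      case True
      then show ?thesis by (simp add: op_norm_nonneg[OF T] state_square_nonneg[OF \<rho> \<xi>])
    next
      case False
      then have "sqrt ?s > 0" using s by simp
      then show ?thesis using main by (simp only: mult_le_cancel_right_pos)
    qed
    also have "\<dots> \<le> op_norm T * ell2_norm \<xi>"
      by (intro mult_left_mono sqrt_state_square_le \<rho> op_norm_nonneg T)
    finally show "?s \<le> (op_norm T * ell2_norm \<xi>)\<^sup>2" by (rule sqrt_le_D)
  qed (simp add: op_norm_nonneg[OF T])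
qed

text \<open>At s = 0 this is the sum that central freeness keeps close to the old coefficient, at s
  \<noteq> 0 the twisted sum that it makes small.\<close>

definition sandwich_coeffs :: "nat \<Rightarrow> (nat \<Rightarrow> 'b) \<Rightarrow> ('g \<Rightarrow>\<^sub>0 'b) \<Rightarrow> 'g \<Rightarrow>\<^sub>0 'b" where
  "sandwich_coeffs N a d = Abs_poly_mapping (\<lambda>s. \<Sum>i<N. star (a i) * (Poly_Mapping.lookup d s * \<alpha> s (a i)))"

lemma lookup_sandwich_coeffs:
  "Poly_Mapping.lookup (sandwich_coeffs N a d) s = (\<Sum>i<N. star (a i) * (Poly_Mapping.lookup d s * \<alpha> s (a i)))"
proof -
  have "finite {s. (\<Sum>i<N. star (a i) * (Poly_Mapping.lookup d s * \<alpha> s (a i))) \<noteq> 0}"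
    by (rule finite_subset[OF _ finite_keys[of d]]) (auto simp: in_keys_iff)
  then show ?thesis by (simp add: sandwich_coeffs_def)
qed

lemma sandwich_cp_op: "sandwich N a (cp_op d) = cp_op (sandwich_coeffs N a d)"
proof (rule extensionalityI[of _ ell2])
  fix \<xi> :: "'g \<Rightarrow> 'b" assume \<xi>: "\<xi> \<in> ell2"
  have keys: "Poly_Mapping.keys (sandwich_coeffs N a d) \<subseteq> Poly_Mapping.keys d"
    by (auto simp: in_keys_iff lookup_sandwich_coeffs)
  show "sandwich N a (cp_op d) \<xi> = cp_op (sandwich_coeffs N a d) \<xi>"
  proof
    fix t
    have cp: "cp_op d \<zeta> t = (\<Sum>s\<in>Poly_Mapping.keys d. \<alpha> (- t) (Poly_Mapping.lookup d s) * \<zeta> (- s + t))"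
      if "\<zeta> \<in> ell2" for \<zeta>
      using cp_op_superset[OF finite_keys order_refl that] by (simp add: monomial_apply that)
    have "sandwich N a (cp_op d) \<xi> t = (\<Sum>i<N. \<alpha> (- t) (star (a i)) * cp_op d (monomial 0 (a i) \<xi>) t)"
      by (simp add: sandwich_apply[OF \<xi>] monomial_apply[OF adjointable_ell2[OF cp_op_adjointable
          monomial_ell2[OF \<xi>]]])
    also have "\<dots> = (\<Sum>i<N. \<Sum>s\<in>Poly_Mapping.keys d.
        \<alpha> (- t) (star (a i) * (Poly_Mapping.lookup d s * \<alpha> s (a i))) * \<xi> (- s + t))"
    proof (rule sum.cong[OF refl])
      fix i
      have "monomial 0 (a i) \<xi> (- s + t) = \<alpha> (- t) (\<alpha> s (a i)) * \<xi> (- s + t)" for s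
        unfolding monomial_apply[OF \<xi>] minus_add minus_minus act_plus by simp
      then show "\<alpha> (- t) (star (a i)) * cp_op d (monomial 0 (a i) \<xi>) t = (\<Sum>s\<in>Poly_Mapping.keys d.
        \<alpha> (- t) (star (a i) * (Poly_Mapping.lookup d s * \<alpha> s (a i))) * \<xi> (- s + t))"
        by (simp add: cp[OF monomial_ell2[OF \<xi>]] sum_distrib_left act_mult mult.assoc)
    qed
    also have "\<dots> = (\<Sum>s\<in>Poly_Mapping.keys d. \<Sum>i<N.
        \<alpha> (- t) (star (a i) * (Poly_Mapping.lookup d s * \<alpha> s (a i))) * \<xi> (- s + t))"
      by (rule sum.swap)
    also have "\<dots> = cp_op (sandwich_coeffs N a d) \<xi> t"
      by (simp add: cp_op_superset[OF finite_keys keys \<xi>] monomial_apply[OF \<xi>] lookup_sandwich_coeffs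
          act_sum sum_distrib_right)
    finally show "sandwich N a (cp_op d) \<xi> t = cp_op (sandwich_coeffs N a d) \<xi> t" .
  qed
qed (simp_all add: sandwich_def cp_op_def)

text \<open>Applying \<open>op_norm_sandwich\<close> to a single monomial isolates one
  coefficient.\<close>

lemma norm_sandwich_coeffs:
  assumes h: "norm (\<Sum>i<N. star (a i) * a i) \<le> 1"
  shows "norm (Poly_Mapping.lookup (sandwich_coeffs N a d) s) \<le> norm (Poly_Mapping.lookup d s)"
proof -
  let ?e = "Poly_Mapping.single s (Poly_Mapping.lookup d s)"
  have "norm (Poly_Mapping.lookup (sandwich_coeffs N a ?e) s)
      \<le> op_norm (cp_op (sandwich_coeffs N a ?e))"
    by (rule has_coeff_norm_le[OF cp_op_adjointable has_coeff_cp_op])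
  also have "\<dots> \<le> op_norm (cp_op ?e)"
    unfolding sandwich_cp_op[symmetric] by (rule op_norm_sandwich[OF h cp_op_adjointable])
  also have "\<dots> \<le> norm (Poly_Mapping.lookup d s)" unfolding cp_op_single by (rule op_norm_monomial)
  finally show ?thesis by (simp add: lookup_sandwich_coeffs)
qed

lemma op_norm_cp_op_le:
  assumes "finite F" "Poly_Mapping.keys d \<subseteq> F"
  shows "op_norm (cp_op d) \<le> (\<Sum>s\<in>F. norm (Poly_Mapping.lookup d s))"
proof (rule op_norm_le)
  fix \<xi> :: "'g \<Rightarrow> 'b" assume \<xi>: "\<xi> \<in> ell2"
  have "ell2_norm (cp_op d \<xi>) \<le> (\<Sum>s\<in>F. ell2_norm (monomial s (Poly_Mapping.lookup d s) \<xi>))"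
    unfolding cp_op_superset[OF assms \<xi>] by (rule ell2_norm_sum_le[OF monomial_ell2[OF \<xi>]])
  also have "\<dots> \<le> (\<Sum>s\<in>F. norm (Poly_Mapping.lookup d s) * ell2_norm \<xi>)"
    by (intro sum_mono monomial_norm_bound \<xi>)
  finally show "ell2_norm (cp_op d \<xi>) \<le> (\<Sum>s\<in>F. norm (Poly_Mapping.lookup d s)) * ell2_norm \<xi>"
    by (simp add: sum_distrib_right)
qed (simp add: sum_nonneg)

end

section \<open>Intermediate algebras\<close>

locale intermediate_op_algebra = cstar_dynamics \<alpha>
  for \<alpha> :: "'g::group_add \<Rightarrow> 'b::cstar_algebra \<Rightarrow> 'b" +
  fixes A :: "'b set" and C :: "('g, 'b) op set"
  assumes A: "cstar_subalgebra A" and A_inv: "action_invariant \<alpha> A" and free: "centrally_free \<alpha> A"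
    and C: "op_cstar_subalgebra C" and A_C: "reduced_crossed_product \<alpha> A \<subseteq> C"
    and C_B: "C \<subseteq> reduced_crossed_product \<alpha> UNIV"
begin

lemma C_add: "S \<in> C \<Longrightarrow> T \<in> C \<Longrightarrow> op_add S T \<in> C"
  and C_mult: "S \<in> C \<Longrightarrow> T \<in> C \<Longrightarrow> compose ell2 S T \<in> C"
  and C_scale: "T \<in> C \<Longrightarrow> op_scale z T \<in> C"
  and C_zero: "op_zero \<in> C"
  and C_adjointable: "T \<in> C \<Longrightarrow> T \<in> adjointable"
  and C_adjoint: "T \<in> C \<Longrightarrow> \<exists>S\<in>C. is_adjoint T S"
  and C_closed: "T \<in> adjointable \<Longrightarrow> (\<And>\<epsilon>. \<epsilon> > 0 \<Longrightarrow> \<exists>S\<in>C. op_norm (op_diff T S) < \<epsilon>) \<Longrightarrow> T \<in> C"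
  using C by (auto simp: op_cstar_subalgebra_def)

lemma A_zero: "0 \<in> A" and A_star: "x \<in> A \<Longrightarrow> star x \<in> A" and A_act: "x \<in> A \<Longrightarrow> \<alpha> s x \<in> A"
  using A A_inv by (auto simp: cstar_subalgebra_def action_invariant_def)

lemma monomial_A: "x \<in> A \<Longrightarrow> monomial s x \<in> C"
  using monomial_reduced[OF A_zero] A_C by blast

text \<open>One compression per element of F. Later compressions do not enlarge coefficients, so
  those already small stay small and no new support appears, and contractivity preserves the
  distance between x' and \<open>cp_op d'\<close>. The drift at 0 is paid for by halving
  \<epsilon>.\<close>

lemma kill_coefficients:
  assumes "finite F" "0 \<notin> F" and x: "x \<in> C" and "\<epsilon> > 0"
  shows "\<exists>x'\<in>C. \<exists>d'. op_norm (op_diff x' (cp_op d')) \<le> op_norm (op_diff x (cp_op d)) \<and>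
    (\<forall>s. norm (Poly_Mapping.lookup d' s) \<le> norm (Poly_Mapping.lookup d s)) \<and>
    norm (Poly_Mapping.lookup d' 0 - Poly_Mapping.lookup d 0) < \<epsilon> \<and>
    (\<forall>s\<in>F. norm (Poly_Mapping.lookup d' s) < \<epsilon>)"
  using assms(1,2,4)
proof (induction F arbitrary: \<epsilon>)
  case empty
  then show ?case using x by (intro bexI[of _ x] exI[of _ d]) auto
next
  case (insert s F)
  then obtain x1 d1 where 1: "x1 \<in> C"
    "op_norm (op_diff x1 (cp_op d1)) \<le> op_norm (op_diff x (cp_op d))"
    "\<And>r. norm (Poly_Mapping.lookup d1 r) \<le> norm (Poly_Mapping.lookup d r)"
    "norm (Poly_Mapping.lookup d1 0 - Poly_Mapping.lookup d 0) < \<epsilon> / 2"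
    "\<And>r. r \<in> F \<Longrightarrow> norm (Poly_Mapping.lookup d1 r) < \<epsilon> / 2"
    using insert.IH[of "\<epsilon> / 2"] by auto
  have "s \<noteq> 0" "\<epsilon> / 2 > 0" using insert.prems by auto
  obtain N a where a: "\<And>i. a i \<in> A" "norm (\<Sum>i<(N::nat). star (a i) * a i) \<le> 1"
    "norm ((\<Sum>i<N. star (a i) * (Poly_Mapping.lookup d1 0 * a i)) - Poly_Mapping.lookup d1 0) < \<epsilon> / 2"
    "norm (\<Sum>i<N. star (a i) * (Poly_Mapping.lookup d1 s * \<alpha> s (a i))) < \<epsilon> / 2"
    by (rule centrally_free_finite[OF free \<open>\<epsilon> / 2 > 0\<close> \<open>s \<noteq> 0\<close>]) blast
  let ?x = "sandwich N a x1" and ?d = "sandwich_coeffs N a d1"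
  have "?x \<in> C" by (rule sandwich_in[OF C 1(1)]) (auto intro: monomial_A A_star a(1))
  moreover have "op_norm (op_diff ?x (cp_op ?d)) \<le> op_norm (op_diff x (cp_op d))"
    unfolding sandwich_cp_op[symmetric] sandwich_diff[OF C_adjointable[OF 1(1)] cp_op_adjointable, symmetric]
    by (rule order_trans[OF op_norm_sandwich[OF a(2) op_diff_adjointable] 1(2)])
      (auto intro: C_adjointable 1(1))
  moreover have le: "norm (Poly_Mapping.lookup ?d r) \<le> norm (Poly_Mapping.lookup d1 r)" for r
    by (rule norm_sandwich_coeffs[OF a(2)])
  moreover have "norm (Poly_Mapping.lookup ?d 0 - Poly_Mapping.lookup d 0) < \<epsilon>"
  proof -
    have "norm (Poly_Mapping.lookup ?d 0 - Poly_Mapping.lookup d1 0) < \<epsilon> / 2"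
      using a(3) by (simp add: lookup_sandwich_coeffs)
    then show ?thesis
      using 1(4) norm_triangle_ineq[of "Poly_Mapping.lookup ?d 0 - Poly_Mapping.lookup d1 0"
          "Poly_Mapping.lookup d1 0 - Poly_Mapping.lookup d 0"] by simp
  qed
  moreover have "norm (Poly_Mapping.lookup ?d r) < \<epsilon>" if "r \<in> insert s F" for r
  proof (cases "r = s")
    case True
    then show ?thesis using a(4) \<open>\<epsilon> / 2 > 0\<close> by (simp add: lookup_sandwich_coeffs)
  next
    case False
    then show ?thesis using that 1(5)[of r] le[of r] \<open>\<epsilon> / 2 > 0\<close> by auto
  qed
  ultimately show ?case using order_trans[OF le 1(3)] by blast
qed

definition base :: "'b set" where
  "base = {b. monomial 0 b \<in> C}"

lemma coeff_zero_in_base: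
  assumes x: "x \<in> C" and b: "has_coeff x 0 b"
  shows "b \<in> base"
  unfolding base_def mem_Collect_eq
proof (rule C_closed[OF monomial_adjointable])
  fix \<epsilon> :: real assume \<epsilon>: "\<epsilon> > 0"
  have ax: "x \<in> adjointable" by (rule C_adjointable[OF x])
  obtain d where d: "op_norm (op_diff x (cp_op d)) < \<epsilon> / 4"
    using x C_B \<epsilon> unfolding reduced_crossed_product_def algebraic_crossed_product_eq[OF UNIV_I]
    by (fastforce dest: spec[of _ "\<epsilon> / 4"])
  define F where "F = Poly_Mapping.keys d - {0}"
  have F: "finite F" "0 \<notin> F" by (auto simp: F_def)
  \<comment> \<open>Error budget: \<epsilon>/2 for replacing b by the coefficient of d' at 0,
    \<epsilon>/4 for the terms over F, \<epsilon>/4 for the distance of x' from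
    \<open>cp_op d'\<close>. The summand 1 covers an empty F and gives \<eta> \<le>
    \<epsilon>/4.\<close>
  define \<eta> where "\<eta> = \<epsilon> / (4 * (card F + 1))"
  have \<eta>: "\<eta> > 0" "card F * \<eta> \<le> \<epsilon> / 4" "\<eta> \<le> \<epsilon> / 4"
  proof -
    have "4 * (card F + 1) * \<eta> = \<epsilon>" by (simp add: \<eta>_def)
    then have *: "4 * (card F * \<eta>) + 4 * \<eta> = \<epsilon>" by (simp add: algebra_simps)
    show pos: "\<eta> > 0" using \<epsilon> by (simp add: \<eta>_def)
    then have "0 \<le> card F * \<eta>" by simp
    then show "card F * \<eta> \<le> \<epsilon> / 4" "\<eta> \<le> \<epsilon> / 4" using * pos by linarith+
  qed
  obtain x' d' where x': "x' \<in> C" "op_norm (op_diff x' (cp_op d')) \<le> op_norm (op_diff x (cp_op d))"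
    "\<And>s. norm (Poly_Mapping.lookup d' s) \<le> norm (Poly_Mapping.lookup d s)"
    "norm (Poly_Mapping.lookup d' 0 - Poly_Mapping.lookup d 0) < \<eta>"
    "\<And>s. s \<in> F \<Longrightarrow> norm (Poly_Mapping.lookup d' s) < \<eta>"
    using kill_coefficients[OF F x \<eta>(1), of d] by blast
  let ?d0 = "Poly_Mapping.lookup d' 0"
  let ?e = "d' - Poly_Mapping.single 0 ?d0"
  have e: "Poly_Mapping.lookup ?e s = (if s = 0 then 0 else Poly_Mapping.lookup d' s)" for s
    by (simp add: lookup_minus lookup_single when_def)
  have "Poly_Mapping.keys ?e \<subseteq> F"
  proof
    fix s assume "s \<in> Poly_Mapping.keys ?e"
    then have "s \<noteq> 0" "Poly_Mapping.lookup d' s \<noteq> 0" by (auto simp: in_keys_iff e split: if_splits)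
    then show "s \<in> F" using x'(3)[of s] by (auto simp: F_def in_keys_iff)
  qed
  then have "op_norm (cp_op ?e) \<le> (\<Sum>s\<in>F. norm (Poly_Mapping.lookup ?e s))"
    by (rule op_norm_cp_op_le[OF F(1)])
  also have "\<dots> \<le> (\<Sum>s\<in>F. \<eta>)" using x'(5) F(2) by (intro sum_mono) (auto simp: e less_imp_le)
  finally have 1: "op_norm (op_diff (cp_op d') (monomial 0 ?d0)) \<le> \<epsilon> / 4"
    using \<eta>(2) by (simp add: cp_op_diff cp_op_single)
  have "norm (b - Poly_Mapping.lookup d 0) \<le> op_norm (op_diff x (cp_op d))"
    by (rule has_coeff_diff_norm_le[OF ax cp_op_adjointable b has_coeff_cp_op])
  then have "norm (b - ?d0) < \<epsilon> / 2"
    using x'(4) \<eta>(3) d norm_triangle_ineq4[of "b - Poly_Mapping.lookup d 0"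
        "?d0 - Poly_Mapping.lookup d 0"] by simp
  then have 2: "op_norm (op_diff (monomial 0 b) (monomial 0 ?d0)) < \<epsilon> / 2"
    using op_norm_monomial_diff[of 0 b ?d0] by simp
  have ax': "x' \<in> adjointable" by (rule C_adjointable[OF x'(1)])
  have "op_norm (op_diff (monomial 0 b) x') \<le> op_norm (op_diff (monomial 0 b) (monomial 0 ?d0))
      + (op_norm (op_diff (monomial 0 ?d0) (cp_op d')) + op_norm (op_diff (cp_op d') x'))"
    using op_norm_diff_triangle[OF monomial_adjointable[of 0 b] monomial_adjointable[of 0 ?d0] ax']
      op_norm_diff_triangle[OF monomial_adjointable[of 0 ?d0] cp_op_adjointable[of d'] ax'] by simp
  also have "\<dots> < \<epsilon>"
    using 1 2 d x'(2) op_norm_diff_commute[OF monomial_adjointable[of 0 ?d0] cp_op_adjointable[of d']]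
      op_norm_diff_commute[OF ax' cp_op_adjointable[of d']] by simp
  finally show "\<exists>S\<in>C. op_norm (op_diff (monomial 0 b) S) < \<epsilon>" using x'(1) by blast
qed

section \<open>The coefficient algebra is an invariant C*-subalgebra\<close>

lemma base_add: "x \<in> base \<Longrightarrow> y \<in> base \<Longrightarrow> x + y \<in> base"
  by (simp add: base_def monomial_add C_add)

lemma base_mult: "x \<in> base \<Longrightarrow> y \<in> base \<Longrightarrow> x * y \<in> base"
  using C_mult[of "monomial 0 x" "monomial 0 y"] by (simp add: base_def monomial_compose)

lemma base_zero: "0 \<in> base"
  by (simp add: base_def monomial_zero C_zero)

lemma base_sum: "(\<And>i. i \<in> F \<Longrightarrow> f i \<in> base) \<Longrightarrow> sum f F \<in> base"
  by (induction F rule: infinite_finite_induct) (auto simp: base_zero base_add)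

lemma A_base: "A \<subseteq> base"
  by (auto simp: base_def monomial_A)

lemma base_star: assumes "x \<in> base" shows "star x \<in> base"
proof -
  obtain S where S: "S \<in> C" "is_adjoint (monomial 0 x) S" using C_adjoint assms
    by (auto simp: base_def)
  have "S = monomial 0 (star x)"
  proof (rule adjoint_unique[OF S(2) monomial_zero_adjoint _ monomial_PiE monomial_ell2])
    show "S \<in> ell2 \<rightarrow>\<^sub>E ell2" using C_adjointable[OF S(1)] by (simp add: adjointable_def)
  qed
  then show ?thesis using S(1) by (simp add: base_def)
qed

lemma monomial_limit:
  assumes "\<And>\<epsilon>. \<epsilon> > 0 \<Longrightarrow> \<exists>c. monomial s c \<in> C \<and> norm (b - c) < \<epsilon>"
  shows "monomial s b \<in> C"
proof (rule C_closed[OF monomial_adjointable])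
  fix \<epsilon> :: real assume "\<epsilon> > 0"
  then obtain c where "monomial s c \<in> C" "norm (b - c) < \<epsilon>" using assms by blast
  then show "\<exists>S\<in>C. op_norm (op_diff (monomial s b) S) < \<epsilon>"
    using op_norm_monomial_diff[of s b c] by (intro bexI[of _ "monomial s c"]) auto
qed

lemma closed_base: "closed base"
  unfolding closed_sequential_limits
proof (intro allI impI)
  fix x l assume x: "(\<forall>n. x n \<in> base) \<and> x \<longlonglongrightarrow> l"
  have "monomial 0 l \<in> C"
  proof (rule monomial_limit)
    fix \<epsilon> :: real assume "\<epsilon> > 0"
    then obtain n where "norm (x n - l) < \<epsilon>" using x LIMSEQ_D[of x l \<epsilon>] by blast
    then show "\<exists>c. monomial 0 c \<in> C \<and> norm (l - c) < \<epsilon>"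
      using x by (intro exI[of _ "x n"]) (simp add: base_def norm_minus_commute)
  qed
  then show "l \<in> base" by (simp add: base_def)
qed

lemma cstar_subalgebra_base: "cstar_subalgebra base"
  unfolding cstar_subalgebra_def
  using base_zero base_add base_mult base_star closed_base
  by (auto simp: base_def monomial_scale C_scale)

text \<open>Central freeness with c = 0. It speaks only of s \<noteq> 0, hence the first assumption;
  the neutral element is treated directly where this is used.\<close>

lemma approximate_unit:
  assumes "s \<noteq> (0::'g)" "\<epsilon> > 0"
  obtains N a where "\<And>i. a i \<in> A" "norm (b - (\<Sum>i<(N::nat). star (a i) * (b * a i))) < \<epsilon>"
  using centrally_free_finite[OF free assms(2,1), of b 0] by (metis norm_minus_commute)

lemma monomial_sum_in: "(\<And>i. i \<in> F \<Longrightarrow> monomial s (f i) \<in> C) \<Longrightarrow> monomial s (sum f F) \<in> C"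
  by (induction F rule: infinite_finite_induct) (auto simp: monomial_zero monomial_add C_zero C_add)

lemma monomial_base:
  assumes b: "b \<in> base" shows "monomial s b \<in> C"
proof (cases "s = 0")
  case True
  then show ?thesis using b by (simp add: base_def)
next
  case False
  show ?thesis
  proof (rule monomial_limit)
    fix \<epsilon> :: real assume "\<epsilon> > 0"
    obtain N a where a: "\<And>i. a i \<in> A" "norm (b - (\<Sum>i<(N::nat). star (a i) * (b * a i))) < \<epsilon>"
      by (rule approximate_unit[OF False \<open>\<epsilon> > 0\<close>]) blast
    \<comment> \<open>A shift is available only together with an element of \<open>A\<close>: the
      term is the product of \<open>star (a i) * b\<close> at 0 and \<open>a i\<close> at s.\<close>
    have "monomial s (star (a i) * (b * a i)) \<in> C" for i
    proof -
      have "star (a i) \<in> base" using A_base A_star[OF a(1)] by blast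
      then have "monomial 0 (star (a i) * b) \<in> C" using base_mult b by (simp add: base_def)
      from C_mult[OF this monomial_A[OF a(1)], of s i] show ?thesis
        by (simp add: monomial_compose mult.assoc)
    qed
    then have "monomial s (\<Sum>i<N. star (a i) * (b * a i)) \<in> C" by (intro monomial_sum_in)
    then show "\<exists>c. monomial s c \<in> C \<and> norm (b - c) < \<epsilon>" using a(2) by blast
  qed
qed

lemma base_invariant: "action_invariant \<alpha> base"
  unfolding action_invariant_def
proof (intro allI ballI)
  fix s b assume b: "b \<in> base"
  show "\<alpha> s b \<in> base"
  proof (cases "s = 0")
    case True
    then show ?thesis using b by simp
  next
    case False
    have "monomial 0 (\<alpha> s b) \<in> C"
    proof (rule monomial_limit)
      fix \<epsilon> :: real assume "\<epsilon> > 0"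
      obtain N a where a: "\<And>i. a i \<in> A" "norm (\<alpha> s b - (\<Sum>i<(N::nat). star (a i) * (\<alpha> s b * a i))) < \<epsilon>"
        by (rule approximate_unit[OF False \<open>\<epsilon> > 0\<close>]) blast
      \<comment> \<open>The product of \<open>star (a i)\<close> at s, b at 0 and
        \<open>\<alpha> (- s) (a i)\<close> at - s: the two shifts conjugate b, and each has a
        factor from \<open>A\<close> attached.\<close>
      have "monomial 0 (star (a i) * (\<alpha> s b * a i)) \<in> C" for i
      proof -
        have "monomial 0 b \<in> C" using b by (simp add: base_def)
        from C_mult[OF C_mult[OF monomial_A[OF A_star[OF a(1)]] this] monomial_A[OF A_act[OF a(1)]],
            of s i "- s" "- s" i]
        show ?thesis by (simp add: monomial_compose mult.assoc)
      qed
      then have "monomial 0 (\<Sum>i<N. star (a i) * (\<alpha> s b * a i)) \<in> C" by (intro monomial_sum_in)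
      then show "\<exists>c. monomial 0 c \<in> C \<and> norm (\<alpha> s b - c) < \<epsilon>" using a(2) by blast
    qed
    then show ?thesis by (simp add: base_def)
  qed
qed

text \<open>Right multiplication by the shift by - s moves the coefficient at s to 0. The
  coefficient \<open>\<alpha> (- s) a\<close> is chosen so that the surviving factor is a
  itself.\<close>

lemma has_coeff_compose_monomial:
  assumes "has_coeff T s b"
  shows "has_coeff (compose ell2 T (monomial (- s) (\<alpha> (- s) a))) 0 (b * a)"
  unfolding has_coeff_def
proof (intro allI)
  fix t c
  have eq: "monomial (- s) (\<alpha> (- s) a) (ell2_single t c) = ell2_single (- s + t) (\<alpha> (- t) a * c)"
  proof
    fix u
    have "s + u = t \<longleftrightarrow> u = - s + t" by (metis add.assoc left_minus add_0 right_minus)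
    moreover have "\<alpha> (- (- s + t)) (\<alpha> (- s) a) = \<alpha> (- t) a"
      unfolding minus_add minus_minus act_plus by simp
    ultimately show "monomial (- s) (\<alpha> (- s) a) (ell2_single t c) u
        = ell2_single (- s + t) (\<alpha> (- t) a * c) u"
      by (auto simp: monomial_apply) (auto simp: ell2_single_def)
  qed
  show "compose ell2 T (monomial (- s) (\<alpha> (- s) a)) (ell2_single (- 0 + t) c) t
      = \<alpha> (- t) (b * a) * c"
    using assms by (simp add: compose_eq eq has_coeff_def act_mult mult.assoc)
qed

text \<open>The case s = 0, applied to x times a monomial, puts \<open>b * a\<close> into
  \<open>base\<close> for every a in \<open>A\<close>; and b is a limit of sums of
  \<open>star (a i) * (b * a i)\<close>.\<close>

lemma coeff_in_base:
  assumes x: "x \<in> C" and b: "has_coeff x s b"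
  shows "b \<in> base"
proof (cases "s = 0")
  case True
  then show ?thesis using coeff_zero_in_base[OF x] b by simp
next
  case False
  have ba: "b * a \<in> base" if "a \<in> A" for a
    by (rule coeff_zero_in_base[OF C_mult[OF x monomial_A[OF A_act[OF that]]] has_coeff_compose_monomial[OF b]])
  have "monomial 0 b \<in> C"
  proof (rule monomial_limit)
    fix \<epsilon> :: real assume "\<epsilon> > 0"
    obtain N a where a: "\<And>i. a i \<in> A" "norm (b - (\<Sum>i<(N::nat). star (a i) * (b * a i))) < \<epsilon>"
      by (rule approximate_unit[OF False \<open>\<epsilon> > 0\<close>]) blast
    have "(\<Sum>i<N. star (a i) * (b * a i)) \<in> base"
    proof (rule base_sum)
      fix i
      have "star (a i) \<in> base" using A_base A_star[OF a(1)] by blast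
      then show "star (a i) * (b * a i) \<in> base" by (rule base_mult[OF _ ba[OF a(1)]])
    qed
    then show "\<exists>c. monomial 0 c \<in> C \<and> norm (b - c) < \<epsilon>" using a(2) by (auto simp: base_def)
  qed
  then show ?thesis by (simp add: base_def)
qed

lemma reduced_base_subset: "reduced_crossed_product \<alpha> base \<subseteq> C"
proof
  fix T assume T: "T \<in> reduced_crossed_product \<alpha> base"
  have "S \<in> C" if "S \<in> algebraic_crossed_product \<alpha> base" for S
  proof (rule algebraic_crossed_product_induct[OF base_zero _ that])
    show "\<forall>x\<in>base. \<forall>y\<in>base. x + y \<in> base" using base_add by blast
  qed (auto intro: C_zero C_add monomial_base)
  then show "T \<in> C" using T unfolding reduced_crossed_product_def by (intro C_closed) blast+
qed

theorem eq_reduced_base: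
  assumes "has_AP TYPE('g)"
  shows "C = reduced_crossed_product \<alpha> base"
proof
  show "C \<subseteq> reduced_crossed_product \<alpha> base"
  proof
    fix x assume x: "x \<in> C"
    then show "x \<in> reduced_crossed_product \<alpha> base"
      using C_B coeff_in_base[OF x]
      by (intro reduced_crossed_product_synthesis[OF assms cstar_subalgebra_base]) auto
  qed
qed (rule reduced_base_subset)

end

section \<open>The lattices\<close>

lemma cstar_subalgebra_Inter:
  "(\<And>D. D \<in> \<D> \<Longrightarrow> cstar_subalgebra D) \<Longrightarrow> cstar_subalgebra (\<Inter>\<D>)"
  unfolding cstar_subalgebra_def by (auto intro: closed_Inter)

lemma cstar_subalgebra_generated: "cstar_subalgebra (cstar_generated X)"
  unfolding cstar_generated_def by (rule cstar_subalgebra_Inter) auto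

lemma subset_cstar_generated: "X \<subseteq> cstar_generated X"
  by (auto simp: cstar_generated_def)

lemma cstar_generated_least: "cstar_subalgebra D \<Longrightarrow> X \<subseteq> D \<Longrightarrow> cstar_generated X \<subseteq> D"
  by (auto simp: cstar_generated_def)

lemma (in cstar_dynamics) cstar_subalgebra_vimage_act:
  assumes "cstar_subalgebra D" shows "cstar_subalgebra (\<alpha> s -` D)"
proof -
  have "closed (\<alpha> s -` D)"
    using assms linear_continuous_on[OF bounded_linear_act, of UNIV s]
    by (intro closed_vimage) (auto simp: cstar_subalgebra_def)
  then show ?thesis using assms
    by (simp add: cstar_subalgebra_def act_add act_mult act_scaleC act_star)
qed

text \<open>The preimage of the generated algebra under \<open>\<alpha> s\<close> is a C*-subalgebra
  containing X, so it contains the generated algebra.\<close>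

lemma (in cstar_dynamics) action_invariant_generated:
  assumes "action_invariant \<alpha> X" shows "action_invariant \<alpha> (cstar_generated X)"
  unfolding action_invariant_def
proof (intro allI ballI)
  fix s x assume "x \<in> cstar_generated X"
  moreover have "X \<subseteq> \<alpha> s -` cstar_generated X"
    using assms subset_cstar_generated[of X] by (auto simp: action_invariant_def)
  ultimately show "\<alpha> s x \<in> cstar_generated X"
    using cstar_generated_least[OF cstar_subalgebra_vimage_act[OF cstar_subalgebra_generated]]
      by blast
qed

text \<open>Nonemptiness keeps the intersection inside \<open>adjointable\<close>. The adjoints
  found in the members coincide by uniqueness, so the adjoint lies in all of them.\<close>

lemma op_cstar_subalgebra_Inter:
  fixes \<C> :: "('g, 'b::cstar_algebra) op set set"
  assumes ne: "\<C> \<noteq> {}" and sub: "\<And>C. C \<in> \<C> \<Longrightarrow> op_cstar_subalgebra C"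
  shows "op_cstar_subalgebra (\<Inter>\<C>)"
  unfolding op_cstar_subalgebra_def
proof (intro conjI ballI allI impI)
  obtain C0 where C0: "C0 \<in> \<C>" using ne by blast
  show sub_adj: "\<Inter>\<C> \<subseteq> adjointable" using C0 sub[OF C0] by (auto simp: op_cstar_subalgebra_def)
  show "op_zero \<in> \<Inter>\<C>" using sub by (auto simp: op_cstar_subalgebra_def)
  fix S T assume "S \<in> \<Inter>\<C>" "T \<in> \<Inter>\<C>"
  then show "op_add S T \<in> \<Inter>\<C>" "compose ell2 S T \<in> \<Inter>\<C>"
    using sub by (auto simp: op_cstar_subalgebra_def)
next
  fix z T assume "T \<in> \<Inter>\<C>"
  then show "op_scale z T \<in> \<Inter>\<C>" using sub by (auto simp: op_cstar_subalgebra_def)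
next
  fix T assume T: "T \<in> \<Inter>\<C>"
  obtain C0 where C0: "C0 \<in> \<C>" using ne by blast
  have aT: "T \<in> adjointable" using T C0 sub[OF C0] by (auto simp: op_cstar_subalgebra_def)
  obtain S where S: "S \<in> ell2 \<rightarrow>\<^sub>E ell2" "is_adjoint T S" by (rule adjointable_adjoint[OF aT])
  have "S \<in> C" if "C \<in> \<C>" for C
  proof -
    have "op_cstar_subalgebra C" "T \<in> C" using T sub[OF that] that by auto
    then obtain S' where S': "S' \<in> C" "is_adjoint T S'" "S' \<in> adjointable"
      unfolding op_cstar_subalgebra_def by blast
    have "S = S'"
      by (rule adjoint_unique[OF S(2) S'(2) S(1)]) (use S'(3) aT in \<open>auto simp: adjointable_def\<close>)
    then show ?thesis using S'(1) by simp
  qed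
  then show "\<exists>S\<in>\<Inter>\<C>. is_adjoint T S" using S(2) by blast
next
  fix T assume "T \<in> adjointable" "\<forall>\<epsilon>>0. \<exists>S\<in>\<Inter>\<C>. op_norm (op_diff T S) < \<epsilon>"
  then show "T \<in> \<Inter>\<C>" using sub unfolding op_cstar_subalgebra_def by blast
qed

lemma op_cstar_subalgebra_generated:
  assumes "op_cstar_subalgebra R" "X \<subseteq> R"
  shows "op_cstar_subalgebra (op_cstar_generated X)" "op_cstar_generated X \<subseteq> R"
proof -
  show "op_cstar_subalgebra (op_cstar_generated X)"
    unfolding op_cstar_generated_def by (rule op_cstar_subalgebra_Inter) (use assms in auto)
  show "op_cstar_generated X \<subseteq> R" using assms by (auto simp: op_cstar_generated_def)
qed

lemma subset_op_cstar_generated: "X \<subseteq> op_cstar_generated X"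
  by (auto simp: op_cstar_generated_def)



theorem theorem4p5:
  fixes \<alpha> :: "'g::group_add \<Rightarrow> 'b::cstar_algebra \<Rightarrow> 'b"
    and A :: "'b set"
  assumes "has_AP TYPE('g)"
    and "cstar_action \<alpha>"
    and "cstar_subalgebra A"
    and "action_invariant \<alpha> A"
    and "centrally_free \<alpha> A"
  shows "lattice_isomorphism
    (intermediate_algebras \<alpha> A)
    (\<lambda>D E. D \<inter> E) (\<lambda>D E. cstar_generated (D \<union> E))
    (intermediate_op_algebras (reduced_crossed_product \<alpha> A) (reduced_crossed_product \<alpha> UNIV))
    (\<lambda>C D. C \<inter> D) (\<lambda>C D. op_cstar_generated (C \<union> D))
    (\<lambda>D. reduced_crossed_product \<alpha> D)"
proof -
  interpret cstar_dynamics \<alpha> by unfold_locales (rule assms(2))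
  let ?f = "reduced_crossed_product \<alpha>"
  let ?L = "intermediate_algebras \<alpha> A"
  let ?L' = "intermediate_op_algebras (?f A) (?f UNIV)"
  have L: "D \<in> ?L \<longleftrightarrow> cstar_subalgebra D \<and> action_invariant \<alpha> D \<and> A \<subseteq> D" for D
    by (simp add: intermediate_algebras_def)
  have L': "C \<in> ?L' \<longleftrightarrow> op_cstar_subalgebra C \<and> ?f A \<subseteq> C \<and> C \<subseteq> ?f UNIV" for C
    by (simp add: intermediate_op_algebras_def)
  have f_sub: "op_cstar_subalgebra (?f D)" if "D \<in> ?L" for D
    using that op_cstar_subalgebra_reduced by (simp add: L)
  have f_in: "?f D \<in> ?L'" if "D \<in> ?L" for D
    using that f_sub[OF that] reduced_crossed_product_mono[of A D] reduced_crossed_product_mono[of D UNIV]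
    by (simp add: L L')
  \<comment> \<open>Inclusions are reflected because the monomial of b at 0 detects membership of
    b.\<close>
  have f_le: "D \<subseteq> E" if "D \<in> ?L" "E \<in> ?L" "?f D \<subseteq> ?f E" for D E
  proof
    fix b assume b: "b \<in> D"
    have "0 \<in> D" "0 \<in> E" "closed E" using that by (auto simp: L cstar_subalgebra_def)
    then show "b \<in> E" using monomial_reduced[of D b 0] monomial_reduced_iff[of E 0 b] b that(3)
      by blast
  qed
  have f_surj: "\<exists>G\<in>?L. C = ?f G" if "C \<in> ?L'" for C
  proof -
    interpret intermediate_op_algebra \<alpha> A C
      using that assms by unfold_locales (auto simp: L')
    show ?thesis
      using eq_reduced_base[OF assms(1)] cstar_subalgebra_base base_invariant A_base
        by (auto simp: L)
  qed
  have UNIV_sub: "op_cstar_subalgebra (?f UNIV)"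
    by (rule op_cstar_subalgebra_reduced) (auto simp: cstar_subalgebra_def action_invariant_def)
  have meet: "D \<inter> E \<in> ?L" if "D \<in> ?L" "E \<in> ?L" for D E
    using that cstar_subalgebra_Inter[of "{D, E}"] by (auto simp: L action_invariant_def)
  have join: "cstar_generated (D \<union> E) \<in> ?L" if "D \<in> ?L" "E \<in> ?L" for D E
  proof -
    have "action_invariant \<alpha> (D \<union> E)" using that by (auto simp: L action_invariant_def)
    then show ?thesis
      using that subset_cstar_generated[of "D \<union> E"]
      by (auto simp: L cstar_subalgebra_generated action_invariant_generated)
  qed
  have meet': "C \<inter> C' \<in> ?L'" if "C \<in> ?L'" "C' \<in> ?L'" for C C'
    using that op_cstar_subalgebra_Inter[of "{C, C'}"] by (auto simp: L')
  have join': "op_cstar_generated (C \<union> C') \<in> ?L'" if "C \<in> ?L'" "C' \<in> ?L'" for C C'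
    using that op_cstar_subalgebra_generated[OF UNIV_sub, of
        "C \<union> C'"] subset_op_cstar_generated[of "C \<union> C'"]
    by (auto simp: L')
  have bij: "bij_betw ?f ?L ?L'"
    unfolding bij_betw_def
  proof
    show "inj_on ?f ?L" by (rule inj_onI) (metis f_le order_refl subset_antisym)
    show "?f ` ?L = ?L'" using f_in f_surj by blast
  qed
  have f_meet: "?f (D \<inter> E) = ?f D \<inter> ?f E" if D: "D \<in> ?L" and E: "E \<in> ?L" for D E
  proof
    show "?f (D \<inter> E) \<subseteq> ?f D \<inter> ?f E" by (simp add: reduced_crossed_product_mono)
    \<comment> \<open>By surjectivity the intersection is the crossed product by some G, and
      reflection of inclusions places G inside D and E; the two crossed products need not be
      intersected by hand.\<close>
    obtain G where G: "G \<in> ?L" "?f D \<inter> ?f E = ?f G" using f_surj[OF meet'[OF f_in[OF D] f_in[OF E]]]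
      by blast
    have "G \<subseteq> D" "G \<subseteq> E" using f_le[OF G(1) D] f_le[OF G(1) E] G(2) by auto
    then show "?f D \<inter> ?f E \<subseteq> ?f (D \<inter> E)" unfolding G(2) by (intro reduced_crossed_product_mono) simp
  qed
  have f_join: "?f (cstar_generated (D \<union> E)) = op_cstar_generated (?f D \<union> ?f E)"
    if D: "D \<in> ?L" and E: "E \<in> ?L" for D E
  proof
    have sub: "D \<subseteq> cstar_generated (D \<union> E)" "E \<subseteq> cstar_generated (D \<union> E)"
      using subset_cstar_generated[of "D \<union> E"] by auto
    show "op_cstar_generated (?f D \<union> ?f E) \<subseteq> ?f (cstar_generated (D \<union> E))"
      using reduced_crossed_product_mono[OF sub(1)] reduced_crossed_product_mono[OF sub(2)]
      by (intro op_cstar_subalgebra_generated(2) f_sub[OF join[OF D E]]) auto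
    \<comment> \<open>Dually, the generated operator algebra comes from some G, which contains D and
      E and hence the algebra that they generate.\<close>
    obtain G where G: "G \<in> ?L" "op_cstar_generated (?f D \<union> ?f E) = ?f G"
      using f_surj[OF join'[OF f_in[OF D] f_in[OF E]]] by blast
    have "?f D \<subseteq> ?f G" "?f E \<subseteq> ?f G" using subset_op_cstar_generated[of "?f D \<union> ?f E"] G(2) by auto
    then have "D \<subseteq> G" "E \<subseteq> G" using f_le D E G(1) by auto
    then have "cstar_generated (D \<union> E) \<subseteq> G" using G(1)
      by (intro cstar_generated_least) (auto simp: L)
    then show "?f (cstar_generated (D \<union> E)) \<subseteq> op_cstar_generated (?f D \<union> ?f E)"
      unfolding G(2) by (rule reduced_crossed_product_mono)
  qed
  show ?thesis
    unfolding lattice_isomorphism_def by (intro conjI ballI meet join meet' join' bij f_meet f_join)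
qed

end
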